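(* Let $\Sigma_{1,1}$ be a torus with one boundary component. If the volume entropy $h$ tends to $0$ in the Teichmüller space of $\Sigma_{1,1}$, then the boundary length $L$ tends to $\infty$; that is, for every sequence $(X_n)$ of hyperbolic metrics on $\Sigma_{1,1}$ with geodesic boundary such that $h_{\mathrm{vol}}(X_n)\to0$, one has $L(X_n)\to\infty$.
   Context: Hyperbolic metrics have constant curvature $-1$, and the boundary curve is a closed geodesic, whose length is $L$; both $h_{\mathrm{vol}}$ and $L$ are regarded as functions on the Teichmüller space of $\Sigma_{1,1}$. The volume entropy is $h_{\mathrm{vol}}=\lim_{R\to\infty}\frac{1}{R}\log\mathrm{Vol}\,B(x,R)$, where $B(x,R)$ is the ball of radius $R$ around a base point $x$ in the universal cover of $\Sigma_{1,1}$ with the lifted metric; this universal cover is a convex subset of $\mathbb{H}^2$ bounded by the lifts of the boundary curve. *)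

theory Defs
  imports "HOL-Analysis.Analysis"
begin

section \<open>The hyperbolic plane (upper half-plane model)\<close>

definition hplane :: "complex set" where
  "hplane = {z. Im z > 0}"

definition hdist :: "complex \<Rightarrow> complex \<Rightarrow> real" where
  "hdist z w = arcosh (1 + (cmod (z - w))\<^sup>2 / (2 * Im z * Im w))"

definition hball :: "complex \<Rightarrow> real \<Rightarrow> complex set" where
  "hball x R = {z \<in> hplane. hdist x z < R}"

text \<open>The Riemannian area $dx\,dy/y^2$; it is only ever evaluated on subsets of \<^term>\<open>hplane\<close>.\<close>

definition harea :: "complex measure" where
  "harea = density lborel (\<lambda>z. ennreal (1 / (Im z)\<^sup>2))"

text \<open>Geodesic segments of the hyperbolic plane are exactly its metric segments.\<close>

definition hsegment :: "complex \<Rightarrow> complex \<Rightarrow> complex set" where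
  "hsegment z w = {u \<in> hplane. hdist z u + hdist u w = hdist z w}"

definition hconvex :: "complex set \<Rightarrow> bool" where
  "hconvex C \<longleftrightarrow> C \<subseteq> hplane \<and> (\<forall>z\<in>C. \<forall>w\<in>C. hsegment z w \<subseteq> C)"

definition hline :: "complex set \<Rightarrow> bool" where
  "hline G \<longleftrightarrow> (\<exists>\<gamma>::real \<Rightarrow> complex. range \<gamma> = G \<and> G \<subseteq> hplane \<and>
                (\<forall>s t. hdist (\<gamma> s) (\<gamma> t) = \<bar>s - t\<bar>))"


section \<open>The torus with one boundary component\<close>

text \<open>
  The torus is the product of two unit circles, i.e. the square
  $[-\pi,\pi]^2$ with opposite sides identified by $(s,t) \mapsto (e^{is}, e^{it})$.
  Removing the open unit disc centred at the origin of the square leaves the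
  one-holed torus.
\<close>

definition Sigma11 :: "(complex \<times> complex) set" where
  "Sigma11 = {(cis s, cis t) | s t. \<bar>s\<bar> \<le> pi \<and> \<bar>t\<bar> \<le> pi \<and> 1 \<le> s\<^sup>2 + t\<^sup>2}"

definition bdry_curve :: "real \<Rightarrow> complex \<times> complex" where
  "bdry_curve \<theta> = (cis (cos (2 * pi * \<theta>)), cis (sin (2 * pi * \<theta>)))"

definition bdry_Sigma11 :: "(complex \<times> complex) set" where
  "bdry_Sigma11 = path_image bdry_curve"


section \<open>Length of curves\<close>

text \<open>
  The length of a curve parametrised by the unit interval, with respect to a
  distance function \<open>d\<close>: the supremum of the lengths of inscribed polygons.
\<close>

definition curve_length :: "('a \<Rightarrow> 'a \<Rightarrow> real) \<Rightarrow> (real \<Rightarrow> 'a) \<Rightarrow> ereal" where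
  "curve_length d \<gamma> =
     (SUP ts \<in> {ts. sorted ts \<and> set ts \<subseteq> {0..1}}.
        ereal (\<Sum>i < length ts - 1. d (\<gamma> (ts ! i)) (\<gamma> (ts ! Suc i))))"

definition length_metric_on :: "'a::topological_space set \<Rightarrow> ('a \<Rightarrow> 'a \<Rightarrow> real) \<Rightarrow> bool" where
  "length_metric_on S d \<longleftrightarrow>
     (\<forall>x\<in>S. \<forall>y\<in>S. ereal (d x y) =
        (INF \<gamma> \<in> {\<gamma>. path \<gamma> \<and> path_image \<gamma> \<subseteq> S \<and> pathstart \<gamma> = x \<and> pathfinish \<gamma> = y}.
           curve_length d \<gamma>))"


section \<open>Hyperbolic metrics with geodesic boundary\<close>

text \<open>
  The universal cover of the surface with metric \<open>d\<close>, realised as a closed convex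
  region \<open>C\<close> of the hyperbolic plane bounded by complete geodesics, the lifts of the
  boundary curve. Convexity makes \<open>C\<close> contractible, so the covering \<open>p\<close> is universal,
  and makes the restriction of \<^const>\<open>hdist\<close> to \<open>C\<close> a length metric; as \<open>p\<close> is a local
  isometry, this restriction is the lift of \<open>d\<close>.
\<close>

definition universal_cover ::
  "(complex \<times> complex \<Rightarrow> complex \<times> complex \<Rightarrow> real) \<Rightarrow> complex set \<Rightarrow>
   (complex \<Rightarrow> complex \<times> complex) \<Rightarrow> bool" where
  "universal_cover d C p \<longleftrightarrow>
     hconvex C \<and> closedin (top_of_set hplane) C \<and>
     covering_space C p Sigma11 \<and>
     (\<forall>x\<in>C. \<exists>r>0. \<forall>y \<in> C \<inter> hball x r. \<forall>z \<in> C \<inter> hball x r. d (p y) (p z) = hdist y z) \<and>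
     {x \<in> C. p x \<in> bdry_Sigma11} = hplane \<inter> frontier C \<and>
     (\<forall>K \<in> components (hplane \<inter> frontier C). hline K)"

text \<open>
  The metric is given by its distance function. Having a universal cover as above
  means being locally isometric to the hyperbolic plane (curvature $-1$) at interior
  points and to a closed half-plane at boundary points (geodesic boundary).
\<close>

definition hyperbolic_metric ::
  "(complex \<times> complex \<Rightarrow> complex \<times> complex \<Rightarrow> real) \<Rightarrow> bool" where
  "hyperbolic_metric d \<longleftrightarrow>
     Metric_space Sigma11 d \<and>
     Metric_space.mtopology Sigma11 d = top_of_set Sigma11 \<and>
     length_metric_on Sigma11 d \<and>
     (\<exists>C p. universal_cover d C p)"

definition boundary_length ::
  "(complex \<times> complex \<Rightarrow> complex \<times> complex \<Rightarrow> real) \<Rightarrow> ereal" where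
  "boundary_length d = curve_length d bdry_curve"

text \<open>
  The limit depends neither on the base point \<open>x\<close> nor on the chosen realisation
  \<open>(C, p)\<close> of the universal cover, which is unique up to isometry.
\<close>

definition volume_entropy ::
  "(complex \<times> complex \<Rightarrow> complex \<times> complex \<Rightarrow> real) \<Rightarrow> real" where
  "volume_entropy d =
     (SOME h. \<exists>C p x. universal_cover d C p \<and> x \<in> C \<and>
        ((\<lambda>R. ln (measure harea (C \<inter> hball x R)) / R) \<longlongrightarrow> h) at_top)"

end

theory Submission
  imports Defs
begin

text \<open>
  Let \<open>C\<close> be the universal cover, a convex region of the hyperbolic plane. The theorem holds
  because a bound \<open>L\<close> on the boundary length forces \<open>C\<close> to contain a binary tree whose edges
  have length at most \<open>3 * L + 79\<close>, which makes the entropy at least \<open>ln 2 / (3 * L + 79)\<close>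
  (\<open>volume_entropy_ge\<close>). An entropy that tends to \<open>0\<close> therefore rules out any bound on \<open>L\<close>.

  The tree is built from tripods. A tripod at \<open>y\<close> consists of three points at a distance between
  \<open>l\<close> and \<open>l'\<close> from \<open>y\<close> whose pairwise Gromov products at \<open>y\<close> are at most \<open>c\<close>, with \<open>l\<close> large
  compared to \<open>c\<close>. A path that arrives at \<open>y\<close> can be continued along at least two legs without
  backtracking, and hyperbolicity keeps the ends of different continuations apart. So if every point
  of a set carries a tripod with ends in that set, there are \<open>2 ^ n\<close> separated points at distance
  at most \<open>n * l'\<close> (\<open>tripod_tree\<close>).

  Tripods exist for two different reasons. If the boundary geodesics of \<open>C\<close> are far away from
  each other, the vicinity of a point of \<open>C\<close> is at worst bounded by a single geodesic, and a
  \<open>T\<close> whose stem points away from that geodesic fits into \<open>C\<close> (\<open>tripod_far\<close>). Otherwise some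
  geodesic \<open>K'\<close> comes close to another one, \<open>K\<close>, and two legs run along \<open>K\<close> in both directions while
  the third one follows \<open>K'\<close> (\<open>tripod_near\<close>). This is where \<open>L\<close> enters. As the boundary of the
  surface is a single curve of length \<open>L\<close>, some deck transformation translates \<open>K\<close> by at most \<open>L\<close>,
  and every boundary point of the surface has lifts within \<open>L\<close> of every point of \<open>K\<close> and of \<open>K'\<close>. The
  orthogonal projections of different boundary geodesics to \<open>K\<close> are disjoint, and the translates of
  \<open>K'\<close> along \<open>K\<close> are different geodesics, so the projection of \<open>K'\<close> to \<open>K\<close> is no longer than \<open>L\<close>
  (\<open>shadow_short\<close>). Thus \<open>K'\<close> leaves the vicinity of \<open>K\<close> at a bounded distance. Deck
  transformations move this single tripod to the whole orbit of its centre. The decisive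
  topological fact is thus that the boundary has only one component.

  The volume entropy is a limit, whose existence has to be shown as well. Up to bounded factors the
  volume of a ball counts the points of a deck orbit in the ball, these numbers are
  submultiplicative because \<open>C\<close> is convex and the surface is compact, and Fekete's argument gives the
  limit (\<open>entropy_limit_exists\<close>).

  All computations in the plane are linear algebra in the hyperboloid model; in the affine chart
  \<open>parab\<close> hyperbolic convexity becomes Euclidean convexity, which provides supporting lines along
  the boundary and the topology needed for lifting maps to \<open>C\<close>.
\<close>

section \<open>The hyperboloid model\<close>

type_synonym mvec = "real \<times> real \<times> real"

text \<open>
  The polar form of \<open>a * b - x\<^sup>2\<close>, the determinant of a symmetric matrix with
  diagonal \<open>a\<close>, \<open>b\<close> and off-diagonal entry \<open>x\<close>. It has
  signature (1, 2).
\<close>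

definition mink :: "mvec \<Rightarrow> mvec \<Rightarrow> real" where
  "mink v w = (fst v * fst (snd w) + fst w * fst (snd v)) / 2 - snd (snd v) * snd (snd w)"

text \<open>
  The embedding of the half-plane onto one sheet of the hyperboloid of determinant one. In these
  coordinates the form is exactly the hyperbolic cosine of the distance (\<open>mink_hvec\<close>).
\<close>

definition hvec :: "complex \<Rightarrow> mvec" where
  "hvec z = ((cmod z)\<^sup>2 / Im z, 1 / Im z, Re z / Im z)"

text \<open>
  Inverse of the embedding on its image.
\<close>

definition hpoint :: "mvec \<Rightarrow> complex" where
  "hpoint v = Complex (snd (snd v) / fst (snd v)) (1 / fst (snd v))"

lemma mink_commute: "mink v w = mink w v"
  by (simp add: mink_def algebra_simps)

lemma mink_bilinear [simp]:
  "mink (u + v) w = mink u w + mink v w" "mink w (u + v) = mink w u + mink w v"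
  "mink (u - v) w = mink u w - mink v w" "mink w (u - v) = mink w u - mink w v"
  "mink (c *\<^sub>R v) w = c * mink v w" "mink w (c *\<^sub>R v) = c * mink w v"
  "mink (- v) w = - mink v w" "mink w (- v) = - mink w v"
  "mink 0 w = 0" "mink w 0 = 0"
  by (simp_all add: mink_def algebra_simps add_divide_distrib diff_divide_distrib)

lemma continuous_on_mink [continuous_intros]:
  assumes "continuous_on S f" "continuous_on S g"
  shows "continuous_on S (\<lambda>x. mink (f x) (g x))"
  unfolding mink_def by (intro continuous_intros assms) auto

lemma hplane_Im [simp]: "z \<in> hplane \<Longrightarrow> Im z > 0" "z \<in> hplane \<Longrightarrow> Im z \<noteq> 0" "z \<in> hplane \<Longrightarrow> Im z \<ge> 0"
  by (simp_all add: hplane_def)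

lemma hplaneI: "Im z > 0 \<Longrightarrow> z \<in> hplane"
  unfolding hplane_def by (rule CollectI)

lemma cosh_eq_iff_nonneg: "x \<ge> 0 \<Longrightarrow> y \<ge> 0 \<Longrightarrow> cosh x = cosh y \<longleftrightarrow> x = (y::real)"
  by (metis cosh_real_nonneg_le_iff order_antisym order_refl)

lemma hdist_arg_ge_1:
  assumes "z \<in> hplane" "w \<in> hplane"
  shows "1 + (cmod (z - w))\<^sup>2 / (2 * Im z * Im w) \<ge> 1"
  using assms by simp

lemma cosh_hdist:
  assumes "z \<in> hplane" "w \<in> hplane"
  shows "cosh (hdist z w) = 1 + (cmod (z - w))\<^sup>2 / (2 * Im z * Im w)"
  unfolding hdist_def by (rule cosh_arcosh_real [OF hdist_arg_ge_1 [OF assms]])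

lemma hdist_nonneg [simp]:
  assumes "z \<in> hplane" "w \<in> hplane"
  shows "hdist z w \<ge> 0"
  unfolding hdist_def by (rule arcosh_nonneg_real [OF hdist_arg_ge_1 [OF assms]])

lemma hdist_commute: "hdist z w = hdist w z"
  by (simp add: hdist_def norm_minus_commute mult.commute mult.left_commute)

lemma mink_hvec:
  assumes "z \<in> hplane" "w \<in> hplane"
  shows "mink (hvec z) (hvec w) = cosh (hdist z w)"
proof -
  have "(cmod (z - w))\<^sup>2 = (cmod z)\<^sup>2 + (cmod w)\<^sup>2 - 2 * Re z * Re w - 2 * Im z * Im w"
    unfolding cmod_power2 by (simp add: power2_eq_square algebra_simps)
  then have "1 + (cmod (z - w))\<^sup>2 / (2 * Im z * Im w)
      = ((cmod z)\<^sup>2 + (cmod w)\<^sup>2 - 2 * Re z * Re w) / (2 * Im z * Im w)"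
    using hplane_Im(2) [OF assms(1)] hplane_Im(2) [OF assms(2)] by (simp add: field_simps)
  also have "\<dots> = mink (hvec z) (hvec w)"
    using hplane_Im(2) [OF assms(1)] hplane_Im(2) [OF assms(2)]
    by (simp add: mink_def hvec_def divide_simps)
  finally show ?thesis by (simp add: cosh_hdist [OF assms])
qed

lemma hdist_refl [simp]: "hdist z z = 0"
  by (simp add: hdist_def)

lemma mink_hvec_self: "z \<in> hplane \<Longrightarrow> mink (hvec z) (hvec z) = 1"
  by (simp add: mink_hvec)

lemma hpoint_hvec [simp]: "z \<in> hplane \<Longrightarrow> hpoint (hvec z) = z"
  by (simp add: hpoint_def hvec_def complex_eq_iff)

lemma hvec_inj: "z \<in> hplane \<Longrightarrow> w \<in> hplane \<Longrightarrow> hvec z = hvec w \<longleftrightarrow> z = w"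
  by (metis hpoint_hvec)

text \<open>
  The vectors of the hyperboloid are timelike in a form of signature (1, 2), so their orthogonal
  complements are negative definite. This is how vectors are shown to vanish below.
\<close>

lemma mink_orth_definite:
  assumes "z \<in> hplane" "mink (hvec z) v = 0" "mink v v \<ge> 0"
  shows "v = 0"
proof -
  obtain a b x where v: "v = (a, b, x)" by (metis prod_cases3)
  define X Y where "X = Re z" and "Y = Im z"
  have Y: "Y > 0" using assms by (simp add: Y_def)
  have "((X\<^sup>2 + Y\<^sup>2) / Y * b + a * (1 / Y)) / 2 - X / Y * x = 0"
    using assms(2) by (simp add: v mink_def hvec_def X_def Y_def cmod_power2)
  moreover have "((X\<^sup>2 + Y\<^sup>2) / Y * b + a * (1 / Y)) / 2 - X / Y * x
      = ((X\<^sup>2 + Y\<^sup>2) * b + a - 2 * X * x) / (2 * Y)"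
    using Y by (simp add: divide_simps)
  ultimately have a: "a = 2 * X * x - (X\<^sup>2 + Y\<^sup>2) * b"
    using Y by simp
  have "mink v v = a * b - x\<^sup>2" by (simp add: v mink_def power2_eq_square)
  also have "\<dots> = - ((x - X * b)\<^sup>2 + (Y * b)\<^sup>2)"
    by (simp add: a power2_eq_square algebra_simps)
  finally have "(x - X * b)\<^sup>2 + (Y * b)\<^sup>2 = 0"
    using assms(3) by (smt (verit) zero_le_power2)
  then have "Y * b = 0" "x - X * b = 0" by (simp_all add: sum_power2_eq_zero_iff)
  with Y have "b = 0" "x = 0" by simp_all
  with a v show ?thesis by (simp add: zero_prod_def)
qed

lemma hdist_eq_0_iff:
  assumes "z \<in> hplane" "w \<in> hplane"
  shows "hdist z w = 0 \<longleftrightarrow> z = w"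
proof
  assume "hdist z w = 0"
  with cosh_hdist [OF assms] have "(cmod (z - w))\<^sup>2 / (2 * Im z * Im w) = 0" by simp
  with assms show "z = w" by simp
qed simp

text \<open>
  The Cauchy-Schwarz inequality of the negative definite plane orthogonal to \<open>hvec z\<close>.
\<close>

lemma mink_cauchy:
  assumes "z \<in> hplane" "mink (hvec z) u = 0" "mink (hvec z) w = 0"
  shows "(mink u w)\<^sup>2 \<le> mink u u * mink w w"
proof -
  have neg: "mink v v \<le> 0" if "mink (hvec z) v = 0" for v
    using mink_orth_definite [OF assms(1) that] by fastforce
  show ?thesis
  proof (cases "mink w w = 0")
    case True
    then have "w = 0" using mink_orth_definite [OF assms(1,3)] by simp
    then show ?thesis by simp
  next
    case False
    then have ww: "mink w w < 0" using neg [OF assms(3)] by simp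
    define v where "v = mink w w *\<^sub>R u - mink u w *\<^sub>R w"
    have "mink v v \<le> 0" by (rule neg) (simp add: v_def assms)
    moreover have "mink v v = mink w w * (mink u u * mink w w - (mink u w)\<^sup>2)"
      by (simp add: v_def mink_commute [of w u] power2_eq_square algebra_simps)
    ultimately show ?thesis using ww by (simp add: mult_le_0_iff)
  qed
qed

text \<open>
  The hyperbolic law of cosines: the components of \<open>x\<close> and \<open>z\<close> orthogonal
  to \<open>y\<close> have lengths \<open>sinh a\<close> and \<open>sinh b\<close>, and the cosine
  of the angle between them is at least \<open>-1\<close> by Cauchy-Schwarz.
\<close>

lemma hdist_triangle:
  assumes "x \<in> hplane" "y \<in> hplane" "z \<in> hplane"
  shows "hdist x z \<le> hdist x y + hdist y z"
proof -
  define a b c where "a = hdist x y" and "b = hdist y z" and "c = hdist x z"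
  have nn: "a \<ge> 0" "b \<ge> 0" "c \<ge> 0" using assms by (simp_all add: a_def b_def c_def)
  define u w where "u = hvec x - cosh a *\<^sub>R hvec y" and "w = hvec z - cosh b *\<^sub>R hvec y"
  have m: "mink (hvec x) (hvec y) = cosh a" "mink (hvec y) (hvec x) = cosh a"
    "mink (hvec y) (hvec z) = cosh b" "mink (hvec z) (hvec y) = cosh b" "mink (hvec x) (hvec z) = cosh c"
    "mink (hvec x) (hvec x) = 1" "mink (hvec y) (hvec y) = 1" "mink (hvec z) (hvec z) = 1"
    using assms by (simp_all add: mink_hvec a_def b_def c_def hdist_commute)
  have "(mink u w)\<^sup>2 \<le> mink u u * mink w w"
    by (rule mink_cauchy [OF assms(2)]) (simp_all add: u_def w_def m)
  moreover have "mink u w = cosh c - cosh a * cosh b" by (simp add: u_def w_def m)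
  moreover have "mink u u = - (sinh a)\<^sup>2" "mink w w = - (sinh b)\<^sup>2"
    using cosh_square_eq [of a] cosh_square_eq [of b]
    by (simp_all add: u_def w_def m power2_eq_square)
  ultimately have "(cosh c - cosh a * cosh b)\<^sup>2 \<le> (sinh a * sinh b)\<^sup>2"
    by (simp add: power_mult_distrib)
  then have "\<bar>cosh c - cosh a * cosh b\<bar> \<le> \<bar>sinh a * sinh b\<bar>"
    by (simp add: abs_le_square_iff)
  then have "cosh c \<le> cosh (a + b)"
    using abs_ge_self [of "cosh c - cosh a * cosh b"] nn by (simp add: cosh_add)
  then show ?thesis
    using nn by (simp add: cosh_real_nonneg_le_iff a_def b_def c_def)
qed

section \<open>Geodesics\<close>

text \<open>
  A unit speed geodesic is a section of the hyperboloid by the plane of an orthonormal pair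
  \<open>e\<close>, \<open>f\<close>: \<open>e\<close> is the point at time \<open>0\<close> and
  \<open>f\<close> the tangent vector there.
\<close>

definition hgeo :: "(real \<Rightarrow> complex) \<Rightarrow> mvec \<Rightarrow> mvec \<Rightarrow> bool" where
  "hgeo \<gamma> e f \<longleftrightarrow> mink e e = 1 \<and> mink e f = 0 \<and> mink f f = -1 \<and>
     (\<forall>s. \<gamma> s \<in> hplane \<and> hvec (\<gamma> s) = cosh s *\<^sub>R e + sinh s *\<^sub>R f)"

lemma hgeoD:
  assumes "hgeo \<gamma> e f"
  shows "mink e e = 1" "mink e f = 0" "mink f f = -1" "mink f e = 0" "\<gamma> s \<in> hplane" "Im (\<gamma> s) > 0"
    "hvec (\<gamma> s) = cosh s *\<^sub>R e + sinh s *\<^sub>R f"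
  using assms mink_commute [of f e] by (auto simp: hgeo_def)

lemma hgeo_dist:
  assumes "hgeo \<gamma> e f"
  shows "hdist (\<gamma> s) (\<gamma> t) = \<bar>s - t\<bar>"
proof -
  have "cosh (hdist (\<gamma> s) (\<gamma> t)) = cosh s * cosh t - sinh s * sinh t"
    using mink_hvec [OF hgeoD(5) hgeoD(5), OF assms assms, of s t] hgeoD(1-4) [OF assms]
    by (simp add: hgeoD(7) [OF assms] algebra_simps)
  also have "\<dots> = cosh \<bar>s - t\<bar>"
    by (simp add: cosh_diff)
  finally show ?thesis
    using hdist_nonneg [OF hgeoD(5) hgeoD(5), OF assms assms, of s t]
    by (simp add: cosh_eq_iff_nonneg)
qed

lemma hgeo_continuous:
  assumes "hgeo \<gamma> e f"
  shows "continuous_on S \<gamma>"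
proof -
  have "fst (snd (cosh s *\<^sub>R e + sinh s *\<^sub>R f)) \<noteq> 0" for s
    using hgeoD(6,7) [OF assms, of s] by (metis hvec_def fst_conv snd_conv divide_pos_pos less_irrefl zero_less_one)
  then have "continuous_on S (\<lambda>s. hpoint (cosh s *\<^sub>R e + sinh s *\<^sub>R f))"
    unfolding hpoint_def Complex_eq by (intro continuous_intros) auto
  moreover have "hpoint (cosh s *\<^sub>R e + sinh s *\<^sub>R f) = \<gamma> s" for s
    using hpoint_hvec [OF hgeoD(5) [OF assms]] unfolding hgeoD(7) [OF assms] .
  ultimately show ?thesis by simp
qed

text \<open>
  The curve \<open>cosh s * e + sinh s * f\<close> keeps determinant one. It stays on the sheet of
  \<open>z\<close> because its product with \<open>hvec z\<close> is \<open>cosh s > 0\<close>.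
\<close>

lemma hgeo_exists:
  assumes z: "z \<in> hplane" and zf: "mink (hvec z) f = 0" and ff: "mink f f = -1"
  obtains \<gamma> where "hgeo \<gamma> (hvec z) f" "\<gamma> 0 = z"
proof -
  define v where "v s = cosh s *\<^sub>R hvec z + sinh s *\<^sub>R f" for s
  define \<gamma> where "\<gamma> s = hpoint (v s)" for s
  have zz: "mink (hvec z) (hvec z) = 1" by (rule mink_hvec_self [OF z])
  have vv: "mink (v s) (v s) = 1" for s
    using zf ff zz mink_commute [of f "hvec z"]
    by (simp add: v_def cosh_square_eq [unfolded power2_eq_square] algebra_simps)
  have vz: "mink (hvec z) (v s) > 0" for s
    using zf zz by (simp add: v_def)
  have pos: "fst (snd (v s)) > 0" for s
  proof -
    obtain a b x where ab: "v s = (a, b, x)" by (metis prod_cases3)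
    have 1: "a * b = 1 + x\<^sup>2" using vv [of s] by (simp add: ab mink_def power2_eq_square)
    have *: "((cmod z)\<^sup>2 * b + a) / 2 > Re z * x"
    proof -
      have "((cmod z)\<^sup>2 * b + a) / 2 - Re z * x = Im z * mink (hvec z) (v s)"
        using z by (simp add: ab mink_def hvec_def field_simps)
      then show ?thesis using mult_pos_pos [OF hplane_Im(1) [OF z] vz [of s]] by linarith
    qed
    show ?thesis
    proof (rule ccontr)
      assume "\<not> ?thesis"
      then have b: "b \<le> 0" by (simp add: ab)
      moreover have ab1: "a * b > 0" using 1 by (smt (verit) zero_le_power2)
      ultimately have a: "a < 0" "b < 0" by (auto simp: zero_less_mult_iff)
      have "(Re z)\<^sup>2 \<le> (cmod z)\<^sup>2" by (simp add: cmod_power2)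
      then have "(cmod z)\<^sup>2 * b \<le> (Re z)\<^sup>2 * b" using a by simp
      then have "(Re z)\<^sup>2 * b + a > 2 * Re z * x" using * by simp
      then have "((Re z)\<^sup>2 * b + a) * b < 2 * Re z * x * b"
        using a mult_strict_right_mono_neg by blast
      then have "(Re z * b - x)\<^sup>2 + 1 < 0"
        using 1 by (simp add: power2_eq_square algebra_simps)
      then show False by (smt (verit) zero_le_power2)
    qed
  qed
  have "\<gamma> s \<in> hplane \<and> hvec (\<gamma> s) = v s" for s
  proof -
    obtain a b x where ab: "v s = (a, b, x)" by (metis prod_cases3)
    have 1: "a * b = 1 + x\<^sup>2" using vv [of s] by (simp add: ab mink_def power2_eq_square)
    have b: "b > 0" using pos [of s] by (simp add: ab)
    have "((x / b)\<^sup>2 + (1 / b)\<^sup>2) / (1 / b) = (1 + x\<^sup>2) / b"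
      using b by (simp add: field_simps power2_eq_square)
    also have "\<dots> = a" using 1 b by (simp add: field_simps)
    finally show ?thesis
      using b by (auto intro!: hplaneI simp: \<gamma>_def hpoint_def ab hvec_def cmod_power2)
  qed
  then have "hgeo \<gamma> (hvec z) f"
    using zz zf ff by (simp add: hgeo_def v_def)
  moreover have "\<gamma> 0 = z" using z by (simp add: \<gamma>_def v_def)
  ultimately show ?thesis using that by blast
qed

lemma hgeo_between:
  assumes "x \<in> hplane" "y \<in> hplane" "x \<noteq> y"
  obtains \<gamma> f where "hgeo \<gamma> (hvec x) f" "\<gamma> 0 = x" "\<gamma> (hdist x y) = y"
proof -
  define D where "D = hdist x y"
  have D: "D > 0" using assms hdist_nonneg [OF assms(1,2)] hdist_eq_0_iff [OF assms(1,2)]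
    unfolding D_def by linarith
  define f where "f = (1 / sinh D) *\<^sub>R (hvec y - cosh D *\<^sub>R hvec x)"
  have m: "mink (hvec x) (hvec y) = cosh D" "mink (hvec y) (hvec x) = cosh D"
    "mink (hvec x) (hvec x) = 1" "mink (hvec y) (hvec y) = 1"
    using mink_hvec assms hdist_commute [of x y] mink_hvec_self by (simp_all add: D_def)
  have "mink f f = (1 / sinh D)\<^sup>2 * (1 - (cosh D)\<^sup>2)"
    by (simp add: f_def m power2_eq_square divide_simps)
  also have "\<dots> = -1" using D by (simp add: cosh_square_eq power_divide)
  finally have "mink f f = -1" .
  moreover have "mink (hvec x) f = 0" by (simp add: f_def m)
  ultimately obtain \<gamma> where g: "hgeo \<gamma> (hvec x) f" "\<gamma> 0 = x"
    using hgeo_exists [OF assms(1)] by metis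
  have "hvec (\<gamma> D) = hvec y"
    using D by (simp add: hgeoD(7) [OF g(1)] f_def)
  then have "\<gamma> D = y" using hvec_inj hgeoD(5) [OF g(1)] assms(2) by blast
  with g that D_def show ?thesis by blast
qed

text \<open>
  A metric line is determined by two of its points: the difference between \<open>hvec (\<gamma>
  s)\<close> and the expected value is a null vector orthogonal to \<open>hvec (\<gamma> 0)\<close>,
  hence zero.
\<close>

lemma hline_imp_hgeo:
  assumes h: "\<And>s. \<gamma> s \<in> hplane" and d: "\<And>s t. hdist (\<gamma> s) (\<gamma> t) = \<bar>s - t\<bar>"
  obtains e f where "hgeo \<gamma> e f"
proof -
  define e where "e = hvec (\<gamma> 0)"
  define f where "f = (1 / sinh 1) *\<^sub>R (hvec (\<gamma> 1) - cosh 1 *\<^sub>R e)"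
  have m: "mink (hvec (\<gamma> s)) (hvec (\<gamma> t)) = cosh (s - t)" for s t
    by (simp add: mink_hvec [OF h h] d)
  have ee: "mink e e = 1" using m [of 0 0] by (simp add: e_def)
  have fs: "mink (hvec (\<gamma> s)) f = - sinh s" for s
  proof -
    have "mink (hvec (\<gamma> s)) f = (1 / sinh 1) * (cosh (s - 1) - cosh 1 * cosh s)"
      using m [of s 1] m [of s 0] by (simp add: f_def e_def)
    also have "\<dots> = - sinh s" by (simp add: cosh_diff)
    finally show ?thesis .
  qed
  have ef: "mink e f = 0" using fs [of 0] by (simp add: e_def)
  have "mink f f = (1 / sinh 1) * (mink (hvec (\<gamma> 1)) f - cosh 1 * mink e f)"
    by (subst (1) f_def) simp
  then have ff: "mink f f = -1" using fs [of 1] ef by simp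
  have "hvec (\<gamma> s) = cosh s *\<^sub>R e + sinh s *\<^sub>R f" for s
  proof -
    define v where "v = hvec (\<gamma> s) - (cosh s *\<^sub>R e + sinh s *\<^sub>R f)"
    have es: "mink (hvec (\<gamma> s)) e = cosh s" using m [of s 0] by (simp add: e_def)
    have se: "mink e (hvec (\<gamma> s)) = cosh s" and sf: "mink f (hvec (\<gamma> s)) = - sinh s"
      and fe: "mink f e = 0"
      using es fs ef mink_commute by metis+
    have "mink e v = 0" by (simp add: v_def ee ef se)
    moreover have "mink v v = 0"
      using m [of s s]
      by (simp add: v_def ee ef ff fe se sf es fs cosh_square_eq [unfolded power2_eq_square] algebra_simps)
    ultimately have "v = 0" using mink_orth_definite [OF h [of 0], of v] by (simp add: e_def)
    then show ?thesis by (simp add: v_def)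
  qed
  with h ee ef ff have "hgeo \<gamma> e f" by (simp add: hgeo_def)
  then show ?thesis by (rule that)
qed

lemma hsegment_imageI:
  assumes "hgeo \<gamma> e f" "a \<le> s" "s \<le> b"
  shows "\<gamma> s \<in> hsegment (\<gamma> a) (\<gamma> b)"
  using assms hgeo_dist [OF assms(1)] hgeoD(5) [OF assms(1)] by (simp add: hsegment_def)

text \<open>
  Along a geodesic every linear functional is a combination of \<open>cosh\<close> and
  \<open>sinh\<close>, so two of its values determine it, with positive weights at times in between.
\<close>

lemma hgeo_sinh_interpolation:
  assumes g: "hgeo \<eta> e f"
  shows "sinh (v - u) * mink (hvec (\<eta> t)) n = sinh (t - u) * mink (hvec (\<eta> v)) n + sinh (v - t) * mink (hvec (\<eta> u)) n"
  by (simp add: hgeoD(7) [OF g] sinh_diff algebra_simps)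

text \<open>
  The point \<open>\<gamma> \<sigma>\<close> is the foot of the perpendicular from \<open>z\<close>
  when \<open>hvec z\<close> is orthogonal to the tangent vector at time \<open>\<sigma>\<close>.
\<close>

definition hfoot :: "mvec \<Rightarrow> mvec \<Rightarrow> complex \<Rightarrow> real \<Rightarrow> bool" where
  "hfoot e f z \<sigma> \<longleftrightarrow> mink (hvec z) (sinh \<sigma> *\<^sub>R e + cosh \<sigma> *\<^sub>R f) = 0"

text \<open>
  Pythagoras for the right triangle \<open>z\<close>, \<open>\<gamma> \<sigma>\<close>,
  \<open>\<gamma> s\<close>. The second identity gives the sign on either side of the perpendicular
  at time \<open>s\<close>.
\<close>

lemma hfoot_functional:
  assumes g: "hgeo \<gamma> e f" and z: "z \<in> hplane" and foot: "hfoot e f z \<sigma>"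
  shows "cosh (hdist z (\<gamma> s)) = cosh (hdist z (\<gamma> \<sigma>)) * cosh (s - \<sigma>)"
    "mink (hvec z) (sinh s *\<^sub>R e + cosh s *\<^sub>R f) = cosh (hdist z (\<gamma> \<sigma>)) * sinh (s - \<sigma>)"
proof -
  define E F where "E = mink (hvec z) e" and "F = mink (hvec z) f"
  have 0: "sinh \<sigma> * E + cosh \<sigma> * F = 0" using foot by (simp add: hfoot_def E_def F_def)
  have c: "cosh (hdist z (\<gamma> s)) = cosh s * E + sinh s * F" for s
    using mink_hvec [OF z hgeoD(5) [OF g]] by (simp add: hgeoD(7) [OF g] E_def F_def)
  have cs: "cosh \<sigma> * cosh \<sigma> = 1 + sinh \<sigma> * sinh \<sigma>" using cosh_square_eq [of \<sigma>] by (simp add: power2_eq_square)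
  show "cosh (hdist z (\<gamma> s)) = cosh (hdist z (\<gamma> \<sigma>)) * cosh (s - \<sigma>)"
    unfolding c cosh_diff using 0 cs by algebra
  have "mink (hvec z) (sinh s *\<^sub>R e + cosh s *\<^sub>R f) = sinh s * E + cosh s * F" by (simp add: E_def F_def)
  also have "\<dots> = (cosh \<sigma> * E + sinh \<sigma> * F) * sinh (s - \<sigma>)"
    unfolding sinh_diff using 0 cs by algebra
  finally show "mink (hvec z) (sinh s *\<^sub>R e + cosh s *\<^sub>R f) = cosh (hdist z (\<gamma> \<sigma>)) * sinh (s - \<sigma>)"
    by (simp add: c)
qed

text \<open>
  The distance to \<open>\<gamma> s\<close> has hyperbolic cosine \<open>A * cosh s + B * sinh
  s\<close>, and Cauchy-Schwarz gives \<open>\<bar>B\<bar> < A\<close>, so it is a shifted multiple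
  of \<open>cosh\<close>; the foot is the shift.
\<close>

lemma hfoot_exists:
  assumes g: "hgeo \<gamma> e f" and z: "z \<in> hplane"
  obtains \<sigma> where "hfoot e f z \<sigma>"
proof -
  define A B where "A = mink (hvec z) e" and "B = mink (hvec z) f"
  have F: "cosh (hdist z (\<gamma> s)) = A * cosh s + B * sinh s" for s
    using mink_hvec [OF z hgeoD(5) [OF g]] by (simp add: hgeoD(7) [OF g] A_def B_def mult.commute)
  have e0: "e = hvec (\<gamma> 0)" using hgeoD(7) [OF g, of 0] by simp
  have A: "A \<ge> 1" using F [of 0] cosh_real_ge_1 [of "hdist z (\<gamma> 0)"] by simp
  define u where "u = hvec z - A *\<^sub>R e"
  have "(mink u f)\<^sup>2 \<le> mink u u * mink f f"
    by (rule mink_cauchy [OF hgeoD(5) [OF g, of 0]])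
       (use hgeoD(1-4) [OF g] in \<open>simp_all add: e0 [symmetric] u_def A_def mink_commute [of e "hvec z"]\<close>)
  moreover have "mink u f = B" using hgeoD(2) [OF g] by (simp add: u_def B_def)
  moreover have "mink u u = 1 - A\<^sup>2"
    using hgeoD(1) [OF g] mink_hvec_self [OF z]
    by (simp add: u_def A_def mink_commute [of e "hvec z"] power2_eq_square)
  ultimately have "B\<^sup>2 < A\<^sup>2" using hgeoD(3) [OF g] by simp
  define m where "m = sqrt (A\<^sup>2 - B\<^sup>2)"
  have m: "m > 0" "m\<^sup>2 = A\<^sup>2 - B\<^sup>2" using \<open>B\<^sup>2 < A\<^sup>2\<close> by (simp_all add: m_def)
  define \<sigma> where "\<sigma> = arsinh (- B / m)"
  have sh: "sinh \<sigma> = - B / m" by (simp add: \<sigma>_def)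
  have "(cosh \<sigma>)\<^sup>2 = (A / m)\<^sup>2"
    using m by (simp add: cosh_square_eq sh power_divide field_simps)
  then have ch: "cosh \<sigma> = A / m" using m A by (simp add: power2_eq_iff_nonneg)
  have "hfoot e f z \<sigma>" by (simp add: hfoot_def sh ch A_def [symmetric] B_def [symmetric])
  then show ?thesis by (rule that)
qed

text \<open>
  A right triangle with long legs \<open>a\<close>, \<open>b\<close> and hypotenuse \<open>c\<close>
  is almost degenerate.
\<close>

lemma cosh_mult_lower:
  assumes "cosh c = cosh a * cosh b" "a \<ge> 0" "b \<ge> 0" "c \<ge> (0::real)"
  shows "c \<ge> a + b - 2"
proof -
  have "exp a * exp b \<le> (2 * cosh a) * (2 * cosh b)"
    by (intro mult_mono) (auto simp: cosh_field_def)
  also have "\<dots> = 4 * cosh c" by (simp add: assms(1))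
  also have "\<dots> \<le> exp 2 * exp c"
  proof (rule mult_mono)
    have "(2::real) ^ 2 \<le> exp 1 ^ 2" using exp_ge_add_one_self [of 1] by (intro power_mono) auto
    then show "(4::real) \<le> exp 2" by (simp add: exp_of_nat_mult [symmetric])
    show "cosh c \<le> exp c" using assms(4) by (simp add: cosh_field_def)
  qed auto
  finally have "exp (a + b) \<le> exp (2 + c)" by (simp add: exp_add)
  then show ?thesis by simp
qed

section \<open>Gromov hyperbolicity and trees of tripods\<close>

text \<open>
  This form of the distance is Euclidean up to a factor for each point, so that a homogeneous
  Euclidean inequality such as Ptolemy's carries over.
\<close>

lemma sinh_half_hdist:
  assumes "z \<in> hplane" "w \<in> hplane"
  shows "sinh (hdist z w / 2) = cmod (z - w) / (2 * sqrt (Im z) * sqrt (Im w))"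
proof -
  have "cosh (2 * (hdist z w / 2)) = 1 + 2 * (sinh (hdist z w / 2))\<^sup>2"
    by (simp only: cosh_double cosh_square_eq)
  then have "2 * (sinh (hdist z w / 2))\<^sup>2 = (cmod (z - w))\<^sup>2 / (2 * Im z * Im w)"
    using cosh_hdist [OF assms] by simp
  also have "\<dots> = 2 * (cmod (z - w) / (2 * sqrt (Im z) * sqrt (Im w)))\<^sup>2"
    using assms by (simp add: power_divide power_mult_distrib)
  finally have "(sinh (hdist z w / 2))\<^sup>2 = (cmod (z - w) / (2 * sqrt (Im z) * sqrt (Im w)))\<^sup>2"
    by simp
  then show ?thesis
    using assms by (simp add: power2_eq_iff_nonneg)
qed

lemma ptolemy_hdist:
  assumes "x \<in> hplane" "y \<in> hplane" "z \<in> hplane" "w \<in> hplane"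
  shows "sinh (hdist x y / 2) * sinh (hdist z w / 2)
    \<le> sinh (hdist x z / 2) * sinh (hdist y w / 2) + sinh (hdist x w / 2) * sinh (hdist y z / 2)"
proof -
  have "(x - y) * (z - w) = (x - z) * (y - w) - (x - w) * (y - z)"
    by (simp add: algebra_simps)
  then have "cmod (x - y) * cmod (z - w) \<le> cmod (x - z) * cmod (y - w) + cmod (x - w) * cmod (y - z)"
    by (metis norm_mult norm_triangle_ineq4)
  then have *: "cmod (x - y) * cmod (z - w) / (4 * sqrt (Im x) * sqrt (Im y) * sqrt (Im z) * sqrt (Im w))
    \<le> (cmod (x - z) * cmod (y - w) + cmod (x - w) * cmod (y - z)) / (4 * sqrt (Im x) * sqrt (Im y) * sqrt (Im z) * sqrt (Im w))"
    using assms by (intro divide_right_mono) auto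
  then show ?thesis
    unfolding sinh_half_hdist [OF assms(1,2)] sinh_half_hdist [OF assms(3,4)] sinh_half_hdist [OF assms(1,3)]
      sinh_half_hdist [OF assms(2,4)] sinh_half_hdist [OF assms(1,4)] sinh_half_hdist [OF assms(2,3)]
    by (simp add: add_divide_distrib mult_ac)
qed

lemma exp_div_4_le_sinh: "4 * sinh a \<ge> exp a" if "a \<ge> ln 2" for a :: real
proof -
  have "exp a \<ge> 2" using that by (metis exp_le_cancel_iff exp_ln zero_less_numeral)
  then have "exp a * exp a \<ge> 2 * 1" by (intro mult_mono) linarith+
  then show ?thesis by (simp add: sinh_field_def exp_minus field_simps)
qed

text \<open>
  Ptolemy's inequality bounds a product of two terms \<open>sinh (d / 2)\<close> by the sum of two
  such products. Taking logarithms turns it into the four point condition, since \<open>sinh\<close>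
  is comparable to \<open>exp\<close> away from zero; if one of the two distances on the left is
  small, the triangle inequality suffices.
\<close>

lemma hdist_four_point:
  assumes "x \<in> hplane" "y \<in> hplane" "z \<in> hplane" "w \<in> hplane"
  shows "hdist x y + hdist z w \<le> max (hdist x z + hdist y w) (hdist x w + hdist y z) + 6"
proof -
  have ln2: "ln 2 < (1::real)" using ln2_le_25_over_36 by simp
  have small: ?thesis if h: "hdist x y < 2 * ln 2 \<or> hdist z w < 2 * ln 2"
  proof -
    have "hdist z w \<le> hdist z x + hdist x y + hdist y w"
      using hdist_triangle [OF assms(3,1,4)] hdist_triangle [OF assms(1,2,4)] by simp
    moreover have "hdist x y \<le> hdist x z + hdist z w + hdist w y"
      using hdist_triangle [OF assms(1,3,2)] hdist_triangle [OF assms(3,4,2)] by simp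
    ultimately show ?thesis using h ln2 hdist_commute [of z x] hdist_commute [of w y] by linarith
  qed
  show ?thesis
  proof (cases "hdist x y < 2 * ln 2 \<or> hdist z w < 2 * ln 2")
    case False
    define P Q1 Q2 where "P = (hdist x y + hdist z w) / 2" and "Q1 = (hdist x z + hdist y w) / 2"
      and "Q2 = (hdist x w + hdist y z) / 2"
    have half: "sinh (a / 2) * sinh (b / 2) \<le> exp ((a + b) / 2) / 4" if "a \<ge> 0" "b \<ge> 0" for a b :: real
    proof -
      have "sinh (a / 2) * sinh (b / 2) \<le> (exp (a / 2) / 2) * (exp (b / 2) / 2)"
        using that by (intro mult_mono) (auto simp: sinh_field_def)
      then show ?thesis by (simp add: exp_add [symmetric] add_divide_distrib)
    qed
    have "exp (hdist x y / 2) * exp (hdist z w / 2) \<le> (4 * sinh (hdist x y / 2)) * (4 * sinh (hdist z w / 2))"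
      using False assms by (intro mult_mono exp_div_4_le_sinh) auto
    then have "exp P \<le> 16 * (sinh (hdist x y / 2) * sinh (hdist z w / 2))"
      by (simp add: P_def exp_add [symmetric] add_divide_distrib)
    also have "\<dots> \<le> 16 * (exp Q1 / 4 + exp Q2 / 4)"
      using ptolemy_hdist [OF assms] half [of "hdist x z" "hdist y w"] half [of "hdist x w" "hdist y z"] assms
      by (simp add: Q1_def Q2_def)
    also have "\<dots> \<le> 8 * exp (max Q1 Q2)" by (simp add: max_def)
    also have "(8::real) \<le> exp 3"
    proof -
      have "(2::real) ^ 3 \<le> exp 1 ^ 3" using exp_ge_add_one_self [of 1] by (intro power_mono) auto
      then show ?thesis by (simp add: exp_of_nat_mult [symmetric])
    qed
    finally have "exp P \<le> exp (3 + max Q1 Q2)" by (simp add: exp_add)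
    then have "P \<le> 3 + max Q1 Q2" by simp
    then have "P \<le> 3 + Q1 \<or> P \<le> 3 + Q2" by (simp add: max_def split: if_splits)
    then show ?thesis
      unfolding P_def Q1_def Q2_def
      using max.cobounded1 [of "hdist x z + hdist y w" "hdist x w + hdist y z"]
        max.cobounded2 [of "hdist x w + hdist y z" "hdist x z + hdist y w"] by argo
  qed (rule small)
qed

text \<open>
  The Gromov product of \<open>x\<close> and \<open>y\<close> at \<open>w\<close>, roughly the
  length for which geodesics from \<open>w\<close> to \<open>x\<close> and to \<open>y\<close> run
  together.
\<close>

definition gprod :: "complex \<Rightarrow> complex \<Rightarrow> complex \<Rightarrow> real" where
  "gprod x y w = (hdist x w + hdist y w - hdist x y) / 2"

lemma gprod_commute: "gprod x y w = gprod y x w"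
  by (simp add: gprod_def hdist_commute)

lemma gprod_hyperbolic:
  assumes "x \<in> hplane" "y \<in> hplane" "z \<in> hplane" "w \<in> hplane"
  shows "gprod x y w \<le> gprod x z w + 3 \<or> gprod y z w \<le> gprod x z w + 3"
  using hdist_four_point [OF assms(1,3,2,4)] hdist_commute [of z y]
  unfolding gprod_def max_def by (auto split: if_splits simp: field_simps)

definition tripod :: "complex set \<Rightarrow> real \<Rightarrow> real \<Rightarrow> real \<Rightarrow> complex \<Rightarrow> bool" where
  "tripod A c l l' y \<longleftrightarrow> (\<exists>u\<in>A. \<exists>v\<in>A. \<exists>w\<in>A.
     (\<forall>t\<in>{u, v, w}. l \<le> hdist y t \<and> hdist y t \<le> l') \<and>
     gprod u v y \<le> c \<and> gprod v w y \<le> c \<and> gprod u w y \<le> c)"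

text \<open>
  The induction keeps control of the direction \<open>x\<close> from which \<open>y\<close> was
  reached: hyperbolicity leaves at least two legs \<open>z\<close>, \<open>z'\<close> of the tripod
  at \<open>y\<close> with a small Gromov product with \<open>x\<close>, and the trees that grow
  from \<open>z\<close> and \<open>z'\<close>, both reached from \<open>y\<close>, stay behind these
  legs. The bound \<open>2 * c + 13\<close> makes a leg longer than the overlap \<open>c + 6\<close>
  at each of its two ends.
\<close>

lemma tripod_tree:
  assumes A: "A \<subseteq> hplane" and step: "\<And>y. y \<in> A \<Longrightarrow> tripod A c l l' y"
    and c: "c \<ge> 0" and l: "l \<ge> 2 * c + 13"
  shows "\<lbrakk>y \<in> A; x \<in> hplane\<rbrakk> \<Longrightarrow> \<exists>T\<subseteq>A. finite T \<and> card T = 2 ^ n \<and>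
     (\<forall>t\<in>T. hdist y t \<le> n * l' \<and> gprod x t y \<le> c + 6) \<and>
     (\<forall>t\<in>T. \<forall>t'\<in>T. t \<noteq> t' \<longrightarrow> 2 \<le> hdist t t')"
proof (induction n arbitrary: y x)
  case 0
  then show ?case
    using c by (intro exI [of _ "{y}"]) (auto simp: gprod_def)
next
  case (Suc n)
  note y = Suc.prems(1) and x = Suc.prems(2)
  have H: "u \<in> hplane" if "u \<in> A" for u using that A by blast
  obtain u1 u2 u3 where u: "u1 \<in> A" "u2 \<in> A" "u3 \<in> A"
    "\<forall>t\<in>{u1, u2, u3}. l \<le> hdist y t \<and> hdist y t \<le> l'"
    "gprod u1 u2 y \<le> c" "gprod u2 u3 y \<le> c" "gprod u1 u3 y \<le> c"
    using step [OF y] unfolding tripod_def by blast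
  \<comment> \<open>At most one leg of the tripod runs back towards \<open>x\<close>.\<close>
  have "\<exists>z z'. z \<in> A \<and> z' \<in> A \<and> l \<le> hdist y z \<and> l \<le> hdist y z' \<and> hdist y z \<le> l' \<and> hdist y z' \<le> l' \<and>
      gprod z z' y \<le> c \<and> gprod x z y \<le> c + 3 \<and> gprod x z' y \<le> c + 3"
  proof -
    have 12: "gprod x u1 y \<le> c + 3 \<or> gprod x u2 y \<le> c + 3"
      using gprod_hyperbolic [OF H [OF u(1)] x H [OF u(2)] H [OF y]] u(5)
      by (auto simp: gprod_commute [of u1 x])
    have 23: "gprod x u2 y \<le> c + 3 \<or> gprod x u3 y \<le> c + 3"
      using gprod_hyperbolic [OF H [OF u(2)] x H [OF u(3)] H [OF y]] u(6)
      by (auto simp: gprod_commute [of u2 x])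
    have 13: "gprod x u1 y \<le> c + 3 \<or> gprod x u3 y \<le> c + 3"
      using gprod_hyperbolic [OF H [OF u(1)] x H [OF u(3)] H [OF y]] u(7)
      by (auto simp: gprod_commute [of u1 x])
    show ?thesis using 12 23 13 u by (metis insertI1 insertI2)
  qed
  then obtain z z' where z: "z \<in> A" "z' \<in> A" "l \<le> hdist y z" "l \<le> hdist y z'" "hdist y z \<le> l'" "hdist y z' \<le> l'"
      "gprod z z' y \<le> c" "gprod x z y \<le> c + 3" "gprod x z' y \<le> c + 3"
    by blast
  from Suc.IH [OF z(1) H [OF y]] obtain T where T: "T \<subseteq> A" "finite T" "card T = 2 ^ n"
    "\<And>t. t \<in> T \<Longrightarrow> hdist z t \<le> n * l' \<and> gprod y t z \<le> c + 6"
    "\<And>t t'. t \<in> T \<Longrightarrow> t' \<in> T \<Longrightarrow> t \<noteq> t' \<Longrightarrow> 2 \<le> hdist t t'" by blast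
  from Suc.IH [OF z(2) H [OF y]] obtain T' where T': "T' \<subseteq> A" "finite T'" "card T' = 2 ^ n"
    "\<And>t. t \<in> T' \<Longrightarrow> hdist z' t \<le> n * l' \<and> gprod y t z' \<le> c + 6"
    "\<And>t t'. t \<in> T' \<Longrightarrow> t' \<in> T' \<Longrightarrow> t \<noteq> t' \<Longrightarrow> 2 \<le> hdist t t'" by blast
  have below: "gprod v t y \<ge> c + 7 \<and> gprod x t y \<le> c + 6 \<and> hdist y t \<le> Suc n * l' \<and> gprod v t y \<le> hdist y t"
    if v: "v \<in> A" "l \<le> hdist y v" "hdist y v \<le> l'" "gprod x v y \<le> c + 3"
      and t: "t \<in> A" "hdist v t \<le> n * l'" "gprod y t v \<le> c + 6" for v t
  proof -
    have 1: "gprod v t y \<ge> c + 7"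
    proof -
      have "gprod v t y = hdist y v - gprod y t v"
        by (simp add: gprod_def hdist_commute [of v y] hdist_commute [of t y] hdist_commute [of t v] field_simps)
      then show ?thesis using t(3) v(2) l by linarith
    qed
    have 2: "gprod x t y \<le> c + 6"
      using gprod_hyperbolic [OF x H [OF t(1)] H [OF v(1)] H [OF y]] 1 v(4) gprod_commute [of t v y] by linarith
    have "hdist y t \<le> hdist y v + hdist v t" "hdist v y \<le> hdist v t + hdist t y"
      by (intro hdist_triangle H y v t)+
    with t v 1 2 show ?thesis
      by (auto simp: gprod_def hdist_commute [of t y] distrib_right)
  qed
  have bT: "gprod z t y \<ge> c + 7 \<and> gprod x t y \<le> c + 6 \<and> hdist y t \<le> Suc n * l' \<and> gprod z t y \<le> hdist y t" if "t \<in> T" for t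
    using below [OF z(1) z(3) z(5) z(8)] T(1,4) that by blast
  have bT': "gprod z' t y \<ge> c + 7 \<and> gprod x t y \<le> c + 6 \<and> hdist y t \<le> Suc n * l' \<and> gprod z' t y \<le> hdist y t" if "t \<in> T'" for t
    using below [OF z(2) z(4) z(6) z(9)] T'(1,4) that by blast
  have sep: "2 \<le> hdist t t'" if "t \<in> T" "t' \<in> T'" for t t'
  proof -
    have h: "t \<in> hplane" "t' \<in> hplane" using that T(1) T'(1) H by auto
    have 1: "gprod t z' y \<le> c + 3"
      using gprod_hyperbolic [OF H [OF z(1)] h(1) H [OF z(2)] H [OF y]] bT [OF that(1)] z(7) by linarith
    have 2: "gprod t t' y \<le> c + 6"
      using gprod_hyperbolic [OF h(1) h(2) H [OF z(2)] H [OF y]] bT' [OF that(2)] 1 gprod_commute [of t' z' y] by linarith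
    have 3: "gprod z t y \<ge> l - c - 6" "gprod z' t' y \<ge> l - c - 6"
    proof -
      have "gprod z t y = hdist y z - gprod y t z" "gprod z' t' y = hdist y z' - gprod y t' z'"
        by (simp_all add: gprod_def hdist_commute [of z y] hdist_commute [of t y] hdist_commute [of t z]
          hdist_commute [of z' y] hdist_commute [of t' y] hdist_commute [of t' z'] field_simps)
      then show "gprod z t y \<ge> l - c - 6" "gprod z' t' y \<ge> l - c - 6"
        using T(4) [OF that(1)] T'(4) [OF that(2)] z(3,4) by linarith+
    qed
    have "hdist t t' = hdist y t + hdist y t' - 2 * gprod t t' y"
      unfolding gprod_def hdist_commute [of y] by argo
    then show ?thesis using 2 3 bT [OF that(1)] bT' [OF that(2)] l by linarith
  qed
  have "T \<inter> T' = {}" using sep by force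
  then have "card (T \<union> T') = 2 ^ Suc n" using T T' by (simp add: card_Un_disjoint)
  moreover have "2 \<le> hdist t t'" if "t \<in> T \<union> T'" "t' \<in> T \<union> T'" "t \<noteq> t'" for t t'
    using that T(5) T'(5) sep hdist_commute [of t t'] by (metis UnE)
  ultimately show ?case using T(1,2) T'(1,2) bT bT'
    by (intro exI [of _ "T \<union> T'"]) auto
qed

section \<open>Metric balls and their area\<close>

lemma mem_hball_iff:
  assumes "z \<in> hplane" "r > 0"
  shows "w \<in> hball z r \<longleftrightarrow> w \<in> hplane \<and> (cmod (z - w))\<^sup>2 < (cosh r - 1) * (2 * Im z * Im w)"
proof (cases "w \<in> hplane")
  case True
  have "hdist z w < r \<longleftrightarrow> cosh (hdist z w) < cosh r"
    using assms True by (simp add: cosh_real_nonneg_less_iff)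
  also have "\<dots> \<longleftrightarrow> (cmod (z - w))\<^sup>2 / (2 * Im z * Im w) < cosh r - 1"
    using cosh_hdist [OF assms(1) True] by (simp add: algebra_simps)
  also have "\<dots> \<longleftrightarrow> (cmod (z - w))\<^sup>2 < (cosh r - 1) * (2 * Im z * Im w)"
    using assms True by (intro pos_divide_less_eq) simp
  finally show ?thesis using True by (simp add: hball_def)
qed (simp add: hball_def)

lemma hball_nonpos: "z \<in> hplane \<Longrightarrow> r \<le> 0 \<Longrightarrow> hball z r = {}"
  unfolding hball_def using hdist_nonneg by fastforce

lemma open_hplane: "open hplane"
  unfolding hplane_def by (rule open_halfspace_Im_gt)

lemma open_hball:
  assumes "z \<in> hplane"
  shows "open (hball z r)"
proof (cases "r > 0")
  case True
  have "hball z r = hplane \<inter> {w. (cmod (z - w))\<^sup>2 < (cosh r - 1) * (2 * Im z * Im w)}"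
    using mem_hball_iff [OF assms True] by auto
  moreover have "open {w. (cmod (z - w))\<^sup>2 < (cosh r - 1) * (2 * Im z * Im w)}"
    by (intro open_Collect_less continuous_intros)
  ultimately show ?thesis using open_hplane by (simp add: open_Int)
qed (simp add: hball_nonpos [OF assms])

lemma hball_bounds:
  assumes z: "z \<in> hplane" and w: "w \<in> hball z r"
  shows "Im w \<le> 2 * cosh r * Im z" "Im z \<le> 2 * cosh r * Im w"
    "(cmod (z - w))\<^sup>2 \<le> (cosh r - 1) * (4 * cosh r) * (Im z)\<^sup>2"
proof -
  have r: "r > 0" using w hball_nonpos [OF z] by (metis empty_iff not_le)
  have wH: "w \<in> hplane" and d: "(cmod (z - w))\<^sup>2 < (cosh r - 1) * (2 * Im z * Im w)"
    using mem_hball_iff [OF z r] w by auto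
  have "(Im z - Im w)\<^sup>2 \<le> (cmod (z - w))\<^sup>2" by (simp add: cmod_power2)
  then have *: "(Im z)\<^sup>2 + (Im w)\<^sup>2 \<le> 2 * cosh r * Im z * Im w"
    using d by (simp add: power2_eq_square algebra_simps)
  have "Im w * Im w \<le> (2 * cosh r * Im z) * Im w" "Im z * Im z \<le> (2 * cosh r * Im w) * Im z"
  proof -
    have "(Im w)\<^sup>2 \<le> 2 * cosh r * Im z * Im w" "(Im z)\<^sup>2 \<le> 2 * cosh r * Im z * Im w"
      using * zero_le_power2 [of "Im z"] zero_le_power2 [of "Im w"] by linarith+
    then show "Im w * Im w \<le> (2 * cosh r * Im z) * Im w" "Im z * Im z \<le> (2 * cosh r * Im w) * Im z"
      by (simp_all add: power2_eq_square mult_ac)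
  qed
  then show 1: "Im w \<le> 2 * cosh r * Im z" and "Im z \<le> 2 * cosh r * Im w"
    using z wH by (simp_all add: mult_le_cancel_right not_less [symmetric])
  have "(cosh r - 1) * (2 * Im z * Im w) \<le> (cosh r - 1) * (2 * Im z * (2 * cosh r * Im z))"
    using 1 z cosh_real_ge_1 [of r] by (intro mult_left_mono) auto
  also have "\<dots> = (cosh r - 1) * (4 * cosh r) * (Im z)\<^sup>2"
    by (simp add: power2_eq_square)
  finally show "(cmod (z - w))\<^sup>2 \<le> (cosh r - 1) * (4 * cosh r) * (Im z)\<^sup>2"
    using d by linarith
qed

lemma hball_subset_open:
  assumes z: "z \<in> hplane" and U: "open U" "z \<in> U"
  obtains r where "r > 0" "hball z r \<subseteq> U"
proof -
  obtain e where e: "e > 0" "ball z e \<subseteq> U" using U openE by blast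
  have "((\<lambda>r. (cosh r - 1) * (4 * cosh r) * (Im z)\<^sup>2) \<longlongrightarrow> (cosh 0 - 1) * (4 * cosh 0) * (Im z)\<^sup>2) (at_right (0::real))"
    by (intro tendsto_intros)
  then have "\<forall>\<^sub>F r in at_right (0::real). (cosh r - 1) * (4 * cosh r) * (Im z)\<^sup>2 < e\<^sup>2"
    using e by (intro order_tendstoD(2)) auto
  then have "\<forall>\<^sub>F r in at_right (0::real). r > 0 \<and> (cosh r - 1) * (4 * cosh r) * (Im z)\<^sup>2 < e\<^sup>2"
    by (intro eventually_conj eventually_at_right_less)
  then obtain r where r: "r > 0" "(cosh r - 1) * (4 * cosh r) * (Im z)\<^sup>2 < e\<^sup>2"
    using eventually_happens' [OF trivial_limit_at_right_real] by blast
  have "hball z r \<subseteq> ball z e"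
  proof
    fix w assume "w \<in> hball z r"
    then have "(cmod (z - w))\<^sup>2 < e\<^sup>2" using hball_bounds(3) [OF z] r by fastforce
    then have "cmod (z - w) < e" using e by (simp add: power2_less_imp_less)
    then show "w \<in> ball z e" by (simp add: dist_norm)
  qed
  with e r that show ?thesis by blast
qed

lemma centre_in_hball: "z \<in> hplane \<Longrightarrow> r > 0 \<Longrightarrow> z \<in> hball z r"
  by (simp add: hball_def)

lemma hball_subset_hplane: "hball z r \<subseteq> hplane"
  by (auto simp: hball_def)

lemma hball_sets [measurable]: "z \<in> hplane \<Longrightarrow> hball z r \<in> sets borel"
  by (simp add: open_hball borel_open)

lemma sets_harea [simp]: "sets harea = sets borel"
  by (simp add: harea_def)

lemma harea_density_measurable: "(\<lambda>z. ennreal (1 / (Im z)\<^sup>2)) \<in> borel_measurable lborel"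
  by measurable

text \<open>
  A metric ball lies in a Euclidean ball whose radius is proportional to the height of the centre,
  at heights comparable to it. The area density is invariant under scaling, so the bound does not
  depend on the centre.
\<close>

lemma harea_hball_upper:
  obtains B where "B > 0" "\<And>z. z \<in> hplane \<Longrightarrow> emeasure harea (hball z r) \<le> ennreal B"
proof -
  define M where "M = sqrt ((cosh r - 1) * (4 * cosh r)) + 1"
  define B where "B = (2 * cosh r)\<^sup>2 * (unit_ball_vol 2 * M\<^sup>2)"
  have M: "M > 0" using cosh_real_ge_1 [of r] by (simp add: M_def add_nonneg_pos)
  have "emeasure harea (hball z r) \<le> ennreal B" if z: "z \<in> hplane" for z
  proof -
    have sub: "hball z r \<subseteq> ball z (M * Im z)"
    proof
      fix w assume w: "w \<in> hball z r"
      have "cmod (z - w) \<le> sqrt ((cosh r - 1) * (4 * cosh r) * (Im z)\<^sup>2)"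
        using hball_bounds(3) [OF z w] by (simp add: real_le_rsqrt)
      also have "\<dots> = sqrt ((cosh r - 1) * (4 * cosh r)) * Im z"
        using z by (simp add: real_sqrt_mult)
      also have "\<dots> < M * Im z" using z by (simp add: M_def)
      finally show "w \<in> ball z (M * Im z)" by (simp add: dist_norm)
    qed
    have "emeasure harea (hball z r) = (\<integral>\<^sup>+w. ennreal (1 / (Im w)\<^sup>2) * indicator (hball z r) w \<partial>lborel)"
      unfolding harea_def using hball_sets [OF z] by (intro emeasure_density harea_density_measurable) simp
    also have "\<dots> \<le> (\<integral>\<^sup>+w. ennreal ((2 * cosh r / Im z)\<^sup>2) * indicator (ball z (M * Im z)) w \<partial>lborel)"
    proof (rule nn_integral_mono)
      fix w
      show "ennreal (1 / (Im w)\<^sup>2) * indicator (hball z r) w \<le> ennreal ((2 * cosh r / Im z)\<^sup>2) * indicator (ball z (M * Im z)) w"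
      proof (cases "w \<in> hball z r")
        case True
        have wH: "w \<in> hplane" using True hball_subset_hplane by blast
        have "1 / Im w \<le> 2 * cosh r / Im z"
          using hball_bounds(2) [OF z True] z wH by (simp add: field_simps)
        then have "(1 / Im w)\<^sup>2 \<le> (2 * cosh r / Im z)\<^sup>2" using wH by (intro power_mono) auto
        then show ?thesis using True sub by (auto simp: power_divide intro!: ennreal_leI)
      qed simp
    qed
    also have "\<dots> = ennreal ((2 * cosh r / Im z)\<^sup>2) * emeasure lborel (ball z (M * Im z))"
      by (intro nn_integral_cmult_indicator) simp
    also have "\<dots> = ennreal ((2 * cosh r / Im z)\<^sup>2) * ennreal (unit_ball_vol 2 * (M * Im z)\<^sup>2)"
      using z M by (simp add: emeasure_ball)
    also have "\<dots> = ennreal B"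
      using z M by (simp add: ennreal_mult [symmetric] B_def power_mult_distrib power_divide)
    finally show ?thesis .
  qed
  moreover have "B > 0" using M by (simp add: B_def)
  ultimately show ?thesis using that by blast
qed

text \<open>
  Conversely a metric ball contains a Euclidean ball with radius proportional to the height.
\<close>

lemma harea_hball_lower:
  assumes r: "r > 0"
  obtains b where "b > 0" "\<And>z. z \<in> hplane \<Longrightarrow> ennreal b \<le> emeasure harea (hball z r)"
proof -
  \<comment> \<open>\<open>t \<le> 1 / 2\<close> keeps the heights comparable, \<open>t\<^sup>2 \<le> cosh r - 1\<close> keeps the ball inside.\<close>
  define t where "t = min (1 / 2) (sqrt (cosh r - 1))"
  have c1: "cosh r > 1" using r by (metis cosh_real_nonneg_less_iff cosh_0 order_refl less_imp_le)
  then have t: "t > 0" "t \<le> 1 / 2" "t\<^sup>2 \<le> cosh r - 1"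
  proof -
    show "t > 0" "t \<le> 1 / 2" using c1 by (auto simp: t_def)
    then have "t\<^sup>2 \<le> (sqrt (cosh r - 1))\<^sup>2" by (intro power_mono) (auto simp: t_def)
    then show "t\<^sup>2 \<le> cosh r - 1" using c1 by simp
  qed
  define b where "b = (1 / 4) * (unit_ball_vol 2 * t\<^sup>2)"
  have "ennreal b \<le> emeasure harea (hball z r)" if z: "z \<in> hplane" for z
  proof -
    have near: "w \<in> hball z r \<and> Im w \<le> 2 * Im z" if "w \<in> ball z (t * Im z)" for w
    proof -
      have d: "cmod (z - w) < t * Im z" using that by (simp add: dist_norm)
      have "\<bar>Im z - Im w\<bar> \<le> cmod (z - w)" using abs_Im_le_cmod [of "z - w"] by simp
      also have "\<dots> < (1 / 2) * Im z" using d t z by (smt (verit) hplane_Im(1) mult_right_mono)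
      finally have "\<bar>Im z - Im w\<bar> < (1 / 2) * Im z" .
      then have I: "Im w > Im z / 2" "Im w \<le> 2 * Im z" using hplane_Im(1) [OF z] by linarith+
      have wH: "w \<in> hplane" using I z by (intro hplaneI) (smt (verit) hplane_Im(1) half_gt_zero)
      have "(cmod (z - w))\<^sup>2 < (t * Im z)\<^sup>2" using d by (intro power_strict_mono) auto
      also have "\<dots> \<le> (cosh r - 1) * (Im z)\<^sup>2"
        unfolding power_mult_distrib using t by (intro mult_right_mono) auto
      also have "\<dots> \<le> (cosh r - 1) * (2 * Im z * Im w)"
        using c1 I z by (intro mult_left_mono) (auto simp: power2_eq_square)
      finally show ?thesis using mem_hball_iff [OF z r] wH I by simp
    qed
    have "ennreal b = ennreal (1 / (2 * Im z)\<^sup>2) * ennreal (unit_ball_vol 2 * (t * Im z)\<^sup>2)"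
      using z t by (simp add: ennreal_mult [symmetric] b_def power_mult_distrib)
    also have "\<dots> = ennreal (1 / (2 * Im z)\<^sup>2) * emeasure lborel (ball z (t * Im z))"
      using z t by (simp add: emeasure_ball)
    also have "\<dots> = (\<integral>\<^sup>+w. ennreal (1 / (2 * Im z)\<^sup>2) * indicator (ball z (t * Im z)) w \<partial>lborel)"
      by (intro nn_integral_cmult_indicator [symmetric]) simp
    also have "\<dots> \<le> (\<integral>\<^sup>+w. ennreal (1 / (Im w)\<^sup>2) * indicator (hball z r) w \<partial>lborel)"
    proof (rule nn_integral_mono)
      fix w
      show "ennreal (1 / (2 * Im z)\<^sup>2) * indicator (ball z (t * Im z)) w \<le> ennreal (1 / (Im w)\<^sup>2) * indicator (hball z r) w"
      proof (cases "w \<in> ball z (t * Im z)")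
        case True
        with near have w: "w \<in> hball z r" "Im w \<le> 2 * Im z" by auto
        then have wH: "w \<in> hplane" using hball_subset_hplane by blast
        have "(Im w)\<^sup>2 \<le> (2 * Im z)\<^sup>2" using w wH by (intro power_mono) auto
        then have "1 / (2 * Im z)\<^sup>2 \<le> 1 / (Im w)\<^sup>2" using wH z by (intro divide_left_mono) (auto intro!: mult_pos_pos)
        then show ?thesis using True w by (auto intro!: ennreal_leI)
      qed simp
    qed
    also have "\<dots> = emeasure harea (hball z r)"
      unfolding harea_def using hball_sets [OF z] by (intro emeasure_density [symmetric] harea_density_measurable) simp
    finally show ?thesis .
  qed
  moreover have "b > 0" using t by (simp add: b_def)
  ultimately show ?thesis using that by blast
qed

section \<open>Hyperbolic convexity\<close>

text \<open>
  In the coordinates \<open>Re z\<close>, \<open>\<bar>z\<bar>\<^sup>2\<close> hyperbolic geodesics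
  are straight: a half-circle with centre \<open>a\<close> on the real axis is given by
  \<open>\<bar>z\<bar>\<^sup>2 - 2 * a * Re z = const\<close>. The half-plane becomes the region
  above a parabola.
\<close>

definition parab :: "complex \<Rightarrow> complex" where
  "parab z = Complex (Re z) ((cmod z)\<^sup>2)"

definition parab_inv :: "complex \<Rightarrow> complex" where
  "parab_inv q = Complex (Re q) (sqrt (Im q - (Re q)\<^sup>2))"

lemma parab_inv_parab: "z \<in> hplane \<Longrightarrow> parab_inv (parab z) = z"
  by (simp add: parab_def parab_inv_def cmod_power2 complex_eq_iff)

text \<open>
  Nonnegative combinations of two vectors of the hyperboloid lie between them, because
  \<open>sinh\<close> of the distances to the end points is \<open>b * sinh (hdist x y)\<close> and
  \<open>a * sinh (hdist x y)\<close>.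
\<close>

lemma hsegmentI_hvec:
  assumes H: "x \<in> hplane" "y \<in> hplane" "z \<in> hplane"
    and z: "hvec z = a *\<^sub>R hvec x + b *\<^sub>R hvec y" and ab: "a \<ge> 0" "b \<ge> 0"
  shows "z \<in> hsegment x y"
proof -
  define c where "c = cosh (hdist x y)"
  define s where "s = sinh (hdist x y)"
  have s: "s \<ge> 0" "s\<^sup>2 = c\<^sup>2 - 1" using H by (simp_all add: s_def c_def sinh_square_eq)
  have m: "mink (hvec x) (hvec x) = 1" "mink (hvec y) (hvec y) = 1" "mink (hvec x) (hvec y) = c" "mink (hvec y) (hvec x) = c"
    using H by (simp_all add: mink_hvec c_def hdist_commute)
  have 1: "a\<^sup>2 + b\<^sup>2 + 2 * a * b * c = 1"
    using mink_hvec_self [OF H(3)] by (simp add: z m power2_eq_square algebra_simps)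
  have xz: "cosh (hdist x z) = a + b * c" using mink_hvec [OF H(1,3)] by (simp add: z m)
  have zy: "cosh (hdist z y) = a * c + b" using mink_hvec [OF H(3,2)] by (simp add: z m)
  have "(sinh (hdist x z))\<^sup>2 = (b * s)\<^sup>2"
    using 1 by (simp add: sinh_square_eq xz power_mult_distrib s) (simp add: power2_eq_square algebra_simps)
  then have sxz: "sinh (hdist x z) = b * s" using H s ab by (simp add: power2_eq_iff_nonneg)
  have "(sinh (hdist z y))\<^sup>2 = (a * s)\<^sup>2"
    using 1 by (simp add: sinh_square_eq zy power_mult_distrib s) (simp add: power2_eq_square algebra_simps)
  then have szy: "sinh (hdist z y) = a * s" using H s ab by (simp add: power2_eq_iff_nonneg)
  have "cosh (hdist x z + hdist z y) = (a + b * c) * (a * c + b) + a * b * s\<^sup>2"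
    by (simp add: cosh_add xz zy sxz szy power2_eq_square)
  also have "\<dots> = c * (a\<^sup>2 + b\<^sup>2 + 2 * a * b * c)"
    by (simp add: s) (simp add: power2_eq_square algebra_simps)
  also have "\<dots> = cosh (hdist x y)" unfolding 1 by (simp add: c_def)
  finally have "hdist x z + hdist z y = hdist x y"
    using H by (subst (asm) cosh_eq_iff_nonneg) (auto intro: add_nonneg_nonneg)
  then show ?thesis using H by (simp add: hsegment_def)
qed

text \<open>
  Up to positive factors, \<open>hvec z\<close> is \<open>parab z\<close> with a coordinate
  \<open>1\<close> added. A Euclidean convex combination in the chart is therefore a nonnegative
  combination on the hyperboloid.
\<close>

lemma convex_parab_image:
  assumes C: "hconvex C"
  shows "convex (parab ` C)"
proof (rule convexI)
  fix q1 q2 and u v :: real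
  assume q: "q1 \<in> parab ` C" "q2 \<in> parab ` C" and uv: "u \<ge> 0" "v \<ge> 0" "u + v = 1"
  obtain x y where xy: "x \<in> C" "y \<in> C" "q1 = parab x" "q2 = parab y" using q by blast
  have H: "x \<in> hplane" "y \<in> hplane" using xy C by (auto simp: hconvex_def)
  define q where "q = u *\<^sub>R q1 + v *\<^sub>R q2"
  have Rq: "Re q = u * Re x + v * Re y" and Iq: "Im q = u * (cmod x)\<^sup>2 + v * (cmod y)\<^sup>2"
    by (simp_all add: q_def xy parab_def)
  have "Im q - (Re q)\<^sup>2 = u * (Im x)\<^sup>2 + v * (Im y)\<^sup>2 + u * v * (Re x - Re y)\<^sup>2"
  proof -
    have v: "v = 1 - u" using uv by simp
    show ?thesis unfolding Rq Iq cmod_power2 v by (simp add: power2_eq_square algebra_simps)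
  qed
  moreover have "u * (Im x)\<^sup>2 + v * (Im y)\<^sup>2 > 0"
  proof (cases "u = 0")
    case False
    then have "u * (Im x)\<^sup>2 > 0" using uv H by (intro mult_pos_pos) auto
    then show ?thesis using uv by (simp add: add_pos_nonneg)
  qed (use uv H in simp)
  ultimately have pos: "Im q - (Re q)\<^sup>2 > 0" using uv by (simp add: add_pos_nonneg)
  define z where "z = parab_inv q"
  have zH: "z \<in> hplane" using pos by (intro hplaneI) (simp add: z_def parab_inv_def)
  have pz: "parab z = q" using pos by (simp add: z_def parab_inv_def parab_def cmod_power2)
  have "Im z *\<^sub>R hvec z = u *\<^sub>R (Im x *\<^sub>R hvec x) + v *\<^sub>R (Im y *\<^sub>R hvec y)"
  proof -
    have "w \<in> hplane \<Longrightarrow> Im w *\<^sub>R hvec w = (Im (parab w), 1, Re (parab w))" for w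
      by (simp add: hvec_def parab_def)
    then show ?thesis using zH H uv by (simp add: pz q_def xy)
  qed
  then have "(1 / Im z) *\<^sub>R (Im z *\<^sub>R hvec z) = (1 / Im z) *\<^sub>R (u *\<^sub>R (Im x *\<^sub>R hvec x) + v *\<^sub>R (Im y *\<^sub>R hvec y))"
    by simp
  then have "hvec z = (u * Im x / Im z) *\<^sub>R hvec x + (v * Im y / Im z) *\<^sub>R hvec y"
    using zH by (simp add: scaleR_right_distrib)
  then have "z \<in> hsegment x y"
    using H zH uv by (intro hsegmentI_hvec [where a = "u * Im x / Im z" and b = "v * Im y / Im z"]) auto
  then have "z \<in> C" using C xy by (auto simp: hconvex_def)
  then show "u *\<^sub>R q1 + v *\<^sub>R q2 \<in> parab ` C" using pz q_def by (metis image_eqI)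
qed

lemma homeomorphic_parab_image:
  assumes "C \<subseteq> hplane"
  shows "C homeomorphic parab ` C"
  unfolding homeomorphic_def
proof (intro exI)
  show "homeomorphism C (parab ` C) parab parab_inv"
    unfolding homeomorphism_def parab_def parab_inv_def Complex_eq
    using assms parab_inv_parab [unfolded parab_def parab_inv_def Complex_eq]
    by (auto intro!: continuous_intros simp: image_image subset_iff)
qed

text \<open>
  These are the properties on which the lifting theorem for coverings relies.
\<close>

lemma hconvex_topology:
  assumes "hconvex C"
  shows "simply_connected C" "locally path_connected C" "path_connected C"
proof -
  have h: "C homeomorphic parab ` C" and c: "convex (parab ` C)"
    using assms homeomorphic_parab_image convex_parab_image by (auto simp: hconvex_def)
  show "simply_connected C"
    using homeomorphic_simply_connected_eq [OF h] convex_imp_simply_connected [OF c] by simp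
  show "path_connected C"
    using homeomorphic_path_connectedness [OF h] convex_imp_path_connected [OF c] by simp
  show "locally path_connected C"
    using homeomorphic_locally [where P = path_connected and Q = path_connected, OF h homeomorphic_path_connectedness]
      convex_imp_locally_path_connected [OF c] by blast
qed

section \<open>Lifts and deck transformations\<close>

lemma curve_length_polygon:
  assumes mono: "\<And>i. i < N \<Longrightarrow> t i \<le> t (Suc i)" and t01: "\<And>i. i \<le> N \<Longrightarrow> t i \<in> {0..1::real}"
  shows "ereal (\<Sum>i<N. d (\<gamma> (t i)) (\<gamma> (t (Suc i)))) \<le> curve_length d \<gamma>"
proof -
  let ?ts = "map t [0..<Suc N]"
  have "sorted ?ts" unfolding sorted_iff_nth_Suc
    using mono by (simp del: upt_Suc)
  moreover have "set ?ts \<subseteq> {0..1}" using t01 by (auto simp del: upt_Suc)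
  moreover have "(\<Sum>i<N. d (\<gamma> (t i)) (\<gamma> (t (Suc i)))) = (\<Sum>i < length ?ts - 1. d (\<gamma> (?ts ! i)) (\<gamma> (?ts ! Suc i)))"
    by (intro sum.cong) (auto simp del: upt_Suc)
  ultimately show ?thesis unfolding curve_length_def
    by (intro SUP_upper2 [of ?ts]) auto
qed

lemma curve_length_cong:
  assumes "\<And>t. t \<in> {0..1} \<Longrightarrow> \<gamma> t = \<gamma>' t"
  shows "curve_length d \<gamma> = curve_length d \<gamma>'"
  unfolding curve_length_def
proof (rule SUP_cong [OF refl])
  fix ts assume "ts \<in> {ts. sorted ts \<and> set ts \<subseteq> {0..1::real}}"
  then have "ts ! i \<in> {0..1}" if "i < length ts" for i using that nth_mem by blast
  then show "ereal (\<Sum>i<length ts - 1. d (\<gamma> (ts ! i)) (\<gamma> (ts ! Suc i))) =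
      ereal (\<Sum>i<length ts - 1. d (\<gamma>' (ts ! i)) (\<gamma>' (ts ! Suc i)))"
    using assms by (intro arg_cong [of _ _ ereal] sum.cong) auto
qed

lemma polygon_le:
  fixes d :: "'a \<Rightarrow> 'a \<Rightarrow> real"
  assumes tri: "\<And>x y z. x \<in> S \<Longrightarrow> y \<in> S \<Longrightarrow> z \<in> S \<Longrightarrow> d x z \<le> d x y + d y z"
    and "\<And>x. x \<in> S \<Longrightarrow> d x x = 0" and "\<And>i. i \<le> N \<Longrightarrow> f i \<in> S"
  shows "d (f 0) (f N) \<le> (\<Sum>i<N. d (f i) (f (Suc i)))"
  using assms(3)
proof (induction N)
  case (Suc N)
  then show ?case using tri [of "f 0" "f N" "f (Suc N)"] by fastforce
qed (use assms(2) in auto)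

text \<open>
  Segments are parametrised proportionally to arc length on the unit interval; the constant path
  serves for \<open>u = v\<close>.
\<close>

lemma hsegment_path:
  assumes C: "hconvex C" and uv: "u \<in> C" "v \<in> C"
  obtains \<sigma> :: "real \<Rightarrow> complex" where "continuous_on {0..1} \<sigma>" "\<sigma> ` {0..1} \<subseteq> C" "\<sigma> 0 = u" "\<sigma> 1 = v"
    "\<And>s t. hdist (\<sigma> s) (\<sigma> t) = \<bar>s - t\<bar> * hdist u v"
proof (cases "u = v")
  case True
  then show ?thesis using uv by (intro that [of "\<lambda>t. u"]) auto
next
  case False
  have H: "u \<in> hplane" "v \<in> hplane" using C uv by (auto simp: hconvex_def)
  obtain \<gamma> f where g: "hgeo \<gamma> (hvec u) f" "\<gamma> 0 = u" "\<gamma> (hdist u v) = v"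
    using hgeo_between [OF H False] by blast
  define \<sigma> where "\<sigma> t = \<gamma> (t * hdist u v)" for t
  have "continuous_on {0..1} \<sigma>" unfolding \<sigma>_def
    by (intro continuous_on_compose2 [OF hgeo_continuous [OF g(1), of UNIV]] continuous_intros) auto
  moreover have "\<sigma> ` {0..1} \<subseteq> C"
  proof -
    have "\<sigma> t \<in> hsegment u v" if "t \<in> {0..1}" for t
      using hsegment_imageI [OF g(1), of 0 "t * hdist u v" "hdist u v"] that H
      by (simp add: \<sigma>_def g(2,3) mult_left_le_one_le)
    then show ?thesis using C uv unfolding hconvex_def by blast
  qed
  moreover have "hdist (\<sigma> s) (\<sigma> t) = \<bar>s - t\<bar> * hdist u v" for s t
    using H by (simp add: \<sigma>_def hgeo_dist [OF g(1)] left_diff_distrib [symmetric] abs_mult)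
  ultimately show ?thesis using that [of \<sigma>] g by (simp add: \<sigma>_def)
qed

lemma compact_Sigma11: "compact Sigma11"
proof -
  define T :: "(real \<times> real) set" where "T = ({-pi..pi} \<times> {-pi..pi}) \<inter> {x. 1 \<le> (fst x)\<^sup>2 + (snd x)\<^sup>2}"
  have "compact T" unfolding T_def
    by (intro compact_Int_closed compact_Times compact_Icc closed_Collect_le continuous_intros)
  then have "compact ((\<lambda>x. (cis (fst x), cis (snd x))) ` T)"
    by (rule compact_continuous_image [rotated]) (intro continuous_intros)
  moreover have "Sigma11 = (\<lambda>x. (cis (fst x), cis (snd x))) ` T"
    by (force simp: Sigma11_def T_def abs_le_iff)
  ultimately show ?thesis by simp
qed

text \<open>
  A point of the torus off the removed disc and off its boundary.
\<close>

definition q0 :: "complex \<times> complex" where "q0 = (-1, -1)"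

lemma q0_Sigma11: "q0 \<in> Sigma11"
  unfolding Sigma11_def q0_def
proof (intro CollectI exI [of _ pi] conjI)
  have "2 * 2 \<le> pi * pi" using pi_ge_two by (intro mult_mono) auto
  then show "1 \<le> pi\<^sup>2 + pi\<^sup>2" by (simp add: power2_eq_square)
qed auto

lemma q0_not_bdry: "q0 \<notin> bdry_Sigma11"
proof
  assume "q0 \<in> bdry_Sigma11"
  then obtain t where t: "cis (cos t) = -1" by (auto simp: bdry_Sigma11_def bdry_curve_def path_image_def q0_def)
  then have "cos (cos t) = - 1" by (metis cis.sel(1) uminus_complex.simps(1) one_complex.simps(1))
  moreover have "cos (cos t) > 0"
    using cos_le_one [of t] cos_ge_minus_one [of t] pi_half_gt_zero pi_gt3 by (intro cos_gt_zero_pi) linarith+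
  ultimately show False by simp
qed

locale hyp_cover =
  fixes d :: "complex \<times> complex \<Rightarrow> complex \<times> complex \<Rightarrow> real"
    and C :: "complex set" and p :: "complex \<Rightarrow> complex \<times> complex"
  assumes hyp: "hyperbolic_metric d" and cov: "universal_cover d C p"
begin

abbreviation bdC :: "complex set" where
  "bdC \<equiv> hplane \<inter> frontier C"

sublocale M: Metric_space Sigma11 d
  using hyp by (simp add: hyperbolic_metric_def)

lemma hconvex_C: "hconvex C" and closedin_C: "closedin (top_of_set hplane) C"
  and covering: "covering_space C p Sigma11"
  and bdry_C: "{x \<in> C. p x \<in> bdry_Sigma11} = bdC"
  and components_hline: "K \<in> components bdC \<Longrightarrow> hline K"
  using cov by (auto simp: universal_cover_def)

lemma local_isometry:
  "x \<in> C \<Longrightarrow> \<exists>r>0. \<forall>y \<in> C \<inter> hball x r. \<forall>z \<in> C \<inter> hball x r. d (p y) (p z) = hdist y z"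
  using cov by (auto simp: universal_cover_def)

lemma C_hplane: "C \<subseteq> hplane" and C_hplaneD: "x \<in> C \<Longrightarrow> x \<in> hplane"
  using hconvex_C by (auto simp: hconvex_def)

lemma p_image: "p ` C = Sigma11" and continuous_p: "continuous_on C p"
  using covering_space_imp_surjective [OF covering] covering_space_imp_continuous [OF covering] by auto

lemma p_in: "x \<in> C \<Longrightarrow> p x \<in> Sigma11"
  using p_image by blast

lemma hdist_polygon:
  assumes "\<And>i. i \<le> N \<Longrightarrow> f i \<in> C"
  shows "hdist (f 0) (f N) \<le> (\<Sum>i<N. hdist (f i) (f (Suc i)))"
  by (rule polygon_le [of C]) (auto intro: assms hdist_triangle C_hplaneD)

lemma d_polygon:
  assumes "\<And>i. i \<le> N \<Longrightarrow> f i \<in> C"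
  shows "d (p (f 0)) (p (f N)) \<le> (\<Sum>i<N. d (p (f i)) (p (f (Suc i))))"
  by (rule polygon_le [of Sigma11 d _ "\<lambda>i. p (f i)"]) (auto intro: assms M.triangle p_in)

text \<open>
  The balls on which \<open>p\<close> is isometric cover the compact path; a Lebesgue number of this
  cover tells how finely the unit interval has to be divided.
\<close>

lemma fine_partition:
  fixes \<sigma> :: "real \<Rightarrow> complex"
  assumes s: "continuous_on {0..1} \<sigma>" "\<sigma> ` {0..1} \<subseteq> C"
  obtains N :: nat where "N > 0"
    "\<And>i. i < N \<Longrightarrow> d (p (\<sigma> (i / N))) (p (\<sigma> (Suc i / N))) = hdist (\<sigma> (i / N)) (\<sigma> (Suc i / N))"
proof -
  obtain r where r: "\<And>x. x \<in> C \<Longrightarrow> r x > 0"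
    "\<And>x y z. \<lbrakk>x \<in> C; y \<in> C \<inter> hball x (r x); z \<in> C \<inter> hball x (r x)\<rbrakk> \<Longrightarrow> d (p y) (p z) = hdist y z"
    using local_isometry by metis
  define \<C> where "\<C> = (\<lambda>x. hball x (r x)) ` C"
  have cpt: "compact (\<sigma> ` {0..1})" using s(1) by (intro compact_continuous_image) auto
  have ne: "\<C> \<noteq> {}" using s(2) by (auto simp: \<C>_def)
  have cover: "\<sigma> ` {0..1} \<subseteq> \<Union>\<C>"
  proof
    fix x assume "x \<in> \<sigma> ` {0..1}"
    then have "x \<in> C" using s(2) by blast
    then show "x \<in> \<Union>\<C>" using centre_in_hball [OF C_hplaneD r(1)] by (auto simp: \<C>_def)
  qed
  have "open B" if "B \<in> \<C>" for B using that open_hball C_hplaneD by (auto simp: \<C>_def)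
  with Lebesgue_number_lemma [OF cpt ne cover] obtain \<delta> where
    \<delta>: "0 < \<delta>" "\<And>T. \<lbrakk>T \<subseteq> \<sigma> ` {0..1}; diameter T < \<delta>\<rbrakk> \<Longrightarrow> \<exists>B\<in>\<C>. T \<subseteq> B" by metis
  have "uniformly_continuous_on {0..1} \<sigma>" using s(1) by (intro compact_uniformly_continuous) auto
  then obtain \<epsilon> where \<epsilon>: "\<epsilon> > 0" "\<And>a b. \<lbrakk>a \<in> {0..1}; b \<in> {0..1}; dist a b < \<epsilon>\<rbrakk> \<Longrightarrow> dist (\<sigma> a) (\<sigma> b) < \<delta>"
    using \<delta>(1) unfolding uniformly_continuous_on_def by metis
  obtain M :: nat where M: "inverse (real (Suc M)) < \<epsilon>" using reals_Archimedean [OF \<epsilon>(1)] by blast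
  define N where "N = Suc M"
  have "d (p (\<sigma> (i / N))) (p (\<sigma> (Suc i / N))) = hdist (\<sigma> (i / N)) (\<sigma> (Suc i / N))" if i: "i < N" for i
  proof -
    let ?a = "real i / N" and ?b = "real (Suc i) / N"
    have ab: "?a \<in> {0..1}" "?b \<in> {0..1}" using i by auto
    have "?b - ?a = inverse (real (Suc M))" by (simp add: N_def field_simps)
    moreover have "inverse (real (Suc M)) > 0" by simp
    ultimately have "dist ?a ?b < \<epsilon>" unfolding dist_real_def using M by linarith
    then have "dist (\<sigma> ?a) (\<sigma> ?b) < \<delta>" by (rule \<epsilon>(2) [OF ab])
    moreover have "diameter {\<sigma> ?a, \<sigma> ?b} \<le> dist (\<sigma> ?a) (\<sigma> ?b)"
      by (rule diameter_le) (auto simp: dist_norm norm_minus_commute)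
    ultimately have "diameter {\<sigma> ?a, \<sigma> ?b} < \<delta>" by linarith
    moreover have "{\<sigma> ?a, \<sigma> ?b} \<subseteq> \<sigma> ` {0..1}"
      unfolding insert_subset using ab by (metis empty_subsetI imageI)
    ultimately obtain B where B: "B \<in> \<C>" "{\<sigma> ?a, \<sigma> ?b} \<subseteq> B" by (meson \<delta>(2))
    then obtain x where x: "x \<in> C" "\<sigma> ?a \<in> hball x (r x)" "\<sigma> ?b \<in> hball x (r x)"
      unfolding \<C>_def by (elim imageE) simp
    have "\<sigma> ?a \<in> C \<inter> hball x (r x)" "\<sigma> ?b \<in> C \<inter> hball x (r x)" using x s(2) ab by blast+
    then show ?thesis by (rule r(2) [OF x(1)])
  qed
  then show ?thesis using that [of N] by (simp add: N_def)
qed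

lemma partition_in_C:
  assumes "\<sigma> ` {0..1} \<subseteq> C" "N > (0::nat)" "i \<le> N"
  shows "\<sigma> (real i / real N) \<in> C"
  using assms by (intro subsetD [OF assms(1)] imageI) auto

text \<open>
  On a fine polygon the lengths upstairs and downstairs agree, and the polygon upstairs joins the
  end points.
\<close>

lemma lift_dist_le_length:
  fixes \<sigma> :: "real \<Rightarrow> complex"
  assumes s: "continuous_on {0..1} \<sigma>" "\<sigma> ` {0..1} \<subseteq> C"
  shows "ereal (hdist (\<sigma> 0) (\<sigma> 1)) \<le> curve_length d (\<lambda>t. p (\<sigma> t))"
proof -
  obtain N :: nat where N: "N > 0" "\<And>i. i < N \<Longrightarrow> d (p (\<sigma> (i / N))) (p (\<sigma> (Suc i / N))) = hdist (\<sigma> (i / N)) (\<sigma> (Suc i / N))"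
    using fine_partition [OF s] by blast
  have "hdist (\<sigma> (real 0 / N)) (\<sigma> (real N / N)) \<le> (\<Sum>i<N. hdist (\<sigma> (real i / N)) (\<sigma> (real (Suc i) / N)))"
    by (rule hdist_polygon [of N "\<lambda>i. \<sigma> (real i / N)"]) (rule partition_in_C [OF s(2) N(1)])
  also have "\<dots> = (\<Sum>i<N. d (p (\<sigma> (real i / N))) (p (\<sigma> (real (Suc i) / N))))"
    using N(2) by (intro sum.cong) auto
  finally have *: "hdist (\<sigma> 0) (\<sigma> 1) \<le> (\<Sum>i<N. d (p (\<sigma> (real i / N))) (p (\<sigma> (real (Suc i) / N))))"
    using N(1) by simp
  have "ereal (\<Sum>i<N. d (p (\<sigma> (real i / N))) (p (\<sigma> (real (Suc i) / N)))) \<le> curve_length d (\<lambda>t. p (\<sigma> t))"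
    by (rule curve_length_polygon [where t = "\<lambda>i. real i / real N"]) (use N(1) in \<open>auto simp: divide_right_mono\<close>)
  then show ?thesis using * by (meson ereal_less_eq(3) order_trans)
qed

text \<open>
  Add up the local isometries along the segment from \<open>u\<close> to \<open>v\<close>.
\<close>

lemma p_nonexpanding:
  assumes uv: "u \<in> C" "v \<in> C"
  shows "d (p u) (p v) \<le> hdist u v"
proof -
  obtain \<sigma> :: "real \<Rightarrow> complex" where s: "continuous_on {0..1} \<sigma>" "\<sigma> ` {0..1} \<subseteq> C" and e: "\<sigma> 0 = u" "\<sigma> 1 = v"
    "\<And>s t. hdist (\<sigma> s) (\<sigma> t) = \<bar>s - t\<bar> * hdist u v" using hsegment_path [OF hconvex_C uv] by metis
  obtain N :: nat where N: "N > 0" "\<And>i. i < N \<Longrightarrow> d (p (\<sigma> (i / N))) (p (\<sigma> (Suc i / N))) = hdist (\<sigma> (i / N)) (\<sigma> (Suc i / N))"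
    using fine_partition [OF s] by blast
  have "d (p (\<sigma> (real 0 / N))) (p (\<sigma> (real N / N))) \<le> (\<Sum>i<N. d (p (\<sigma> (real i / N))) (p (\<sigma> (real (Suc i) / N))))"
    by (rule d_polygon [of N "\<lambda>i. \<sigma> (real i / N)"]) (rule partition_in_C [OF s(2) N(1)])
  also have "\<dots> = (\<Sum>i<N. hdist u v / N)"
  proof (rule sum.cong [OF refl])
    fix i assume "i \<in> {..<N}"
    then show "d (p (\<sigma> (real i / N))) (p (\<sigma> (real (Suc i) / N))) = hdist u v / N"
      using N e(3) by (simp add: diff_divide_distrib [symmetric])
  qed
  finally show ?thesis using N(1) e by simp
qed

definition deck :: "(complex \<Rightarrow> complex) \<Rightarrow> bool" where
  "deck g \<longleftrightarrow> continuous_on C g \<and> g ` C \<subseteq> C \<and> (\<forall>z\<in>C. p (g z) = p z)"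

lemma deckD: "deck g \<Longrightarrow> z \<in> C \<Longrightarrow> g z \<in> C" "deck g \<Longrightarrow> z \<in> C \<Longrightarrow> p (g z) = p z"
  by (auto simp: deck_def)

text \<open>
  Lift \<open>p\<close> itself through the covering \<open>p\<close>, with prescribed value at
  \<open>x\<close>.
\<close>

lemma deck_exists:
  assumes "x \<in> C" "y \<in> C" "p x = p y"
  obtains g where "deck g" "g x = y"
proof -
  have "p \<in> C \<rightarrow> Sigma11" using p_in by blast
  from covering_space_lift_strong [OF covering assms(2,1) hconvex_topology(1,2) [OF hconvex_C] continuous_p this assms(3)]
  obtain g where "continuous_on C g" "g \<in> C \<rightarrow> C" "g x = y" "\<And>z. z \<in> C \<Longrightarrow> p (g z) = p z" by blast
  then show ?thesis by (intro that [of g]) (auto simp: deck_def)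
qed

lemma deck_unique:
  assumes "deck g" "deck h" "z \<in> C" "g z = h z" "w \<in> C"
  shows "g w = h w"
  by (rule covering_space_lift_unique [OF covering, of g z h C p w])
     (use assms continuous_p p_in hconvex_topology(3) [OF hconvex_C] in \<open>auto simp: deck_def path_connected_imp_connected\<close>)

lemma deck_id: "deck (\<lambda>z. z)"
  by (auto simp: deck_def)

lemma deck_comp:
  assumes "deck g" "deck h"
  shows "deck (\<lambda>z. g (h z))"
proof -
  have "continuous_on C (\<lambda>z. g (h z))"
    using assms by (intro continuous_on_compose2 [of C g C h]) (auto simp: deck_def)
  then show ?thesis using assms by (simp add: deck_def image_subset_iff)
qed

text \<open>
  The image of the segment from \<open>u\<close> to \<open>v\<close> has a fine polygon whose edges
  have the same length downstairs, where they are at most as long as the edges of the segment.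
\<close>

lemma deck_nonexpanding:
  assumes g: "deck g" and uv: "u \<in> C" "v \<in> C"
  shows "hdist (g u) (g v) \<le> hdist u v"
proof -
  obtain \<sigma> :: "real \<Rightarrow> complex" where s: "continuous_on {0..1} \<sigma>" "\<sigma> ` {0..1} \<subseteq> C" and e: "\<sigma> 0 = u" "\<sigma> 1 = v"
    "\<And>s t. hdist (\<sigma> s) (\<sigma> t) = \<bar>s - t\<bar> * hdist u v" using hsegment_path [OF hconvex_C uv] by metis
  define \<tau> where "\<tau> t = g (\<sigma> t)" for t
  have t: "continuous_on {0..1} \<tau>" "\<tau> ` {0..1} \<subseteq> C"
    using g s unfolding \<tau>_def deck_def by (auto intro!: continuous_on_compose2 [of C g _ \<sigma>])
  obtain N :: nat where N: "N > 0" "\<And>i. i < N \<Longrightarrow> d (p (\<tau> (i / N))) (p (\<tau> (Suc i / N))) = hdist (\<tau> (i / N)) (\<tau> (Suc i / N))"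
    using fine_partition [OF t] by blast
  have "hdist (\<tau> (real 0 / N)) (\<tau> (real N / N)) \<le> (\<Sum>i<N. hdist (\<tau> (real i / N)) (\<tau> (real (Suc i) / N)))"
    by (rule hdist_polygon [of N "\<lambda>i. \<tau> (real i / N)"]) (rule partition_in_C [OF t(2) N(1)])
  also have "\<dots> \<le> (\<Sum>i<N. hdist u v / N)"
  proof (rule sum_mono)
    fix i assume "i \<in> {..<N}"
    then have i: "i < N" by simp
    have c: "\<sigma> (real i / N) \<in> C" "\<sigma> (real (Suc i) / N) \<in> C"
      using i by (auto intro!: partition_in_C [OF s(2) N(1)] simp del: of_nat_Suc)
    have "hdist (\<tau> (real i / N)) (\<tau> (real (Suc i) / N)) = d (p (\<tau> (real i / N))) (p (\<tau> (real (Suc i) / N)))"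
      using N(2) [OF i] by simp
    also have "\<dots> = d (p (\<sigma> (real i / N))) (p (\<sigma> (real (Suc i) / N)))"
      unfolding \<tau>_def using deckD(2) [OF g] c by simp
    also have "\<dots> \<le> hdist (\<sigma> (real i / N)) (\<sigma> (real (Suc i) / N))" by (rule p_nonexpanding [OF c])
    also have "\<dots> = hdist u v / N" using N(1) by (simp add: e(3) diff_divide_distrib [symmetric])
    finally show "hdist (\<tau> (real i / N)) (\<tau> (real (Suc i) / N)) \<le> hdist u v / N" .
  qed
  finally show ?thesis using N(1) e by (simp add: \<tau>_def)
qed

lemma deck_inverse:
  assumes g: "deck g"
  shows "\<exists>h. deck h \<and> (\<forall>z\<in>C. h (g z) = z) \<and> (\<forall>z\<in>C. g (h z) = z)"
proof -
  obtain x where x: "x \<in> C"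
    using p_image q0_Sigma11 by blast
  obtain h where h: "deck h" "h (g x) = x"
    using deck_exists [of "g x" x] deckD [OF g] x by metis
  have 1: "h (g z) = z" if "z \<in> C" for z
    by (rule deck_unique [OF deck_comp [OF h(1) g] deck_id x _ that]) (simp add: h)
  have 2: "g (h z) = z" if "z \<in> C" for z
    by (rule deck_unique [OF deck_comp [OF g h(1)] deck_id deckD(1) [OF g x] _ that]) (simp add: h)
  show ?thesis using h(1) 1 2 by blast
qed

lemma deck_isometry:
  assumes g: "deck g" and uv: "u \<in> C" "v \<in> C"
  shows "hdist (g u) (g v) = hdist u v"
proof -
  obtain h where h: "deck h" "\<And>z. z \<in> C \<Longrightarrow> h (g z) = z" "\<And>z. z \<in> C \<Longrightarrow> g (h z) = z" using deck_inverse [OF g] by blast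
  have "hdist u v \<le> hdist (g u) (g v)"
    using deck_nonexpanding [OF h(1) deckD(1) [OF g uv(1)] deckD(1) [OF g uv(2)]] h(2) uv by simp
  then show ?thesis using deck_nonexpanding [OF g uv] by simp
qed

text \<open>
  The compact surface has finite diameter; lift an almost shortest path from \<open>p x\<close> to
  \<open>q\<close>.
\<close>

lemma cobounded:
  obtains D where "D > 0" "\<And>x q. x \<in> C \<Longrightarrow> q \<in> Sigma11 \<Longrightarrow> \<exists>y\<in>C. p y = q \<and> hdist x y \<le> D"
proof -
  have "compactin M.mtopology Sigma11"
    using hyp compact_Sigma11 by (simp add: hyperbolic_metric_def compactin_subtopology)
  then have "M.mbounded Sigma11" by (rule M.compactin_imp_mbounded)
  then obtain B where B: "B > 0" "\<And>x y. x \<in> Sigma11 \<Longrightarrow> y \<in> Sigma11 \<Longrightarrow> d x y \<le> B"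
    unfolding M.mbounded_alt_pos by blast
  have "\<exists>y\<in>C. p y = q \<and> hdist x y \<le> B + 1" if x: "x \<in> C" and q: "q \<in> Sigma11" for x q
  proof -
    have "ereal (d (p x) q) = (INF \<gamma> \<in> {\<gamma>. path \<gamma> \<and> path_image \<gamma> \<subseteq> Sigma11 \<and> pathstart \<gamma> = p x \<and> pathfinish \<gamma> = q}. curve_length d \<gamma>)"
      using hyp p_in [OF x] q by (simp add: hyperbolic_metric_def length_metric_on_def)
    moreover have "ereal (d (p x) q) < ereal (B + 1)" using B(2) [OF p_in [OF x] q] by simp
    ultimately obtain \<gamma> where \<gamma>: "path \<gamma>" "path_image \<gamma> \<subseteq> Sigma11" "pathstart \<gamma> = p x" "pathfinish \<gamma> = q"
      "curve_length d \<gamma> < ereal (B + 1)" by (auto simp: INF_less_iff)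
    obtain \<sigma> where \<sigma>: "path \<sigma>" "path_image \<sigma> \<subseteq> C" "pathstart \<sigma> = x" "\<And>t. t \<in> {0..1} \<Longrightarrow> p (\<sigma> t) = \<gamma> t"
      using covering_space_lift_path_strong [OF covering x \<gamma>(1,2,3)] by blast
    have "curve_length d (\<lambda>t. p (\<sigma> t)) = curve_length d \<gamma>"
      by (rule curve_length_cong) (rule \<sigma>(4))
    then have "ereal (hdist (\<sigma> 0) (\<sigma> 1)) < ereal (B + 1)"
      using lift_dist_le_length [of \<sigma>] \<sigma>(1,2) \<gamma>(5) unfolding path_def path_image_def
      by (metis order.strict_trans1)
    moreover have "\<sigma> 0 = x" "p (\<sigma> 1) = q" "\<sigma> 1 \<in> C"
      using \<sigma> \<gamma>(4) by (auto simp: pathstart_def pathfinish_def path_image_def)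
    ultimately show ?thesis by (intro bexI [of _ "\<sigma> 1"]) auto
  qed
  then show ?thesis using that [of "B + 1"] B(1) by simp
qed

lemma frontier_C: "bdC \<subseteq> C"
  using bdry_C by blast

lemma deck_frontier:
  assumes "deck g" "z \<in> bdC"
  shows "g z \<in> bdC"
proof -
  have "z \<in> C" "p z \<in> bdry_Sigma11" using assms(2) unfolding bdry_C [symmetric] by simp_all
  then show ?thesis unfolding bdry_C [symmetric] using deckD [OF assms(1)] by simp
qed

lemma exit_point:
  assumes g: "hgeo \<gamma> e f" and ab: "a \<le> b" and in_C: "\<gamma> a \<in> C" and not_in: "\<gamma> b \<notin> C"
  obtains s where "a \<le> s" "s \<le> b" "\<gamma> s \<in> bdC"
proof -
  have "connected (\<gamma> ` {a..b})"
    by (intro connected_continuous_image hgeo_continuous [OF g] connected_Icc)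
  moreover have "\<gamma> ` {a..b} \<inter> C \<noteq> {}" "\<gamma> ` {a..b} - C \<noteq> {}"
  proof -
    have "\<gamma> a \<in> \<gamma> ` {a..b}" "\<gamma> b \<in> \<gamma> ` {a..b}" using ab by auto
    then show "\<gamma> ` {a..b} \<inter> C \<noteq> {}" "\<gamma> ` {a..b} - C \<noteq> {}" using in_C not_in by blast+
  qed
  ultimately have "\<gamma> ` {a..b} \<inter> frontier C \<noteq> {}" by (rule connected_Int_frontier)
  then show ?thesis using that hgeoD(5) [OF g] by auto
qed

lemma hball_subset_C:
  assumes x: "x \<in> C" and far: "\<And>z. z \<in> bdC \<Longrightarrow> hdist x z \<ge> r"
  shows "hball x r \<subseteq> C"
proof
  fix y assume "y \<in> hball x r"
  then have y: "y \<in> hplane" "hdist x y < r" by (auto simp: hball_def)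
  show "y \<in> C"
  proof (rule ccontr)
    assume "y \<notin> C"
    with x have "x \<noteq> y" by blast
    then obtain \<gamma> f where g: "hgeo \<gamma> (hvec x) f" "\<gamma> 0 = x" "\<gamma> (hdist x y) = y"
      using hgeo_between [OF C_hplaneD [OF x] y(1)] by blast
    obtain s where s: "0 \<le> s" "s \<le> hdist x y" "\<gamma> s \<in> bdC"
      using exit_point [OF g(1), of 0 "hdist x y"] g(2,3) x \<open>y \<notin> C\<close> C_hplaneD [OF x] y(1) by auto
    have "hdist x (\<gamma> s) = s" using hgeo_dist [OF g(1), of 0 s] s(1) g(2) by simp
    then show False using far [OF s(3)] s(2) y(2) by simp
  qed
qed

definition orb :: "complex set" where "orb = {y \<in> C. p y = q0}"

lemma orb_C: "y \<in> orb \<Longrightarrow> y \<in> C"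
  by (simp add: orb_def)

text \<open>
  Near one point over \<open>q0\<close> this holds since \<open>p\<close> is locally injective and
  the point is not on the frontier. Deck transformations are isometries of \<open>C\<close> that
  preserve the frontier, so the same radius works on the whole orbit.
\<close>

lemma orb_interior:
  obtains r where "r > 0" "\<And>z. z \<in> orb \<Longrightarrow> hball z r \<subseteq> C"
    "\<And>z w. z \<in> orb \<Longrightarrow> w \<in> orb \<Longrightarrow> z \<noteq> w \<Longrightarrow> 2 * r \<le> hdist z w"
proof -
  obtain x where x: "x \<in> C" "p x = q0" using q0_Sigma11 p_image by (metis imageE)
  have "x \<notin> frontier C" using x q0_not_bdry bdry_C C_hplaneD [OF x(1)] by (metis (mono_tags, lifting) IntI mem_Collect_eq)
  then have "x \<in> interior C" using x(1) closure_subset by (auto simp: frontier_def)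
  then obtain r1 where r1: "r1 > 0" "hball x r1 \<subseteq> interior C"
    using hball_subset_open [OF C_hplaneD [OF x(1)] open_interior] by blast
  obtain r2 where r2: "r2 > 0" "\<And>y z. y \<in> C \<inter> hball x r2 \<Longrightarrow> z \<in> C \<inter> hball x r2 \<Longrightarrow> d (p y) (p z) = hdist y z"
    using local_isometry [OF x(1)] by blast
  define r where "r = min r1 (r2 / 2)"
  have moved: "\<exists>g. deck g \<and> g x = z" if "z \<in> orb" for z
    using that x deck_exists [of x z] by (metis (mono_tags, lifting) mem_Collect_eq orb_def)
  have ball: "hball z r \<subseteq> C" if z: "z \<in> orb" for z
  proof (rule hball_subset_C)
    show "z \<in> C" using z orb_C by blast
    obtain g where g: "deck g" "g x = z" using moved [OF z] by blast
    obtain h where h: "deck h" "\<And>z. z \<in> C \<Longrightarrow> h (g z) = z" "\<And>z. z \<in> C \<Longrightarrow> g (h z) = z" using deck_inverse [OF g(1)] by blast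
    fix w assume w: "w \<in> bdC"
    then have hw: "h w \<in> bdC" using deck_frontier [OF h(1)] by blast
    have "h w \<notin> interior C" using hw by (simp add: frontier_def)
    then have "h w \<notin> hball x r1" using r1 by blast
    then have "hdist x (h w) \<ge> r1" using hw by (simp add: hball_def)
    moreover have "hdist x (h w) = hdist z w"
      using deck_isometry [OF h(1), of z w] h(2) [OF x(1)] g(2) z orb_C w frontier_C by auto
    ultimately show "r \<le> hdist z w" by (simp add: r_def)
  qed
  have sep: "2 * r \<le> hdist z w" if z: "z \<in> orb" "w \<in> orb" "z \<noteq> w" for z w
  proof -
    obtain g where g: "deck g" "g x = z" using moved [OF z(1)] by blast
    obtain h where h: "deck h" "\<And>z. z \<in> C \<Longrightarrow> h (g z) = z" "\<And>z. z \<in> C \<Longrightarrow> g (h z) = z" using deck_inverse [OF g(1)] by blast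
    have hw: "h w \<in> C" "p (h w) = q0" using deckD [OF h(1)] z(2) by (auto simp: orb_def)
    have ne: "h w \<noteq> x" using h(3) [of w] g(2) z orb_C by auto
    have "hdist x (h w) = hdist z w"
      using deck_isometry [OF h(1), of z w] h(2) [OF x(1)] g(2) z orb_C by auto
    moreover have "hdist x (h w) \<ge> r2"
    proof (rule ccontr)
      assume "\<not> ?thesis"
      then have "h w \<in> C \<inter> hball x r2" "x \<in> C \<inter> hball x r2"
        using hw(1) x(1) C_hplaneD r2(1) by (auto simp: hball_def)
      then have "d (p x) (p (h w)) = hdist x (h w)" using r2(2) by blast
      then show False using x(2) hw ne q0_Sigma11 hdist_eq_0_iff [of x "h w"] C_hplaneD x(1) by auto
    qed
    ultimately show ?thesis by (simp add: r_def)
  qed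
  have "r > 0" using r1 r2 by (simp add: r_def)
  then show ?thesis using that ball sep by blast
qed

end

section \<open>Boundary geodesics\<close>

lemma open_parab_image:
  assumes "open U" "U \<subseteq> hplane"
  shows "open (parab ` U)"
proof -
  have "parab ` U = {q. (Re q)\<^sup>2 < Im q} \<inter> parab_inv -` U"
  proof
    show "parab ` U \<subseteq> {q. (Re q)\<^sup>2 < Im q} \<inter> parab_inv -` U"
      using assms(2) by (auto simp: parab_inv_parab subset_iff) (auto simp: parab_def cmod_power2)
    show "{q. (Re q)\<^sup>2 < Im q} \<inter> parab_inv -` U \<subseteq> parab ` U"
    proof
      fix q assume q: "q \<in> {q. (Re q)\<^sup>2 < Im q} \<inter> parab_inv -` U"
      then have "parab (parab_inv q) = q" by (simp add: parab_inv_def parab_def cmod_power2)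
      then show "q \<in> parab ` U" using q by (metis IntD2 image_eqI vimageD)
    qed
  qed
  moreover have "open {q. (Re q)\<^sup>2 < Im q}" by (intro open_Collect_less continuous_intros)
  moreover have "open (parab_inv -` U)"
    unfolding parab_inv_def Complex_eq by (intro open_vimage assms continuous_intros)
  ultimately show ?thesis by (simp add: open_Int)
qed

text \<open>
  The unit vector \<open>n\<close> completes \<open>e\<close>, \<open>f\<close> to an orthogonal
  basis; it is the normal of the geodesic with frame \<open>e\<close>, \<open>f\<close>.
\<close>

definition hnormal :: "mvec \<Rightarrow> mvec \<Rightarrow> mvec \<Rightarrow> bool" where
  "hnormal e f n \<longleftrightarrow> mink n e = 0 \<and> mink n f = 0 \<and> mink n n = -1 \<and>
     (\<forall>v. v = mink v e *\<^sub>R e - mink v f *\<^sub>R f - mink v n *\<^sub>R n)"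

lemma hnormal_minus: "hnormal e f n \<Longrightarrow> hnormal e f (- n)"
  by (simp add: hnormal_def)

lemma hnormal_exists:
  assumes "mink e e = 1" "mink e f = 0" "mink f f = -1"
  obtains n where "hnormal e f n"
proof -
  obtain a b x where e: "e = (a, b, x)" by (metis prod_cases3)
  obtain a' b' x' where f: "f = (a', b', x')" by (metis prod_cases3)
  have ee: "a * b - x * x = 1" and ef: "(a * b' + a' * b) / 2 - x * x' = 0" and ff: "a' * b' - x' * x' = -1"
    using assms by (simp_all add: e f mink_def)
  define n where "n = (x * a' - a * x', b * x' - x * b', (b * a' - a * b') / 2)"
  have ne: "mink n e = 0" "mink n f = 0"
    by (simp_all add: n_def e f mink_def algebra_simps)
  have "mink n n = (a * b - x * x) * (a' * b' - x' * x') - ((a * b' + a' * b) / 2 - x * x')\<^sup>2"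
    by (simp add: n_def mink_def power2_eq_square field_simps)
  then have nn: "mink n n = -1" by (simp add: ee ef ff)
  have "v = mink v e *\<^sub>R e - mink v f *\<^sub>R f - mink v n *\<^sub>R n" for v
  proof -
    define w where "w = v - (mink v e *\<^sub>R e - mink v f *\<^sub>R f - mink v n *\<^sub>R n)"
    have fe: "mink f e = 0" "mink e n = 0" "mink f n = 0"
      using assms ne mink_commute by metis+
    have we: "mink w e = 0" "mink w f = 0" and wn: "mink w n = 0"
      using assms ne nn fe by (simp_all add: w_def)
    obtain w1 w2 w3 where w: "w = (w1, w2, w3)" by (metis prod_cases3)
    have we': "w1 * b + a * w2 = 2 * (w3 * x)" "w1 * b' + a' * w2 = 2 * (w3 * x')"
      using we by (simp_all add: w e f mink_def)
    define n1 n2 n3 where "n1 = x * a' - a * x'" and "n2 = b * x' - x * b'" and "n3 = (b * a' - a * b') / 2"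
    have n: "n = (n1, n2, n3)" by (simp add: n_def n1_def n2_def n3_def)
    have n3: "2 * n3 = b * a' - a * b'" by (simp add: n3_def)
    \<comment> \<open>\<open>w\<close> is orthogonal to \<open>e\<close> and \<open>f\<close>, hence proportional to their cross product \<open>n\<close>.\<close>
    have "2 * (n1 * w2) = 2 * (n2 * w1)" using we' unfolding n1_def n2_def by algebra
    moreover have "2 * (n1 * w3) = 2 * (n3 * w1)" using we' n3 unfolding n1_def by algebra
    moreover have "2 * (n2 * w3) = 2 * (n3 * w2)" using we' n3 unfolding n2_def by algebra
    ultimately have c: "n1 * w2 = n2 * w1" "n1 * w3 = n3 * w1" "n2 * w3 = n3 * w2" by simp_all
    have N: "n1 * n2 - n3 * n3 = -1" using nn by (simp add: n mink_def)
    have W: "w1 * n2 + n1 * w2 = 2 * (w3 * n3)" using wn by (simp add: w n mink_def)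
    have "2 * w1 = 0" using c N W by algebra
    moreover have "2 * w2 = 0" using c N W by algebra
    moreover have "2 * w3 = 0" using c N W by algebra
    ultimately have "w = 0" by (simp add: w zero_prod_def)
    then show ?thesis by (simp add: w_def)
  qed
  then have "hnormal e f n" using ne nn by (simp add: hnormal_def)
  then show ?thesis by (rule that)
qed

lemma hgeo_on_line:
  assumes g: "hgeo \<gamma> e f" and n: "hnormal e f n" and z: "z \<in> hplane" "mink (hvec z) n = 0"
  obtains s where "z = \<gamma> s"
proof -
  define A B where "A = mink (hvec z) e" and "B = - mink (hvec z) f"
  have v: "hvec z = A *\<^sub>R e + B *\<^sub>R f"
    using n z(2) unfolding hnormal_def A_def B_def by (metis (no_types, opaque_lifting) diff_zero scaleR_zero_left
        scaleR_minus_left diff_minus_eq_add minus_diff_eq uminus_add_conv_diff add.commute)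
  have "A > 0"
    using mink_hvec [OF z(1) hgeoD(5) [OF g, of 0]] hgeoD(7) [OF g, of 0] by (simp add: A_def)
  moreover have "A\<^sup>2 = 1 + B\<^sup>2"
    using mink_hvec_self [OF z(1)] hgeoD(1-4) [OF g] by (simp add: v power2_eq_square)
  ultimately have "A = sqrt (1 + B\<^sup>2)" by (metis abs_of_pos real_sqrt_abs)
  then have "A = cosh (arsinh B)" by (simp add: cosh_arsinh_real add.commute)
  then have "hvec z = hvec (\<gamma> (arsinh B))" by (simp add: hgeoD(7) [OF g] v)
  then have "z = \<gamma> (arsinh B)" using hvec_inj z(1) hgeoD(5) [OF g] by blast
  then show ?thesis by (rule that)
qed

context hyp_cover
begin

text \<open>
  A parametrised boundary geodesic of \<open>C\<close> with its normal \<open>n\<close> pointing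
  into \<open>C\<close>. As \<open>mink n n = -1\<close>, points on the side of \<open>n\<close>
  have a negative product with \<open>n\<close>.
\<close>

definition bline :: "(real \<Rightarrow> complex) \<Rightarrow> mvec \<Rightarrow> mvec \<Rightarrow> mvec \<Rightarrow> bool" where
  "bline \<gamma> e f n \<longleftrightarrow> hgeo \<gamma> e f \<and> hnormal e f n \<and> range \<gamma> \<in> components bdC \<and>
     (\<forall>z\<in>C. mink (hvec z) n \<le> 0)"

lemma blineD:
  assumes "bline \<gamma> e f n"
  shows "hgeo \<gamma> e f" "hnormal e f n" "range \<gamma> \<in> components bdC"
    "z \<in> C \<Longrightarrow> mink (hvec z) n \<le> 0" "\<gamma> s \<in> C" "\<gamma> s \<in> bdC" "mink (hvec (\<gamma> s)) n = 0"
    "mink e n = 0" "mink f n = 0" "mink n e = 0" "mink n f = 0" "mink n n = -1"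
proof -
  show *: "hgeo \<gamma> e f" "hnormal e f n" "range \<gamma> \<in> components bdC"
    "z \<in> C \<Longrightarrow> mink (hvec z) n \<le> 0" using assms by (auto simp: bline_def)
  show f: "\<gamma> s \<in> bdC" using in_components_subset [OF *(3)] by blast
  then show "\<gamma> s \<in> C" using frontier_C by blast
  show "mink n e = 0" "mink n f = 0" "mink n n = -1" using *(2) by (auto simp: hnormal_def)
  then show "mink e n = 0" "mink f n = 0" using mink_commute by metis+
  then show "mink (hvec (\<gamma> s)) n = 0" by (simp add: hgeoD(7) [OF *(1)])
qed

lemma interior_C_nonempty: "interior C \<noteq> {}"
proof -
  obtain x where x: "x \<in> C" "p x = q0" using q0_Sigma11 p_image by (metis imageE)
  obtain r where r: "r > 0" "\<And>z. z \<in> orb \<Longrightarrow> hball z r \<subseteq> C" using orb_interior by metis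
  have "hball x r \<subseteq> interior C"
    using r(2) [of x] x C_hplaneD by (intro interior_maximal open_hball) (auto simp: orb_def)
  then show ?thesis using centre_in_hball [OF C_hplaneD [OF x(1)] r(1)] by auto
qed

text \<open>
  The Euclidean supporting hyperplane of the convex set \<open>parab ` C\<close>, written as a
  linear functional on the hyperboloid. It exists at frontier points of \<open>C\<close> because the
  chart is a homeomorphism onto an open set.
\<close>

lemma supporting_functional:
  assumes k: "k \<in> bdC"
  obtains lam :: "mvec \<Rightarrow> real" where "linear lam" "lam (hvec k) = 0"
    "\<And>z. z \<in> C \<Longrightarrow> lam (hvec z) \<ge> 0" "\<exists>v. lam v \<noteq> 0"
proof -
  have kC: "k \<in> C" using k frontier_C by blast
  \<comment> \<open>Hence the relative interior, to which the supporting hyperplane theorem refers, is the interior.\<close>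
  have int_ne: "interior (parab ` C) \<noteq> {}"
  proof -
    have "open (parab ` interior C)" using interior_subset C_hplane by (intro open_parab_image) auto
    then have "parab ` interior C \<subseteq> interior (parab ` C)"
      by (intro interior_maximal image_mono interior_subset)
    then show ?thesis using interior_C_nonempty by blast
  qed
  have "parab k \<notin> interior (parab ` C)"
  proof
    assume a: "parab k \<in> interior (parab ` C)"
    let ?V = "hplane \<inter> parab -` interior (parab ` C)"
    have "open ?V"
      unfolding parab_def Complex_eq by (intro open_Int open_hplane open_vimage open_interior continuous_intros)
    moreover have "?V \<subseteq> C"
    proof
      fix z assume z: "z \<in> ?V"
      then obtain c where c: "c \<in> C" "parab z = parab c" using interior_subset by blast
      then have "z = c" using parab_inv_parab z C_hplaneD by (metis IntD1)
      then show "z \<in> C" using c by simp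
    qed
    ultimately have "k \<in> interior C" using a k by (intro interiorI [of ?V]) auto
    then show False using k by (simp add: frontier_def)
  qed
  then have "parab k \<notin> rel_interior (parab ` C)"
    using rel_interior_nonempty_interior [OF int_ne] by simp
  with supporting_hyperplane_rel_boundary [OF convex_parab_image [OF hconvex_C], of "parab k"] kC
  obtain a where a: "a \<noteq> 0" "\<And>z. z \<in> C \<Longrightarrow> a \<bullet> parab k \<le> a \<bullet> parab z" by (metis image_eqI)
  define lam where "lam v = Re a * snd (snd v) + Im a * fst v - (a \<bullet> parab k) * fst (snd v)" for v
  have lam: "lam (hvec z) = (a \<bullet> parab z - a \<bullet> parab k) / Im z" if "z \<in> hplane" for z
    using that by (simp add: lam_def hvec_def parab_def inner_complex_def field_simps)
  have "linear lam"
    by (rule linearI) (simp_all add: lam_def algebra_simps)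
  moreover have "lam (hvec k) = 0" using lam k by auto
  moreover have "lam (hvec z) \<ge> 0" if "z \<in> C" for z
    using lam [OF C_hplaneD [OF that]] a(2) [OF that] C_hplaneD [OF that] by simp
  moreover have "\<exists>v. lam v \<noteq> 0"
  proof (cases "Re a = 0")
    case True
    then have "Im a \<noteq> 0" using a(1) by (simp add: complex_eq_iff)
    then show ?thesis by (intro exI [of _ "(1, 0, 0)"]) (simp add: lam_def)
  next
    case False
    then show ?thesis by (intro exI [of _ "(0, 0, 1)"]) (simp add: lam_def)
  qed
  ultimately show ?thesis by (rule that)
qed

text \<open>
  The supporting functional at one point of a boundary line is nonnegative on the line and has an
  interior zero, so it vanishes on the whole line and is a multiple of the product with the normal.
\<close>

lemma bline_exists:
  assumes K: "K \<in> components bdC"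
  obtains \<gamma> e f n where "bline \<gamma> e f n" "range \<gamma> = K"
proof -
  obtain \<gamma> :: "real \<Rightarrow> complex" where \<gamma>: "range \<gamma> = K" "K \<subseteq> hplane" "\<And>s t. hdist (\<gamma> s) (\<gamma> t) = \<bar>s - t\<bar>"
    using components_hline [OF K] unfolding hline_def by blast
  obtain e f where g: "hgeo \<gamma> e f"
    by (rule hline_imp_hgeo [of \<gamma>]) (use \<gamma> in auto)
  obtain n where n: "hnormal e f n" using hnormal_exists hgeoD(1-3) [OF g] by blast
  have fr: "\<gamma> s \<in> bdC" for s using in_components_subset [OF K] \<gamma>(1) by blast
  then have in_C: "\<gamma> s \<in> C" for s using frontier_C by blast
  obtain lam :: "mvec \<Rightarrow> real" where lam: "linear lam" "lam (hvec (\<gamma> 0)) = 0"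
    "\<And>z. z \<in> C \<Longrightarrow> lam (hvec z) \<ge> 0" "\<exists>v. lam v \<noteq> 0"
    using supporting_functional [OF fr] by metis
  have e0: "lam e = 0" using lam(2) by (simp add: hgeoD(7) [OF g])
  have f0: "lam f = 0"
  proof -
    have "lam (hvec (\<gamma> s)) = sinh s * lam f" for s
      by (simp add: hgeoD(7) [OF g] linear_add [OF lam(1)] linear_cmul [OF lam(1)] e0)
    with lam(3) [OF in_C [of 1]] lam(3) [OF in_C [of "-1"]] have "sinh 1 * lam f \<ge> 0" "- (sinh 1 * lam f) \<ge> 0" by auto
    then have "sinh 1 * lam f = 0" by linarith
    then show ?thesis by simp
  qed
  have lv: "lam v = - (mink v n * lam n)" for v
  proof -
    have "lam v = lam (mink v e *\<^sub>R e - mink v f *\<^sub>R f - mink v n *\<^sub>R n)"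
      using n unfolding hnormal_def by metis
    then show ?thesis by (simp add: linear_diff [OF lam(1)] linear_cmul [OF lam(1)] e0 f0)
  qed
  then have ln: "lam n \<noteq> 0" using lam(4) by force
  show ?thesis
  proof (cases "lam n > 0")
    case True
    have "mink (hvec z) n \<le> 0" if "z \<in> C" for z
      using lam(3) [OF that] lv [of "hvec z"] True by (auto simp: mult_le_0_iff)
    then show ?thesis using that [of \<gamma> e f n] g n K \<gamma>(1) by (simp add: bline_def)
  next
    case False
    then have "lam n < 0" using ln by simp
    then have "mink (hvec z) (- n) \<le> 0" if "z \<in> C" for z
      using lam(3) [OF that] lv [of "hvec z"] by (auto simp: mult_le_0_iff)
    then show ?thesis using that [of \<gamma> e f "-n"] g hnormal_minus [OF n] K \<gamma>(1) by (simp add: bline_def)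
  qed
qed

lemma bline_through:
  assumes "k \<in> bdC"
  obtains \<gamma> e f n where "bline \<gamma> e f n" "k \<in> range \<gamma>"
proof -
  obtain K where "K \<in> components bdC" "k \<in> K"
    using assms Union_components [of "bdC"] by blast
  then show ?thesis using bline_exists that by metis
qed

lemma bline_disjoint:
  assumes "bline \<gamma> e f n" "bline \<gamma>' e' f' n'" "z \<in> range \<gamma>" "z \<in> range \<gamma>'"
  shows "range \<gamma> = range \<gamma>'"
  using components_nonoverlap [OF blineD(3) [OF assms(1)] blineD(3) [OF assms(2)]] assms(3,4) by blast

lemma in_bline_iff:
  assumes b: "bline \<gamma> e f n" and z: "z \<in> hplane"
  shows "z \<in> range \<gamma> \<longleftrightarrow> mink (hvec z) n = 0"
  using hgeo_on_line [OF blineD(1,2) [OF b] z] blineD(7) [OF b] by (metis rangeE rangeI)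

text \<open>
  Along a geodesic in \<open>C\<close> the product with the normal of a boundary line is
  nonpositive. If it vanishes between two points of \<open>C\<close>, it vanishes at both of them,
  hence everywhere.
\<close>

lemma bline_not_crossed:
  assumes b: "bline \<gamma> e f n" and g: "hgeo \<eta> e' f'" and C: "\<eta> a \<in> C" "\<eta> b \<in> C"
    and s: "a < s" "s < b" "\<eta> s \<in> range \<gamma>"
  shows "\<eta> t \<in> range \<gamma>"
proof -
  define h where "h t = mink (hvec (\<eta> t)) n" for t
  note id = hgeo_sinh_interpolation [OF g, of _ _ _ n, folded h_def]
  have "h s = 0" using s(3) in_bline_iff [OF b hgeoD(5) [OF g]] by (simp add: h_def)
  moreover have "h a \<le> 0" "h b \<le> 0" using blineD(4) [OF b] C by (auto simp: h_def)
  moreover have "sinh (s - a) > 0" "sinh (b - s) > 0" using s by auto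
  moreover have "sinh (s - a) * h b \<le> 0" "sinh (b - s) * h a \<le> 0"
    using calculation by (auto intro: mult_nonneg_nonpos)
  ultimately have "sinh (b - s) * h a = 0"
    using id [of b a s] by (simp only: mult_zero_right)
  then have "h a = 0" using \<open>sinh (b - s) > 0\<close> by simp
  then have "sinh (s - a) * h t = 0" using id [of s a t] \<open>h s = 0\<close> by simp
  then have "h t = 0" using \<open>sinh (s - a) > 0\<close> by simp
  then show ?thesis using in_bline_iff [OF b hgeoD(5) [OF g]] by (simp add: h_def)
qed

lemma hgeo_perpendicular:
  assumes b: "bline \<gamma> e f n"
  obtains \<nu> where "hgeo \<nu> (hvec (\<gamma> \<sigma>)) n" "\<nu> 0 = \<gamma> \<sigma>"
  by (rule hgeo_exists [OF hgeoD(5) [OF blineD(1) [OF b]], of \<sigma> n])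
     (use blineD(7,12) [OF b] in auto)

text \<open>
  The perpendicular from the foot \<open>\<gamma> \<sigma>\<close> leaves in direction
  \<open>n\<close>, and points of \<open>C\<close> are at nonnegative times on it.
\<close>

lemma foot_normal:
  assumes b: "bline \<gamma> e f n" and z: "z \<in> C" and foot: "hfoot e f z \<sigma>"
  obtains \<rho> where "\<rho> \<ge> 0" "hvec z = cosh \<rho> *\<^sub>R hvec (\<gamma> \<sigma>) + sinh \<rho> *\<^sub>R n" "hdist z (\<gamma> \<sigma>) = \<rho>"
proof -
  note g = blineD(1) [OF b] and zH = C_hplaneD [OF z]
  define \<rho> where "\<rho> = hdist z (\<gamma> \<sigma>)"
  define c where "c = - mink (hvec z) n"
  define E F where "E = mink (hvec z) e" and "F = mink (hvec z) f"
  have c0: "c \<ge> 0" using blineD(4) [OF b z] by (simp add: c_def)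
  have v: "hvec z = E *\<^sub>R e - F *\<^sub>R f + c *\<^sub>R n"
  proof -
    have "hvec z = E *\<^sub>R e - F *\<^sub>R f - mink (hvec z) n *\<^sub>R n"
      using blineD(2) [OF b] unfolding hnormal_def E_def F_def by blast
    then show ?thesis by (simp add: c_def)
  qed
  have tan: "sinh \<sigma> * E + cosh \<sigma> * F = 0" using foot by (simp add: hfoot_def E_def F_def)
  have ch: "cosh \<rho> = cosh \<sigma> * E + sinh \<sigma> * F"
    using mink_hvec [OF zH hgeoD(5) [OF g]] by (simp add: hgeoD(7) [OF g] E_def F_def \<rho>_def)
  have cs: "cosh \<sigma> * cosh \<sigma> = 1 + sinh \<sigma> * sinh \<sigma>"
    using cosh_square_eq [of \<sigma>] by (simp add: power2_eq_square)
  have E: "E = cosh \<rho> * cosh \<sigma>" using tan ch cs by algebra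
  have F: "F = - (cosh \<rho> * sinh \<sigma>)" using tan ch cs by algebra
  have "1 = mink (hvec z) (E *\<^sub>R e - F *\<^sub>R f + c *\<^sub>R n)"
    using mink_hvec_self [OF zH] by (simp add: v [symmetric])
  then have "c * c = E * E - F * F - 1" by (simp add: E_def [symmetric] F_def [symmetric] c_def)
  also have "\<dots> = cosh \<rho> * cosh \<rho> - 1" using cs unfolding E F by algebra
  also have "\<dots> = sinh \<rho> * sinh \<rho>" using cosh_square_eq [of \<rho>] by (simp add: power2_eq_square)
  finally have "c\<^sup>2 = (sinh \<rho>)\<^sup>2" by (simp add: power2_eq_square)
  moreover have r0: "\<rho> \<ge> 0" using zH hgeoD(5) [OF g] by (simp add: \<rho>_def)
  ultimately have "c = sinh \<rho>" using c0 by (simp add: power2_eq_iff_nonneg)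
  then have "hvec z = cosh \<rho> *\<^sub>R hvec (\<gamma> \<sigma>) + sinh \<rho> *\<^sub>R n"
    by (simp add: v E F hgeoD(7) [OF g] algebra_simps)
  with r0 \<rho>_def that show ?thesis by blast
qed

text \<open>
  Two boundary points with the same foot lie on the same perpendicular. The nearer one would be
  interior to the segment from the foot to the other one, which then could not lie in
  \<open>C\<close> without running along the nearer boundary geodesic.
\<close>

lemma shadows_disjoint:
  assumes b: "bline \<gamma> e f n" and b1: "bline \<gamma>1 e1 f1 n1" and b2: "bline \<gamma>2 e2 f2 n2"
    and ne: "range \<gamma>1 \<noteq> range \<gamma>" "range \<gamma>2 \<noteq> range \<gamma>"
    and z: "z1 \<in> range \<gamma>1" "z2 \<in> range \<gamma>2"
    and foot: "hfoot e f z1 \<sigma>" "hfoot e f z2 \<sigma>"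
  shows "z1 = z2"
proof -
  have C: "z1 \<in> C" "z2 \<in> C" using z blineD(5) [OF b1] blineD(5) [OF b2] by auto
  obtain \<nu> where \<nu>: "hgeo \<nu> (hvec (\<gamma> \<sigma>)) n" "\<nu> 0 = \<gamma> \<sigma>" using hgeo_perpendicular [OF b] by blast
  have param: "\<exists>\<rho>\<ge>0. w = \<nu> \<rho>" if w: "w \<in> C" "hfoot e f w \<sigma>" for w
  proof -
    obtain \<rho> where \<rho>: "\<rho> \<ge> 0" "hvec w = cosh \<rho> *\<^sub>R hvec (\<gamma> \<sigma>) + sinh \<rho> *\<^sub>R n" using foot_normal [OF b w] by metis
    then have "hvec w = hvec (\<nu> \<rho>)" by (simp add: hgeoD(7) [OF \<nu>(1)])
    then show ?thesis using \<rho>(1) hvec_inj C_hplaneD [OF w(1)] hgeoD(5) [OF \<nu>(1)] by blast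
  qed
  obtain \<rho>1 where r1: "\<rho>1 \<ge> 0" "z1 = \<nu> \<rho>1" using param [OF C(1) foot(1)] by blast
  obtain \<rho>2 where r2: "\<rho>2 \<ge> 0" "z2 = \<nu> \<rho>2" using param [OF C(2) foot(2)] by blast
  have K: "\<nu> 0 \<in> range \<gamma>" "\<nu> 0 \<in> C" using \<nu>(2) blineD(5) [OF b] by auto
  have pos: "\<rho>1 > 0" "\<rho>2 > 0"
    using r1 r2 z K bline_disjoint [OF b1 b] bline_disjoint [OF b2 b] ne by (metis less_eq_real_def)+
  have "\<not> \<rho>1 < \<rho>2"
  proof
    assume "\<rho>1 < \<rho>2"
    then have "\<nu> 0 \<in> range \<gamma>1"
      using bline_not_crossed [OF b1 \<nu>(1) K(2), of \<rho>2 \<rho>1] pos C r1 r2 z by blast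
    then show False using bline_disjoint [OF b1 b _ K(1)] ne by blast
  qed
  moreover have "\<not> \<rho>2 < \<rho>1"
  proof
    assume "\<rho>2 < \<rho>1"
    then have "\<nu> 0 \<in> range \<gamma>2"
      using bline_not_crossed [OF b2 \<nu>(1) K(2), of \<rho>1 \<rho>2] pos C r1 r2 z by blast
    then show False using bline_disjoint [OF b2 b _ K(1)] ne by blast
  qed
  ultimately show ?thesis using r1 r2 by simp
qed

section \<open>Translations along the boundary geodesics\<close>

lemma bdry_subset_Sigma11: "bdry_Sigma11 \<subseteq> Sigma11"
proof -
  have "\<bar>cos t\<bar> \<le> pi" "\<bar>sin t\<bar> \<le> pi" for t :: real
    using abs_cos_le_one [of t] abs_sin_le_one [of t] pi_gt3 by linarith+
  then have "bdry_curve t \<in> Sigma11" for t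
    unfolding bdry_curve_def Sigma11_def
    by (intro CollectI exI [of _ "cos (2 * pi * t)"] exI [of _ "sin (2 * pi * t)"]) simp
  then show ?thesis by (auto simp: bdry_Sigma11_def path_image_def)
qed

lemma path_bdry_curve: "path bdry_curve"
  unfolding path_def bdry_curve_def by (intro continuous_intros)

lemma lift_in_bline:
  assumes b: "bline \<gamma> e f n" and c: "path c" "path_image c \<subseteq> bdry_Sigma11" "pathstart c = p x" and x: "x \<in> range \<gamma>"
  obtains \<sigma> where "path \<sigma>" "path_image \<sigma> \<subseteq> range \<gamma>" "pathstart \<sigma> = x" "\<And>t. t \<in> {0..1} \<Longrightarrow> p (\<sigma> t) = c t"
proof -
  have xC: "x \<in> C" using x blineD(5) [OF b] by auto
  obtain \<sigma> where \<sigma>: "path \<sigma>" "path_image \<sigma> \<subseteq> C" "pathstart \<sigma> = x" "\<And>t. t \<in> {0..1} \<Longrightarrow> p (\<sigma> t) = c t"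
    using covering_space_lift_path_strong [OF covering xC c(1) _ c(3)] c(2) bdry_subset_Sigma11 by (metis order_trans)
  have "path_image \<sigma> \<subseteq> bdC"
  proof
    fix z assume "z \<in> path_image \<sigma>"
    then obtain t where t: "t \<in> {0..1}" "z = \<sigma> t" by (auto simp: path_image_def)
    then have "p z \<in> bdry_Sigma11" "z \<in> C" using \<sigma>(2,4) c(2) by (auto simp: path_image_def)
    then show "z \<in> bdC" using bdry_C by blast
  qed
  moreover have "x \<in> path_image \<sigma>" using \<sigma>(3) pathstart_in_path_image by metis
  ultimately have "path_image \<sigma> \<subseteq> range \<gamma>"
    using components_maximal [OF blineD(3) [OF b] connected_path_image [OF \<sigma>(1)]] x by blast
  with \<sigma> that show ?thesis by blast
qed

text \<open>
  The time parameter is recovered continuously from the product with the tangent vector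
  \<open>f\<close>.
\<close>

lemma bline_param_continuous:
  assumes b: "bline \<gamma> e f n" and \<sigma>: "path \<sigma>" "path_image \<sigma> \<subseteq> range \<gamma>"
  obtains u :: "real \<Rightarrow> real" where "continuous_on {0..1} u" "\<And>t. t \<in> {0..1} \<Longrightarrow> \<sigma> t = \<gamma> (u t)"
proof -
  note g = blineD(1) [OF b]
  define u where "u t = arsinh (- mink (hvec (\<sigma> t)) f)" for t
  have "\<sigma> t = \<gamma> (u t)" if "t \<in> {0..1}" for t
  proof -
    have "\<sigma> t \<in> range \<gamma>" using \<sigma>(2) that unfolding path_image_def by blast
    then obtain s where s: "\<sigma> t = \<gamma> s" by blast
    have "- mink (hvec (\<gamma> s)) f = sinh s" using hgeoD(1-4) [OF g] by (simp add: hgeoD(7) [OF g])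
    then have "u t = s" by (simp add: u_def s arsinh_sinh_real)
    then show ?thesis using s by simp
  qed
  moreover have "continuous_on {0..1} u"
  proof -
    have "Im (\<sigma> t) \<noteq> 0" if "t \<in> {0..1}" for t
    proof -
      have "\<sigma> t \<in> range \<gamma>" using \<sigma>(2) that unfolding path_image_def by blast
      then show ?thesis using hgeoD(6) [OF g] by (metis less_irrefl rangeE)
    qed
    then have "continuous_on {0..1} (\<lambda>t. hvec (\<sigma> t))"
      using \<sigma>(1) unfolding path_def hvec_def by (intro continuous_intros) auto
    then show ?thesis unfolding u_def by (intro continuous_intros)
  qed
  ultimately show ?thesis using that by blast
qed

lemma bdry_curve_halves:
  assumes "0 < t" "t < 1/2" "1/2 < t'" "t' < 1"
  shows "bdry_curve t \<noteq> bdry_curve t'"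
proof
  assume "bdry_curve t = bdry_curve t'"
  then have "cis (sin (2 * pi * t)) = cis (sin (2 * pi * t'))" by (simp add: bdry_curve_def)
  then have eq: "sin (sin (2 * pi * t)) = sin (sin (2 * pi * t'))" by (metis cis.sel(2))
  have 1: "sin (2 * pi * t) > 0" using assms by (intro sin_gt_zero) auto
  have 2: "sin (2 * pi * t') < 0" using assms by (intro sin_lt_zero) auto
  have "sin (sin (2 * pi * t)) > 0"
    using 1 sin_le_one [of "2 * pi * t"] pi_gt3 by (intro sin_gt_zero [of "sin _"]) linarith+
  moreover have "sin (- sin (2 * pi * t')) > 0"
    using 2 sin_ge_minus_one [of "2 * pi * t'"] pi_gt3 by (intro sin_gt_zero [of "- sin _"]) linarith+
  ultimately show False using eq by simp
qed

text \<open>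
  The other isometries of the real line are reflections, which fix a point.
\<close>

lemma real_isometry_translation:
  fixes h :: "real \<Rightarrow> real"
  assumes iso: "\<And>s t. \<bar>h s - h t\<bar> = \<bar>s - t\<bar>" and nofix: "\<And>s. h s \<noteq> s"
  shows "h s = s + h 0"
proof -
  have or: "h s = h 0 + s \<or> h s = h 0 - s" for s using iso [of s 0] by (simp add: abs_if split: if_splits)
  define m where "m = h 0 / 2"
  have m: "h m = h 0 + m" "m \<noteq> 0"
    using or [of m] nofix [of m] nofix [of 0] by (auto simp: m_def)
  have "h 0 = 2 * m" by (simp add: m_def)
  then show ?thesis using or [of s] iso [of s m] m by (auto simp: abs_if split: if_splits)
qed

text \<open>
  The lift of the boundary curve runs along the geodesic from a point over its base point to another
  one, at distance at most \<open>L\<close>. The deck transformation between these two points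
  preserves the geodesic and has no fixed point, so it acts as a translation. The boundary is a
  single curve, hence the lift meets the fibre of every boundary point.
\<close>

lemma bline_translation:
  assumes b: "bline \<gamma> e f n" and L: "boundary_length d \<le> ereal L"
  obtains g \<tau> where "deck g" "\<And>s. g (\<gamma> s) = \<gamma> (s + \<tau>)" "\<tau> \<noteq> 0" "\<bar>\<tau>\<bar> \<le> L"
    "\<And>q. q \<in> bdry_Sigma11 \<Longrightarrow> \<exists>s. p (\<gamma> s) = q"
proof -
  note hg = blineD(1) [OF b]
  have "p (\<gamma> 0) \<in> bdry_Sigma11" using blineD(6) [OF b] bdry_C by blast
  then obtain \<theta> where \<theta>: "\<theta> \<in> {0..1}" "p (\<gamma> 0) = bdry_curve \<theta>" by (auto simp: bdry_Sigma11_def path_image_def)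
  \<comment> \<open>Run back along the boundary curve to reach a point of the geodesic over its base point.\<close>
  define c where "c t = bdry_curve (\<theta> * (1 - t))" for t
  have sub: "\<theta> * (1 - t) \<in> {0..1}" if "t \<in> {0..1}" for t
    using that \<theta>(1) by (auto intro: mult_le_one mult_nonneg_nonneg)
  have c: "path c" "path_image c \<subseteq> bdry_Sigma11" "pathstart c = p (\<gamma> 0)"
  proof -
    show "path c" unfolding c_def bdry_curve_def path_def by (intro continuous_intros)
    show "path_image c \<subseteq> bdry_Sigma11" using sub by (auto simp: path_image_def c_def bdry_Sigma11_def)
    show "pathstart c = p (\<gamma> 0)" by (simp add: pathstart_def c_def \<theta>)
  qed
  obtain \<sigma>' where \<sigma>': "path_image \<sigma>' \<subseteq> range \<gamma>" "\<And>t. t \<in> {0..1} \<Longrightarrow> p (\<sigma>' t) = c t"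
    using lift_in_bline [OF b c rangeI] by metis
  define x0 where "x0 = \<sigma>' 1"
  have x0: "x0 \<in> range \<gamma>" "p x0 = bdry_curve 0"
    using \<sigma>' by (auto simp: x0_def path_image_def c_def)
  obtain \<sigma> where \<sigma>: "path \<sigma>" "path_image \<sigma> \<subseteq> range \<gamma>" "pathstart \<sigma> = x0" "\<And>t. t \<in> {0..1} \<Longrightarrow> p (\<sigma> t) = bdry_curve t"
    by (rule lift_in_bline [OF b path_bdry_curve _ _ x0(1)])
       (use x0(2) in \<open>auto simp: bdry_Sigma11_def pathstart_def\<close>)
  obtain u where u: "continuous_on {0..1} u" "\<And>t. t \<in> {0..1} \<Longrightarrow> \<sigma> t = \<gamma> (u t)"
    using bline_param_continuous [OF b \<sigma>(1,2)] by blast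
  define y where "y = \<sigma> 1"
  have s0: "\<sigma> 0 = x0" using \<sigma>(3) by (simp add: pathstart_def)
  have y: "y \<in> range \<gamma>" "p y = p x0"
    using \<sigma>(2,4) x0(2) by (auto simp: y_def path_image_def bdry_curve_def)
  \<comment> \<open>The lifted boundary curve does not close up, because a line contains no simple closed curve.\<close>
  have xy: "x0 \<noteq> y"
  proof
    assume "x0 = y"
    then have "\<gamma> (u 0) = \<gamma> (u 1)" using u(2) [of 0] u(2) [of 1] s0 by (simp add: y_def)
    then have u01: "u 0 = u 1" using hgeo_dist [OF hg, of "u 0" "u 1"] by simp
    have half: "u (1/2) \<noteq> u 0"
    proof
      assume "u (1/2) = u 0"
      then have "\<sigma> (1/2) = \<sigma> 0" using u(2) [of "1/2"] u(2) [of 0] by simp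
      then have "bdry_curve (1/2) = bdry_curve 0" using \<sigma>(4) [of "1/2"] \<sigma>(4) [of 0] by simp
      then have "cis (-1) = cis 1" by (simp add: bdry_curve_def)
      then have "sin (-1::real) = sin 1" by (metis cis.sel(2))
      moreover have "sin (1::real) > 0" using pi_gt3 by (intro sin_gt_zero) auto
      ultimately show False by simp
    qed
    define v where "v = (u 0 + u (1/2)) / 2"
    have v: "v \<noteq> u 0" "v \<noteq> u (1/2)" "v \<noteq> u 1" using half u01 by (auto simp: v_def field_simps)
    have vs: "v \<in> closed_segment (u 0) (u (1/2))" "v \<in> closed_segment (u (1/2)) (u 1)"
      using u01 by (auto simp: v_def closed_segment_eq_real_ivl field_simps)
    have "continuous_on (closed_segment 0 (1/2)) u" "continuous_on (closed_segment (1/2) 1) u"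
      using u(1) by (auto intro: continuous_on_subset simp: closed_segment_eq_real_ivl)
    from IVT'_closed_segment_real [OF vs(1) this(1)] IVT'_closed_segment_real [OF vs(2) this(2)]
    obtain t t' where t: "t \<in> {0..1/2}" "u t = v" "t' \<in> {1/2..1}" "u t' = v"
      by (auto simp: closed_segment_eq_real_ivl)
    have "t \<noteq> 0" "t \<noteq> 1/2" "t' \<noteq> 1/2" "t' \<noteq> 1" using v t(2,4) by metis+
    then have strict: "0 < t" "t < 1/2" "1/2 < t'" "t' < 1" using t(1,3) by auto
    have "\<sigma> t = \<sigma> t'" using t u(2) [of t] u(2) [of t'] by simp
    then have "bdry_curve t = bdry_curve t'" using \<sigma>(4) [of t] \<sigma>(4) [of t'] t by simp
    then show False using bdry_curve_halves [OF strict] by simp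
  qed
  have C: "x0 \<in> C" "y \<in> C" using x0(1) y(1) blineD(5) [OF b] by auto
  obtain g where g: "deck g" "g x0 = y" using deck_exists [OF C] y(2) by metis
  have nofix: "g z \<noteq> z" if "z \<in> C" for z
    using deck_unique [OF g(1) deck_id that _ C(1)] g(2) xy by auto
  have "g ` range \<gamma> \<subseteq> range \<gamma>"
  proof (rule components_maximal [OF blineD(3) [OF b]])
    have "continuous_on (range \<gamma>) g"
      using g(1) blineD(5) [OF b] by (auto simp: deck_def intro: continuous_on_subset)
    then show "connected (g ` range \<gamma>)"
      using in_components_connected [OF blineD(3) [OF b]] by (rule connected_continuous_image)
    show "g ` range \<gamma> \<subseteq> bdC" using deck_frontier [OF g(1)] blineD(6) [OF b] by blast
    show "range \<gamma> \<inter> g ` range \<gamma> \<noteq> {}" using g(2) x0(1) y(1) by blast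
  qed
  then have "\<exists>t. g (\<gamma> s) = \<gamma> t" for s by blast
  then obtain h where h: "\<And>s. g (\<gamma> s) = \<gamma> (h s)" by metis
  have iso: "\<bar>h s - h t\<bar> = \<bar>s - t\<bar>" for s t
    using deck_isometry [OF g(1) blineD(5) [OF b] blineD(5) [OF b], of s t] by (simp add: h hgeo_dist [OF hg])
  have hfix: "h s \<noteq> s" for s using nofix [OF blineD(5) [OF b, of s]] h [of s] by auto
  have tr: "h s = s + h 0" for s using real_isometry_translation [of h, OF iso hfix] .
  have len: "\<bar>h 0\<bar> \<le> L"
  proof -
    obtain s where s: "x0 = \<gamma> s" using x0(1) by blast
    have "hdist (\<gamma> s) (\<gamma> (s + h 0)) = \<bar>h 0\<bar>" by (simp add: hgeo_dist [OF hg])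
    then have "\<bar>h 0\<bar> = hdist x0 y" using g(2) h [of s] tr [of s] s by metis
    moreover have "ereal (hdist (\<sigma> 0) (\<sigma> 1)) \<le> curve_length d (\<lambda>t. p (\<sigma> t))"
      using \<sigma>(1,2) blineD(5) [OF b] by (intro lift_dist_le_length) (auto simp: path_def path_image_def)
    moreover have "curve_length d (\<lambda>t. p (\<sigma> t)) = curve_length d bdry_curve"
      by (rule curve_length_cong) (use \<sigma>(4) in auto)
    ultimately have "ereal \<bar>h 0\<bar> \<le> ereal L"
      using L s0 unfolding boundary_length_def y_def by (metis order_trans)
    then show ?thesis by simp
  qed
  have all: "\<exists>s. p (\<gamma> s) = q" if "q \<in> bdry_Sigma11" for q
  proof -
    obtain t where "t \<in> {0..1}" "q = bdry_curve t"
      using \<open>q \<in> bdry_Sigma11\<close> unfolding bdry_Sigma11_def path_image_def by blast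
    then show ?thesis using \<sigma>(4) u(2) by metis
  qed
  show ?thesis using that [OF g(1), of "h 0"] h tr hfix [of 0] len all by metis
qed

lemma bline_periodic:
  assumes b: "bline \<gamma> e f n" and g: "deck g" "\<And>s. g (\<gamma> s) = \<gamma> (s + \<tau>)"
  shows "p (\<gamma> (s + of_int k * \<tau>)) = p (\<gamma> s)"
proof -
  have 1: "p (\<gamma> (s + \<tau>)) = p (\<gamma> s)" for s
    using deckD(2) [OF g(1) blineD(5) [OF b], of s] by (simp add: g(2))
  show ?thesis
  proof (induction k rule: int_induct [of _ 0])
    case (step1 i)
    then show ?case using 1 [of "s + of_int i * \<tau>"] by (simp add: algebra_simps)
  next
    case (step2 i)
    then show ?case using 1 [of "s + of_int (i - 1) * \<tau>"] by (simp add: algebra_simps)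
  qed simp
qed

lemma bline_dense:
  assumes b: "bline \<gamma> e f n" and L: "boundary_length d \<le> ereal L" and q: "q \<in> bdry_Sigma11"
  obtains s' where "s \<le> s'" "s' \<le> s + L" "p (\<gamma> s') = q"
proof -
  obtain g \<tau> where g: "deck g" "\<And>s. g (\<gamma> s) = \<gamma> (s + \<tau>)" "\<tau> \<noteq> 0" "\<bar>\<tau>\<bar> \<le> L"
    "\<And>q. q \<in> bdry_Sigma11 \<Longrightarrow> \<exists>s. p (\<gamma> s) = q" using bline_translation [OF b L] by metis
  obtain s1 where s1: "p (\<gamma> s1) = q" using g(5) [OF q] by blast
  define k where "k = \<lceil>(s - s1) / \<bar>\<tau>\<bar>\<rceil>"
  define s' where "s' = s1 + of_int k * \<bar>\<tau>\<bar>"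
  have "\<exists>j::int. of_int k * \<bar>\<tau>\<bar> = of_int j * \<tau>"
    by (cases "\<tau> > 0") (auto intro: exI [of _ k] exI [of _ "-k"])
  then have "p (\<gamma> s') = q" using bline_periodic [OF b g(1,2)] s1 by (auto simp: s'_def)
  moreover have "(s - s1) / \<bar>\<tau>\<bar> \<le> of_int k" "of_int k \<le> (s - s1) / \<bar>\<tau>\<bar> + 1"
    by (auto simp: k_def)
  then have "s - s1 \<le> of_int k * \<bar>\<tau>\<bar>" "of_int k * \<bar>\<tau>\<bar> \<le> s - s1 + \<bar>\<tau>\<bar>"
    using g(3) by (simp_all add: field_simps)
  then have "s \<le> s'" "s' \<le> s + L" using g(4) by (auto simp: s'_def)
  ultimately show ?thesis using that by blast
qed

end

section \<open>Tripods in the universal cover\<close>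

context hyp_cover
begin

lemma frontier_C_iff: "x \<in> C \<Longrightarrow> x \<in> bdC \<longleftrightarrow> p x \<in> bdry_Sigma11"
  unfolding bdry_C [symmetric] by simp

text \<open>
  Within a ball that meets no other part of the frontier, the inner side of a boundary geodesic
  belongs to \<open>C\<close>: a segment that starts in \<open>C\<close> strictly on that side could
  leave \<open>C\<close> only through the frontier.
\<close>

lemma half_ball_subset:
  assumes b: "bline \<gamma> e f n" and y: "y \<in> C"
    and only: "\<And>k. k \<in> bdC \<Longrightarrow> hdist y k < r \<Longrightarrow> k \<in> range \<gamma>"
    and z: "z \<in> hplane" "hdist y z < r" "mink (hvec z) n \<le> 0"
  shows "z \<in> C"
proof (cases "mink (hvec z) n = 0")
  case True
  then show ?thesis using in_bline_iff [OF b z(1)] blineD(5) [OF b] by blast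
next
  case False
  then have zn: "mink (hvec z) n < 0" using z(3) by simp
  have yH: "y \<in> hplane" using y by (rule C_hplaneD)
  \<comment> \<open>One third, as the detour through the starting point below costs at most \<open>2 * \<delta>\<close>.\<close>
  define \<delta> where "\<delta> = (r - hdist y z) / 3"
  have \<delta>: "\<delta> > 0" using z(2) by (simp add: \<delta>_def)
  \<comment> \<open>Start from a point near \<open>y\<close> that lies strictly on the inner side.\<close>
  have "\<exists>y'\<in>C. mink (hvec y') n < 0 \<and> hdist y y' \<le> \<delta>"
  proof (cases "mink (hvec y) n = 0")
    case False
    then show ?thesis using blineD(4) [OF b y] y \<delta> by (intro bexI [of _ y]) auto
  next
    case True
    obtain x where x: "x \<in> C" "p x = q0" using q0_Sigma11 p_image by (metis imageE)
    have "x \<notin> bdC" using x q0_not_bdry frontier_C_iff [OF x(1)] by simp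
    then have "x \<notin> range \<gamma>" using blineD(6) [OF b] by (metis imageE)
    then have xn: "mink (hvec x) n < 0"
      using in_bline_iff [OF b C_hplaneD [OF x(1)]] blineD(4) [OF b x(1)] by simp
    then have "y \<noteq> x" using True by auto
    then obtain \<eta> f' where \<eta>: "hgeo \<eta> (hvec y) f'" "\<eta> 0 = y" "\<eta> (hdist y x) = x"
      using hgeo_between [OF yH C_hplaneD [OF x(1)]] by blast
    have D: "hdist y x > 0" using hdist_eq_0_iff [OF yH C_hplaneD [OF x(1)]] hdist_nonneg [OF yH C_hplaneD [OF x(1)]] \<open>y \<noteq> x\<close> by linarith
    define s where "s = min \<delta> (hdist y x)"
    have s: "0 < s" "s \<le> \<delta>" "s \<le> hdist y x" using \<delta> D by (auto simp: s_def)
    have "\<eta> s \<in> hsegment y x" using hsegment_imageI [OF \<eta>(1), of 0 s "hdist y x"] s \<eta>(2,3) by simp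
    then have "\<eta> s \<in> C" using hconvex_C x(1) y unfolding hconvex_def by blast
    moreover have "mink (hvec (\<eta> s)) n < 0"
    proof -
      have "sinh (hdist y x) * mink (hvec (\<eta> s)) n = sinh s * mink (hvec x) n"
        using hgeo_sinh_interpolation [OF \<eta>(1), of "hdist y x" 0 s n] by (simp add: \<eta>(2,3) True)
      also have "\<dots> < 0" using s xn by (simp add: mult_pos_neg)
      finally show ?thesis using D by (simp add: mult_less_0_iff)
    qed
    moreover have "hdist y (\<eta> s) \<le> \<delta>" using hgeo_dist [OF \<eta>(1), of 0 s] s by (simp add: \<eta>(2))
    ultimately show ?thesis by blast
  qed
  then obtain y' where y': "y' \<in> C" "mink (hvec y') n < 0" "hdist y y' \<le> \<delta>" by blast
  have y'H: "y' \<in> hplane" using y'(1) by (rule C_hplaneD)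
  show ?thesis
  proof (rule ccontr)
    assume "z \<notin> C"
    then have "y' \<noteq> z" using y'(1) by blast
    then obtain \<eta> f' where \<eta>: "hgeo \<eta> (hvec y') f'" "\<eta> 0 = y'" "\<eta> (hdist y' z) = z"
      using hgeo_between [OF y'H z(1)] by blast
    have D: "hdist y' z > 0" using hdist_eq_0_iff [OF y'H z(1)] hdist_nonneg [OF y'H z(1)] \<open>y' \<noteq> z\<close> by linarith
    obtain s where s: "0 \<le> s" "s \<le> hdist y' z" "\<eta> s \<in> bdC"
      using exit_point [OF \<eta>(1), of 0 "hdist y' z"] \<eta>(2,3) D y'(1) \<open>z \<notin> C\<close> by auto
    have "hdist y (\<eta> s) \<le> hdist y y' + hdist y' (\<eta> s)" by (rule hdist_triangle [OF yH y'H hgeoD(5) [OF \<eta>(1)]])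
    moreover have "hdist y' (\<eta> s) = s" using hgeo_dist [OF \<eta>(1), of 0 s] s by (simp add: \<eta>(2))
    moreover have "hdist y' z \<le> hdist y y' + hdist y z" using hdist_triangle [OF y'H yH z(1)] by (simp add: hdist_commute)
    moreover have "3 * \<delta> = r - hdist y z" by (simp add: \<delta>_def)
    ultimately have "hdist y (\<eta> s) < r" using s(2) y'(3) \<delta> by linarith
    then have "\<eta> s \<in> range \<gamma>" using only s(3) by blast
    then have "mink (hvec (\<eta> s)) n = 0" using in_bline_iff [OF b hgeoD(5) [OF \<eta>(1)]] by simp
    then have 0: "sinh s * mink (hvec z) n + sinh (hdist y' z - s) * mink (hvec y') n = 0"
      using hgeo_sinh_interpolation [OF \<eta>(1), of "hdist y' z" 0 s n] by (simp add: \<eta>(2,3))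
    have 1: "sinh s * mink (hvec z) n \<le> 0" using s zn by (simp add: mult_nonneg_nonpos)
    have 2: "sinh (hdist y' z - s) * mink (hvec y') n \<le> 0" using s y'(2) by (simp add: mult_nonneg_nonpos)
    have "sinh s * mink (hvec z) n = 0" "sinh (hdist y' z - s) * mink (hvec y') n = 0" using 0 1 2 by linarith+
    then have "s = 0" "hdist y' z - s = 0" using zn y'(2) by auto
    then show False using D by simp
  qed
qed

lemma bline_exists_some: "\<exists>\<gamma> e f n. bline \<gamma> e f n"
proof -
  have "bdry_curve 0 \<in> bdry_Sigma11" by (auto simp: bdry_Sigma11_def path_image_def)
  moreover from this obtain x where x: "x \<in> C" "p x = bdry_curve 0"
    using p_image bdry_subset_Sigma11 by (metis imageE subsetD)
  ultimately have "x \<in> bdC" using frontier_C_iff [OF x(1)] by simp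
  then show ?thesis by (rule bline_through) blast
qed

text \<open>
  At most one boundary geodesic comes closer to \<open>y\<close> than \<open>16\<close>, as two of
  them would be within \<open>32\<close> of each other. A \<open>T\<close> at \<open>y\<close> stays
  on the inner side of it when its bar has the direction \<open>f1\<close> orthogonal to the normal
  \<open>n\<close> and its stem the direction \<open>f2\<close> away from the geodesic. The Gromov
  products of its legs are at most \<open>1\<close>, since its angles are right or straight, and
  \<open>15 = 2 * 1 + 13\<close> is the length required by \<open>tripod_tree\<close>.
\<close>

lemma tripod_far:
  assumes far: "\<And>\<gamma> e f n \<gamma>' e' f' n' s t. \<lbrakk>bline \<gamma> e f n; bline \<gamma>' e' f' n'; hdist (\<gamma> s) (\<gamma>' t) \<le> 32\<rbrakk> \<Longrightarrow> range \<gamma> = range \<gamma>'"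
    and y: "y \<in> C"
  shows "tripod C 1 15 15 y"
proof -
  have yH: "y \<in> hplane" using y by (rule C_hplaneD)
  have "\<exists>\<gamma> e f n. bline \<gamma> e f n \<and> (\<forall>k \<in> bdC. hdist y k < 16 \<longrightarrow> k \<in> range \<gamma>)"
  proof (cases "\<exists>k0 \<in> bdC. hdist y k0 < 16")
    case True
    then obtain k0 where k0: "k0 \<in> bdC" "hdist y k0 < 16" by blast
    obtain \<gamma> e f n where b: "bline \<gamma> e f n" "k0 \<in> range \<gamma>" using bline_through [OF k0(1)] by blast
    have "k \<in> range \<gamma>" if k: "k \<in> bdC" "hdist y k < 16" for k
    proof -
      obtain \<gamma>' e' f' n' where b': "bline \<gamma>' e' f' n'" "k \<in> range \<gamma>'" using bline_through [OF k(1)] by blast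
      have "hdist k0 k \<le> hdist y k0 + hdist y k"
        using hdist_triangle [of k0 y k] k0(1) k(1) yH by (simp add: hdist_commute)
      then have "hdist k0 k \<le> 32" using k0(2) k(2) by linarith
      then have "range \<gamma> = range \<gamma>'" using far [OF b(1) b'(1)] b(2) b'(2) by blast
      then show ?thesis using b'(2) by simp
    qed
    then show ?thesis using b(1) by blast
  next
    case False
    then show ?thesis using bline_exists_some by metis
  qed
  then obtain \<gamma> e f n where b: "bline \<gamma> e f n"
    and only: "\<And>k. k \<in> bdC \<Longrightarrow> hdist y k < 16 \<Longrightarrow> k \<in> range \<gamma>" by blast
  \<comment> \<open>\<open>f2\<close> is the normalised projection of \<open>n\<close> to the tangent plane at \<open>y\<close>.\<close>
  define m where "m = mink (hvec y) n"
  have m: "m \<le> 0" "mink n (hvec y) = m" using blineD(4) [OF b y] mink_commute by (auto simp: m_def)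
  have yy: "mink (hvec y) (hvec y) = 1" by (rule mink_hvec_self [OF yH])
  have nn: "mink n n = -1" by (rule blineD(12) [OF b])
  define q where "q = sqrt (1 + m\<^sup>2)"
  have q: "q > 0" "q * q = 1 + m * m" by (auto simp: q_def add_pos_nonneg power2_eq_square)
  define f2 where "f2 = (1 / q) *\<^sub>R (n - m *\<^sub>R hvec y)"
  have yf2: "mink (hvec y) f2 = 0" by (simp add: f2_def yy m_def [symmetric])
  have "mink f2 f2 = - ((1 + m * m) / (q * q))"
    by (simp add: f2_def yy nn m m_def [symmetric]) (simp add: add_divide_distrib diff_divide_distrib)
  then have f22: "mink f2 f2 = -1" unfolding q(2) [symmetric] using q(1) by simp
  have nf2: "mink f2 n \<le> 0"
  proof -
    have "mink f2 n = - ((1 + m * m) / q)" by (simp add: f2_def nn m_def [symmetric] add_divide_distrib diff_divide_distrib)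
    then show ?thesis unfolding q(2) [symmetric] using q(1) by simp
  qed
  obtain f1 where f1: "hnormal (hvec y) f2 f1" using hnormal_exists [OF yy yf2 f22] by blast
  then have f1': "mink (hvec y) f1 = 0" "mink f2 f1 = 0" "mink f1 f2 = 0" "mink f1 f1 = -1" "mink f1 (hvec y) = 0"
    using mink_commute unfolding hnormal_def by metis+
  have nf1: "mink f1 n = 0"
  proof -
    have "n = q *\<^sub>R f2 + m *\<^sub>R hvec y" using q by (simp add: f2_def)
    then show ?thesis using f1' by (metis mink_bilinear(2,6) mult_zero_right add_0)
  qed
  obtain \<eta>1 where \<eta>1: "hgeo \<eta>1 (hvec y) f1" "\<eta>1 0 = y" using hgeo_exists [OF yH f1'(1,4)] by blast
  obtain \<eta>2 where \<eta>2: "hgeo \<eta>2 (hvec y) f2" "\<eta>2 0 = y" using hgeo_exists [OF yH yf2 f22] by blast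
  have in_C: "\<eta> s \<in> C" if \<eta>: "hgeo \<eta> (hvec y) g" "\<eta> 0 = y" and s: "\<bar>s\<bar> < 16" "sinh s * mink g n \<le> 0" for \<eta> g s
  proof (rule half_ball_subset [OF b y only hgeoD(5) [OF \<eta>(1)]])
    show "hdist y (\<eta> s) < 16" using hgeo_dist [OF \<eta>(1), of 0 s] s \<eta>(2) by simp
    show "mink (hvec (\<eta> s)) n \<le> 0" using m s by (simp add: hgeoD(7) [OF \<eta>(1)] m_def [symmetric] add_nonpos_nonpos mult_nonneg_nonpos)
  qed
  have C: "\<eta>1 15 \<in> C" "\<eta>1 (-15) \<in> C" "\<eta>2 15 \<in> C"
    using in_C [OF \<eta>1, of 15] in_C [OF \<eta>1, of "-15"] in_C [OF \<eta>2, of 15] nf1 nf2 by (auto simp: mult_nonneg_nonpos)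
  have d: "hdist y (\<eta>1 15) = 15" "hdist y (\<eta>1 (-15)) = 15" "hdist y (\<eta>2 15) = 15" "hdist (\<eta>1 15) (\<eta>1 (-15)) = 30"
    using hgeo_dist [OF \<eta>1(1), of 0 15] hgeo_dist [OF \<eta>1(1), of 0 "-15"] hgeo_dist [OF \<eta>2(1), of 0 15]
      hgeo_dist [OF \<eta>1(1), of 15 "-15"] \<eta>1(2) \<eta>2(2) by auto
  have cross: "hdist (\<eta>1 s) (\<eta>2 15) \<ge> 28" if "\<bar>s\<bar> = 15" for s
  proof -
    have "cosh (hdist (\<eta>1 s) (\<eta>2 15)) = cosh s * cosh 15"
      using mink_hvec [OF hgeoD(5) hgeoD(5), OF \<eta>1(1) \<eta>2(1), of s 15]
      by (simp add: hgeoD(7) [OF \<eta>1(1)] hgeoD(7) [OF \<eta>2(1)] yy yf2 f1' mult.commute)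
    then have "hdist (\<eta>1 s) (\<eta>2 15) \<ge> 15 + 15 - 2"
      using that hgeoD(5) [OF \<eta>1(1)] hgeoD(5) [OF \<eta>2(1)]
      by (intro cosh_mult_lower) (auto simp: abs_if split: if_splits)
    then show ?thesis by simp
  qed
  show ?thesis unfolding tripod_def
  proof (intro bexI conjI ballI)
    show "gprod (\<eta>1 15) (\<eta>1 (-15)) y \<le> 1"
      unfolding gprod_def hdist_commute [of _ y] d by simp
    show "gprod (\<eta>1 (-15)) (\<eta>2 15) y \<le> 1" "gprod (\<eta>1 15) (\<eta>2 15) y \<le> 1"
      unfolding gprod_def hdist_commute [of _ y] d using cross [of 15] cross [of "-15"] by simp_all
    fix a assume "a \<in> {\<eta>1 15, \<eta>1 (-15), \<eta>2 15}"
    then show "15 \<le> hdist y a" "hdist y a \<le> 15" using d by auto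
  qed (use C in auto)
qed

lemma tripod_deck:
  assumes t: "tripod {z \<in> C. p z = q} c l l' y0" and y0: "y0 \<in> C" "p y0 = q" and y: "y \<in> C" "p y = q"
  shows "tripod {z \<in> C. p z = q} c l l' y"
proof -
  obtain g where g: "deck g" "g y0 = y" using deck_exists [OF y0(1) y(1)] y0(2) y(2) by metis
  note iso = deck_isometry [OF g(1)]
  obtain u v w where uvw: "u \<in> {z \<in> C. p z = q}" "v \<in> {z \<in> C. p z = q}" "w \<in> {z \<in> C. p z = q}"
    "\<forall>t\<in>{u, v, w}. l \<le> hdist y0 t \<and> hdist y0 t \<le> l'"
    "gprod u v y0 \<le> c" "gprod v w y0 \<le> c" "gprod u w y0 \<le> c" using t unfolding tripod_def by blast
  then have C: "u \<in> C" "v \<in> C" "w \<in> C" by auto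
  have "gprod (g a) (g a') y = gprod a a' y0" if "a \<in> C" "a' \<in> C" for a a'
    using that iso y0(1) by (simp add: gprod_def g(2) [symmetric])
  moreover have "hdist y (g a) = hdist y0 a" if "a \<in> C" for a
    using that iso y0(1) by (simp add: g(2) [symmetric])
  ultimately show ?thesis unfolding tripod_def using uvw C deckD [OF g(1)]
    by (intro bexI [of _ "g u"] bexI [of _ "g v"] bexI [of _ "g w"]) auto
qed

text \<open>
  The foot is determined by the distances to the points of the geodesic, which deck transformations
  preserve.
\<close>

lemma hfoot_deck:
  assumes b: "bline \<gamma> e f n" and g: "deck g" "\<And>s. g (\<gamma> s) = \<gamma> (s + \<kappa>)" and z: "z \<in> C" and foot: "hfoot e f z \<sigma>"
  shows "hfoot e f (g z) (\<sigma> + \<kappa>)" "hdist (g z) (\<gamma> (\<sigma> + \<kappa>)) = hdist z (\<gamma> \<sigma>)"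
proof -
  note hg = blineD(1) [OF b]
  have d: "hdist (g z) (\<gamma> (s + \<kappa>)) = hdist z (\<gamma> s)" for s
    using deck_isometry [OF g(1) z blineD(5) [OF b], of s] by (simp add: g(2))
  show "hdist (g z) (\<gamma> (\<sigma> + \<kappa>)) = hdist z (\<gamma> \<sigma>)" by (rule d)
  have gz: "g z \<in> hplane" using deckD(1) [OF g(1) z] by (rule C_hplaneD)
  define E F where "E = mink (hvec (g z)) e" and "F = mink (hvec (g z)) f"
  have c: "cosh (hdist (g z) (\<gamma> s)) = cosh s * E + sinh s * F" for s
    using mink_hvec [OF gz hgeoD(5) [OF hg]] by (simp add: hgeoD(7) [OF hg] E_def F_def)
  have "cosh (hdist (g z) (\<gamma> (\<sigma> + 1 + \<kappa>))) = cosh (hdist (g z) (\<gamma> (\<sigma> - 1 + \<kappa>)))"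
    unfolding d using hfoot_functional(1) [OF hg C_hplaneD [OF z] foot, of "\<sigma> + 1"]
      hfoot_functional(1) [OF hg C_hplaneD [OF z] foot, of "\<sigma> - 1"] by simp
  then have "cosh (\<sigma> + \<kappa> + 1) * E + sinh (\<sigma> + \<kappa> + 1) * F = cosh (\<sigma> + \<kappa> - 1) * E + sinh (\<sigma> + \<kappa> - 1) * F"
    unfolding c by (simp add: algebra_simps)
  then have "2 * sinh 1 * (sinh (\<sigma> + \<kappa>) * E + cosh (\<sigma> + \<kappa>) * F) = 0"
    unfolding cosh_add [of "\<sigma> + \<kappa>"] sinh_add [of "\<sigma> + \<kappa>"] cosh_diff [of "\<sigma> + \<kappa>"] sinh_diff [of "\<sigma> + \<kappa>"]
    by (simp add: algebra_simps)
  then have "sinh (\<sigma> + \<kappa>) * E + cosh (\<sigma> + \<kappa>) * F = 0" by simp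
  then show "hfoot e f (g z) (\<sigma> + \<kappa>)" by (simp add: hfoot_def E_def F_def)
qed

text \<open>
  Otherwise \<open>v\<close>, \<open>g v\<close> and \<open>g (g v)\<close> are equally spaced
  points of one geodesic at the same distance from the other geodesic. But along a geodesic the
  product \<open>h\<close> with the normal \<open>n\<close> satisfies \<open>h (t - D) + h (t + D) =
  2 * cosh D * h t\<close>, so it cannot take the same nonzero value at three equally spaced times.
\<close>

lemma translation_moves_other:
  assumes b: "bline \<gamma> e f n" and b': "bline \<gamma>' e' f' n'" and ne: "range \<gamma> \<noteq> range \<gamma>'"
    and g: "deck g" "\<And>s. g (\<gamma> s) = \<gamma> (s + \<kappa>)" "\<kappa> \<noteq> 0" and v: "v \<in> range \<gamma>'"
  shows "g v \<notin> range \<gamma>'"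
proof
  assume gv: "g v \<in> range \<gamma>'"
  note hg = blineD(1) [OF b] and hg' = blineD(1) [OF b']
  have vC: "v \<in> C" "g v \<in> C" "g (g v) \<in> C" using v blineD(5) [OF b'] deckD(1) [OF g(1)] by blast+
  have "g ` range \<gamma>' \<subseteq> range \<gamma>'"
  proof (rule components_maximal [OF blineD(3) [OF b']])
    have "continuous_on (range \<gamma>') g"
      using g(1) blineD(5) [OF b'] by (auto simp: deck_def intro: continuous_on_subset)
    then show "connected (g ` range \<gamma>')"
      using in_components_connected [OF blineD(3) [OF b']] by (rule connected_continuous_image)
    show "g ` range \<gamma>' \<subseteq> bdC" using deck_frontier [OF g(1)] blineD(6) [OF b'] by blast
    show "range \<gamma>' \<inter> g ` range \<gamma>' \<noteq> {}" using gv v by blast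
  qed
  then have ggv: "g (g v) \<in> range \<gamma>'" using gv by blast
  obtain t0 t1 t2 where t: "v = \<gamma>' t0" "g v = \<gamma>' t1" "g (g v) = \<gamma>' t2" using v gv ggv by blast
  obtain \<sigma> where foot: "hfoot e f v \<sigma>" using hfoot_exists [OF hg C_hplaneD [OF vC(1)]] by blast
  note f1 = hfoot_deck [OF b g(1,2) vC(1) foot]
  note f2 = hfoot_deck [OF b g(1,2) vC(2) f1(1)]
  define \<rho> where "\<rho> = hdist v (\<gamma> \<sigma>)"
  have vn: "mink (hvec w) n = - sinh \<rho>" if w: "w \<in> C" "hfoot e f w s" "hdist w (\<gamma> s) = \<rho>" for w s
  proof -
    obtain \<rho>' where "hvec w = cosh \<rho>' *\<^sub>R hvec (\<gamma> s) + sinh \<rho>' *\<^sub>R n" "hdist w (\<gamma> s) = \<rho>'"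
      using foot_normal [OF b w(1,2)] by metis
    then show ?thesis using blineD(7,12) [OF b] w(3) by simp
  qed
  have n0: "mink (hvec v) n = - sinh \<rho>" using vn [OF vC(1) foot] by (simp add: \<rho>_def)
  have n1: "mink (hvec (g v)) n = - sinh \<rho>" using vn [OF vC(2) f1(1)] f1(2) by (simp add: \<rho>_def)
  have n2: "mink (hvec (g (g v))) n = - sinh \<rho>" using vn [OF vC(3) f2(1)] f2(2) f1(2) by (simp add: \<rho>_def)
  have "v \<notin> range \<gamma>" using bline_disjoint [OF b b'] ne v by blast
  then have "mink (hvec v) n \<noteq> 0" using in_bline_iff [OF b C_hplaneD [OF vC(1)]] by simp
  then have \<rho>: "sinh \<rho> \<noteq> 0" using n0 by simp
  have dist_feet: "w \<noteq> w'" if "hfoot e f w s" "hfoot e f w' s'" "s \<noteq> s'" "w \<in> C" for w w' s s'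
  proof
    assume "w = w'"
    then have "cosh (hdist w (\<gamma> s)) * sinh (s' - s) = 0"
      using hfoot_functional(2) [OF hg C_hplaneD [OF that(4)] that(1), of s'] that(2) by (simp add: hfoot_def)
    then show False using that(3) by simp
  qed
  have "v \<noteq> g v" "v \<noteq> g (g v)"
    using dist_feet [OF foot f1(1)] dist_feet [OF foot f2(1)] g(3) vC(1) by auto
  then have tne: "t0 \<noteq> t1" "t0 \<noteq> t2" using t by auto
  have "\<bar>t1 - t2\<bar> = \<bar>t0 - t1\<bar>"
    using deck_isometry [OF g(1) vC(1,2)] hgeo_dist [OF hg', of t1 t2] hgeo_dist [OF hg', of t0 t1] by (metis t)
  then have t2: "t2 - t1 = t1 - t0" using tne by (auto simp: abs_if split: if_splits)
  define D where "D = t1 - t0"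
  have "mink (hvec (\<gamma>' (t1 - D))) n + mink (hvec (\<gamma>' (t1 + D))) n = 2 * cosh D * mink (hvec (\<gamma>' t1)) n"
    by (simp add: hgeoD(7) [OF hg'] cosh_add cosh_diff sinh_add sinh_diff algebra_simps)
  moreover have "t1 - D = t0" "t1 + D = t2" using t2 by (auto simp: D_def)
  ultimately have "mink (hvec v) n + mink (hvec (g (g v))) n = 2 * cosh D * mink (hvec (g v)) n"
    using t by metis
  then have "cosh D = 1" using \<rho> by (simp add: n0 n1 n2)
  then have "D = 0" by (metis cosh_real_one_iff)
  then show False using tne by (simp add: D_def)
qed

text \<open>
  If the feet of two points of \<open>\<gamma>'\<close> are at least the translation length apart,
  then by continuity some point of \<open>\<gamma>'\<close> has the same foot as the translate of
  \<open>\<gamma>' t\<close>. Disjointness of shadows puts that translate on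
  \<open>\<gamma>'\<close>, which \<open>translation_moves_other\<close> excludes.
\<close>

lemma shadow_short:
  assumes b: "bline \<gamma> e f n" and b': "bline \<gamma>' e' f' n'" and ne: "range \<gamma> \<noteq> range \<gamma>'"
    and g: "deck g" "\<And>s. g (\<gamma> s) = \<gamma> (s + \<kappa>)" "\<kappa> \<noteq> 0"
    and foot: "hfoot e f (\<gamma>' t) \<sigma>" "hfoot e f (\<gamma>' t') \<sigma>'"
  shows "\<not> (\<kappa> \<le> \<sigma>' - \<sigma> \<and> 0 < \<kappa>) \<and> \<not> (\<sigma>' - \<sigma> \<le> \<kappa> \<and> \<kappa> < 0)"
proof (rule ccontr)
  assume asm: "\<not> ?thesis"
  note hg = blineD(1) [OF b] and hg' = blineD(1) [OF b']
  define T where "T = sinh (\<sigma> + \<kappa>) *\<^sub>R e + cosh (\<sigma> + \<kappa>) *\<^sub>R f"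
  define F where "F r = mink (hvec (\<gamma>' r)) T" for r
  have F: "F r = cosh (hdist (\<gamma>' r) (\<gamma> s)) * sinh (\<sigma> + \<kappa> - s)" if "hfoot e f (\<gamma>' r) s" for r s
    using hfoot_functional(2) [OF hg hgeoD(5) [OF hg'] that, of "\<sigma> + \<kappa>"] by (simp add: F_def T_def)
  have "continuous_on (closed_segment t t') F"
    unfolding F_def hgeoD(7) [OF hg'] by (simp, intro continuous_intros)
  moreover have "0 \<in> closed_segment (F t) (F t')"
  proof -
    have "F t \<le> 0 \<and> F t' \<ge> 0 \<or> F t \<ge> 0 \<and> F t' \<le> 0"
      using asm F [OF foot(1)] F [OF foot(2)] by (auto simp: mult_le_0_iff zero_le_mult_iff)
    then show ?thesis by (auto simp: closed_segment_eq_real_ivl)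
  qed
  ultimately obtain r where r: "F r = 0" by (metis IVT'_closed_segment_real)
  have vC: "\<gamma>' t \<in> C" by (rule blineD(5) [OF b'])
  have z2: "g (\<gamma>' t) \<in> bdC" by (rule deck_frontier [OF g(1) blineD(6) [OF b']])
  obtain \<gamma>2 e2 f2 n2 where b2: "bline \<gamma>2 e2 f2 n2" "g (\<gamma>' t) \<in> range \<gamma>2" using bline_through [OF z2] by blast
  have "g (\<gamma>' t) \<notin> range \<gamma>"
  proof
    assume "g (\<gamma>' t) \<in> range \<gamma>"
    then obtain s where "g (\<gamma>' t) = \<gamma> s" by blast
    then have "g (\<gamma>' t) = g (\<gamma> (s - \<kappa>))" by (simp add: g(2))
    then have "\<gamma>' t = \<gamma> (s - \<kappa>)" using deck_inverse [OF g(1)] vC blineD(5) [OF b] by metis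
    then show False using bline_disjoint [OF b b', of "\<gamma>' t"] ne by (metis rangeI)
  qed
  then have ne2: "range \<gamma>2 \<noteq> range \<gamma>" using b2(2) by blast
  have "\<gamma>' r = g (\<gamma>' t)"
    by (rule shadows_disjoint [OF b b' b2(1) ne [symmetric] ne2 rangeI b2(2), where \<sigma> = "\<sigma> + \<kappa>"])
       (use r hfoot_deck(1) [OF b g(1,2) vC foot(1)] in \<open>auto simp: F_def T_def hfoot_def\<close>)
  then show False using translation_moves_other [OF b b' ne g, of "\<gamma>' t"] by (metis rangeI)
qed

text \<open>
  The centre \<open>y0\<close> is the foot of \<open>\<gamma>' t\<close>. Two legs follow
  \<open>\<gamma>\<close> in both directions and one follows \<open>\<gamma>'\<close>, all ending at
  lifts of \<open>p y0\<close>. The foot of the third end is within \<open>L\<close> of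
  \<open>y0\<close> because the shadow of \<open>\<gamma>'\<close> is short, so the third leg runs
  along \<open>\<gamma>\<close> for no longer than that and its Gromov products with points of
  \<open>\<gamma>\<close> are at most \<open>L + 1\<close>.
\<close>

lemma tripod_near:
  assumes L: "boundary_length d \<le> ereal L"
    and b: "bline \<gamma> e f n" and b': "bline \<gamma>' e' f' n'" and ne: "range \<gamma> \<noteq> range \<gamma>'"
    and near: "hdist (\<gamma> s0) (\<gamma>' t) \<le> 32"
  obtains y0 where "y0 \<in> C" "tripod {z \<in> C. p z = p y0} (L + 1) (2 * L + 15) (3 * L + 79) y0"
proof -
  note hg = blineD(1) [OF b] and hg' = blineD(1) [OF b']
  have H: "\<gamma> r \<in> hplane" "\<gamma>' r \<in> hplane" for r using hgeoD(5) hg hg' by auto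
  obtain g \<tau> where g: "deck g" "\<And>s. g (\<gamma> s) = \<gamma> (s + \<tau>)" "\<tau> \<noteq> 0" "\<bar>\<tau>\<bar> \<le> L"
    using bline_translation [OF b L] by metis
  obtain h where h: "deck h" "\<And>z. z \<in> C \<Longrightarrow> h (g z) = z" using deck_inverse [OF g(1)] by blast
  have h2: "h (\<gamma> s) = \<gamma> (s + - \<tau>)" for s using h(2) [OF blineD(5) [OF b], of "s - \<tau>"] by (simp add: g(2))
  obtain \<sigma> where \<sigma>: "hfoot e f (\<gamma>' t) \<sigma>" using hfoot_exists [OF hg H(2)] by blast
  define y0 where "y0 = \<gamma> \<sigma>"
  have y0: "y0 \<in> C" "p y0 \<in> bdry_Sigma11" using blineD(5,6) [OF b] bdry_C by (auto simp: y0_def)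
  have y0v: "hdist (\<gamma>' t) y0 \<le> 32"
  proof -
    have "cosh (hdist (\<gamma>' t) y0) * 1 \<le> cosh (hdist (\<gamma>' t) (\<gamma> s0))"
      unfolding hfoot_functional(1) [OF hg H(2) \<sigma>, of s0] y0_def
      by (intro mult_left_mono cosh_real_ge_1) auto
    then have "hdist (\<gamma>' t) y0 \<le> hdist (\<gamma>' t) (\<gamma> s0)" using H by (simp add: y0_def cosh_real_nonneg_le_iff)
    then show ?thesis using near by (simp add: hdist_commute)
  qed
  define l where "l = 2 * L + 15"
  have L0: "L > 0" using g(3,4) by linarith
  \<comment> \<open>The third leg starts at distance at most \<open>32\<close> from \<open>y0\<close>, so \<open>l + 32\<close> along \<open>\<gamma>'\<close> is enough.\<close>
  obtain t3 where t3: "t + (l + 32) \<le> t3" "t3 \<le> t + (l + 32) + L" "p (\<gamma>' t3) = p y0"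
    using bline_dense [OF b' L y0(2), of "t + (l + 32)"] by blast
  obtain \<sigma>3 where \<sigma>3: "hfoot e f (\<gamma>' t3) \<sigma>3" using hfoot_exists [OF hg H(2)] by blast
  have sh: "\<bar>\<sigma>3 - \<sigma>\<bar> \<le> L"
    using shadow_short [OF b b' ne g(1-3) \<sigma> \<sigma>3] shadow_short [OF b b' ne h(1) h2 _ \<sigma> \<sigma>3] g(3,4) by linarith
  have d3: "l \<le> hdist y0 (\<gamma>' t3)" "hdist y0 (\<gamma>' t3) \<le> l + L + 64"
  proof -
    have "hdist (\<gamma>' t) (\<gamma>' t3) = t3 - t" using t3(1) L0 by (simp add: hgeo_dist [OF hg'] l_def)
    moreover have "hdist (\<gamma>' t) (\<gamma>' t3) \<le> hdist (\<gamma>' t) y0 + hdist y0 (\<gamma>' t3)"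
      "hdist y0 (\<gamma>' t3) \<le> hdist y0 (\<gamma>' t) + hdist (\<gamma>' t) (\<gamma>' t3)"
      unfolding y0_def by (intro hdist_triangle H)+
    ultimately show "l \<le> hdist y0 (\<gamma>' t3)" "hdist y0 (\<gamma>' t3) \<le> l + L + 64"
      using t3 y0v hdist_commute [of y0 "\<gamma>' t"] by linarith+
  qed
  have gp: "gprod (\<gamma> s) (\<gamma>' t3) y0 \<le> L + 1" for s
  proof -
    define a c where "a = \<bar>s - \<sigma>3\<bar>" and "c = \<bar>\<sigma>3 - \<sigma>\<bar>"
    have "hdist (\<gamma>' t3) (\<gamma> s) \<ge> hdist (\<gamma>' t3) (\<gamma> \<sigma>3) + a - 2"
      unfolding a_def by (rule cosh_mult_lower) (use hfoot_functional(1) [OF hg H(2) \<sigma>3, of s] H in auto)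
    moreover have "hdist (\<gamma>' t3) y0 \<le> hdist (\<gamma>' t3) (\<gamma> \<sigma>3) + c"
      using hdist_triangle [of "\<gamma>' t3" "\<gamma> \<sigma>3" "\<gamma> \<sigma>"] H by (simp add: y0_def hgeo_dist [OF hg] c_def)
    moreover have "hdist (\<gamma> s) y0 \<le> a + c" by (simp add: y0_def hgeo_dist [OF hg] a_def c_def)
    moreover have "c \<le> L" using sh by (simp add: c_def)
    ultimately show ?thesis unfolding gprod_def hdist_commute [of "\<gamma> s" "\<gamma>' t3"] by argo
  qed
  \<comment> \<open>\<open>k\<close> translation lengths are at least \<open>l\<close>, and exceed it by at most \<open>L\<close>.\<close>
  define k where "k = \<lceil>l / \<bar>\<tau>\<bar>\<rceil>"
  have "l / \<bar>\<tau>\<bar> \<le> of_int k" "of_int k \<le> l / \<bar>\<tau>\<bar> + 1" by (auto simp: k_def)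
  then have k: "l \<le> of_int k * \<bar>\<tau>\<bar>" "of_int k * \<bar>\<tau>\<bar> \<le> l + \<bar>\<tau>\<bar>" using g(3) by (simp_all add: field_simps)
  have k0: "of_int k * \<bar>\<tau>\<bar> \<ge> 0" using k(1) L0 by (simp add: l_def)
  define u w where "u = \<gamma> (\<sigma> + of_int k * \<tau>)" and "w = \<gamma> (\<sigma> + of_int (- k) * \<tau>)"
  have absk: "\<bar>of_int k * \<tau>\<bar> = of_int k * \<bar>\<tau>\<bar>" using k0 by (simp add: abs_mult zero_le_mult_iff g(3))
  have uw: "hdist y0 u = of_int k * \<bar>\<tau>\<bar>" "hdist y0 w = of_int k * \<bar>\<tau>\<bar>" "hdist u w = 2 * (of_int k * \<bar>\<tau>\<bar>)"
    using absk by (auto simp: y0_def u_def w_def hgeo_dist [OF hg] abs_mult)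
  have P: "p u = p y0" "p w = p y0" unfolding u_def w_def y0_def by (rule bline_periodic [OF b g(1,2)])+
  have C: "u \<in> C" "w \<in> C" "\<gamma>' t3 \<in> C" using blineD(5) [OF b] blineD(5) [OF b'] by (auto simp: u_def w_def)
  have "tripod {z \<in> C. p z = p y0} (L + 1) (2 * L + 15) (3 * L + 79) y0"
    unfolding tripod_def
  proof (intro bexI conjI ballI)
    show "gprod u w y0 \<le> L + 1" using uw L0 by (simp add: gprod_def hdist_commute [of _ y0])
    show "gprod w (\<gamma>' t3) y0 \<le> L + 1" "gprod u (\<gamma>' t3) y0 \<le> L + 1" unfolding u_def w_def by (rule gp)+
    fix a assume "a \<in> {u, w, \<gamma>' t3}"
    then show "2 * L + 15 \<le> hdist y0 a" "hdist y0 a \<le> 3 * L + 79"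
      using uw k d3 g(4) L0 by (auto simp: l_def)
  qed (use C P t3 in auto)
  with y0(1) that show ?thesis by blast
qed

text \<open>
  If two boundary geodesics come within distance \<open>32\<close>, the tripods stand on a single
  fibre of \<open>p\<close>, otherwise on all points of \<open>C\<close>. The maximal leg length
  \<open>3 * L + 79\<close> covers both.
\<close>

lemma tripods_exist:
  assumes L: "boundary_length d \<le> ereal L"
  obtains A c l where "A \<subseteq> C" "A \<noteq> {}" "c \<ge> 0" "l \<ge> 2 * c + 13" "\<And>y. y \<in> A \<Longrightarrow> tripod A c l (3 * L + 79) y"
    "L > 0"
proof -
  obtain \<gamma>0 e0 f0 n0 where b0: "bline \<gamma>0 e0 f0 n0" using bline_exists_some by blast
  then have L0: "L > 0" using bline_translation [OF b0 L] by (metis zero_less_abs_iff less_le_trans)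
  show ?thesis
  proof (cases "\<forall>\<gamma> e f n \<gamma>' e' f' n' s t. bline \<gamma> e f n \<longrightarrow> bline \<gamma>' e' f' n' \<longrightarrow>
      hdist (\<gamma> s) (\<gamma>' t) \<le> 32 \<longrightarrow> range \<gamma> = range \<gamma>'")
    case False
    then obtain \<gamma> e f n \<gamma>' e' f' n' s t where b: "bline \<gamma> e f n" "bline \<gamma>' e' f' n'" "range \<gamma> \<noteq> range \<gamma>'" "hdist (\<gamma> s) (\<gamma>' t) \<le> 32" by blast
    obtain y0 where y0: "y0 \<in> C" "tripod {z \<in> C. p z = p y0} (L + 1) (2 * L + 15) (3 * L + 79) y0"
      using tripod_near [OF L b] by blast
    show ?thesis
    proof (rule that [of "{z \<in> C. p z = p y0}" "L + 1" "2 * L + 15"])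
      show "tripod {z \<in> C. p z = p y0} (L + 1) (2 * L + 15) (3 * L + 79) y" if "y \<in> {z \<in> C. p z = p y0}" for y
        using tripod_deck [OF y0(2) y0(1) refl] that by simp
    qed (use y0 L0 in auto)
  next
    case True
    have T: "tripod C 1 15 15 y" if "y \<in> C" for y
      by (rule tripod_far [OF True [rule_format] that])
    have "tripod C 1 15 (3 * L + 79) y" if yC: "y \<in> C" for y
    proof -
      obtain u v w where uvw: "u \<in> C" "v \<in> C" "w \<in> C" "\<forall>t\<in>{u, v, w}. 15 \<le> hdist y t \<and> hdist y t \<le> 15"
        "gprod u v y \<le> 1 \<and> gprod v w y \<le> 1 \<and> gprod u w y \<le> 1"
        using T [OF yC] unfolding tripod_def by blast
      have "\<forall>t\<in>{u, v, w}. 15 \<le> hdist y t \<and> hdist y t \<le> 3 * L + 79" using uvw(4) L0 by fastforce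
      then show ?thesis unfolding tripod_def using uvw by blast
    qed
    moreover have "C \<noteq> {}" using blineD(5) [OF b0] by blast
    ultimately show ?thesis using that [of C 1 15] L0 by auto
  qed
qed

end

section \<open>Orbit counting and entropy\<close>

lemma const_over_tendsto_0: "filterlim g at_top F \<Longrightarrow> ((\<lambda>x. k / g x) \<longlongrightarrow> (0::real)) F" for k :: real
  by (rule tendsto_divide_0 [OF tendsto_const filterlim_at_top_imp_at_infinity])

text \<open>
  Fekete's subadditive limit for a real parameter; monotonicity takes care of the remainder when
  \<open>R\<close> is divided by \<open>T\<close>.
\<close>

lemma fekete_real:
  fixes a :: "real \<Rightarrow> real"
  assumes sub: "\<And>R S. R > 0 \<Longrightarrow> S > 0 \<Longrightarrow> a (R + S) \<le> a R + a S"
    and nonneg: "\<And>R. R > 0 \<Longrightarrow> a R \<ge> 0" and mono: "\<And>R S. 0 < R \<Longrightarrow> R \<le> S \<Longrightarrow> a R \<le> a S"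
  obtains h where "((\<lambda>R. a R / R) \<longlongrightarrow> h) at_top"
proof -
  define Q where "Q = (\<lambda>T. a T / T) ` {0<..}"
  have ne: "Q \<noteq> {}" by (auto simp: Q_def)
  have bdd: "bdd_below Q" using nonneg by (intro bdd_belowI [of _ 0]) (auto simp: Q_def)
  define h where "h = Inf Q"
  have low: "h \<le> a R / R" if "R > 0" for R
    unfolding h_def using that by (intro cInf_lower bdd) (auto simp: Q_def)
  have mult: "a (real (Suc n) * T) \<le> real (Suc n) * a T" if "T > 0" for n T
  proof (induction n)
    case (Suc n)
    have "a (real (Suc n) * T + T) \<le> a (real (Suc n) * T) + a T" using that by (intro sub) auto
    then show ?case using Suc by (simp add: algebra_simps)
  qed simp
  have "((\<lambda>R. a R / R) \<longlongrightarrow> h) at_top"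
  proof (rule order_tendstoI)
    fix l assume "l < h"
    then show "\<forall>\<^sub>F R in at_top. l < a R / R"
      by (intro eventually_mono [OF eventually_gt_at_top [of 0]]) (use low less_le_trans in blast)
  next
    fix u assume "h < u"
    then obtain T where T: "T > 0" "a T / T < u"
      using cInf_lessD [OF ne, of u] by (auto simp: h_def Q_def)
    have "((\<lambda>R. a T / T + a T / R) \<longlongrightarrow> a T / T + 0) at_top"
      by (intro tendsto_add tendsto_const const_over_tendsto_0 filterlim_ident)
    then have "\<forall>\<^sub>F R in at_top. a T / T + a T / R < u" using T(2) by (intro order_tendstoD(2)) auto
    moreover have "\<forall>\<^sub>F R in at_top. a R / R \<le> a T / T + a T / R"
    proof (rule eventually_mono [OF eventually_gt_at_top [of 0]])
      fix R :: real assume R: "R > 0"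
      define n where "n = nat \<lfloor>R / T\<rfloor>"
      have n: "R / T \<le> real (Suc n)" "real n \<le> R / T" using R T by (auto simp: n_def) linarith
      have "a R \<le> a (real (Suc n) * T)" using R n(1) T(1) by (intro mono) (simp_all add: field_simps)
      also have "\<dots> \<le> real (Suc n) * a T" by (rule mult [OF T(1)])
      also have "\<dots> \<le> (R / T + 1) * a T" using n(2) nonneg [OF T(1)] by (intro mult_right_mono) auto
      finally have "a R / R \<le> ((R / T + 1) * a T) / R" using R by (intro divide_right_mono) auto
      also have "\<dots> = a T / T + a T / R" using R T by (simp add: field_simps)
      finally show "a R / R \<le> a T / T + a T / R" .
    qed
    ultimately show "\<forall>\<^sub>F R in at_top. a R / R < u"
      by eventually_elim simp
  qed
  then show ?thesis by (rule that)
qed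

lemma rate_shift:
  fixes a :: "real \<Rightarrow> real"
  assumes "((\<lambda>R. a R / R) \<longlongrightarrow> h) at_top"
  shows "((\<lambda>R. (a (R - c) + k) / R) \<longlongrightarrow> h) at_top"
proof -
  have f: "filterlim (\<lambda>R. R - c) at_top (at_top :: real filter)"
    using filterlim_tendsto_add_at_top [OF tendsto_const filterlim_ident, of "- c"] by (simp add: add.commute)
  have "((\<lambda>R. a (R - c) / (R - c) * (1 - c / R) + k / R) \<longlongrightarrow> h * (1 - 0) + 0) at_top"
    by (intro tendsto_intros filterlim_compose [OF assms f] const_over_tendsto_0 filterlim_ident)
  then have "((\<lambda>R. a (R - c) / (R - c) * (1 - c / R) + k / R) \<longlongrightarrow> h) at_top" by simp
  moreover have "\<forall>\<^sub>F R in at_top. a (R - c) / (R - c) * (1 - c / R) + k / R = (a (R - c) + k) / R"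
    by (rule eventually_mono [OF eventually_gt_at_top [of "max 0 c"]]) (auto simp: field_simps)
  ultimately show ?thesis by (rule Lim_transform_eventually)
qed

lemma packing_harea:
  fixes r b :: real
  assumes F: "finite F" "F \<subseteq> hplane" and sep: "\<And>z w. z \<in> F \<Longrightarrow> w \<in> F \<Longrightarrow> z \<noteq> w \<Longrightarrow> 2 * r \<le> hdist z w"
    and b: "b \<ge> 0" "\<And>z. z \<in> hplane \<Longrightarrow> ennreal b \<le> emeasure harea (hball z r)"
    and S: "S \<in> sets borel" "\<And>z. z \<in> F \<Longrightarrow> hball z r \<subseteq> S"
  shows "ennreal (card F * b) \<le> emeasure harea S"
proof -
  have disj: "disjoint_family_on (\<lambda>z. hball z r) F"
    unfolding disjoint_family_on_def
  proof (intro ballI impI)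
    fix z w assume zw: "z \<in> F" "w \<in> F" "z \<noteq> w"
    show "hball z r \<inter> hball w r = {}"
    proof (rule ccontr)
      assume "\<not> ?thesis"
      then obtain u where u: "u \<in> hplane" "hdist z u < r" "hdist w u < r" by (auto simp: hball_def)
      have "hdist z w \<le> hdist z u + hdist w u"
        using hdist_triangle [of z u w] zw F(2) u(1) hdist_commute [of u w] by auto
      then show False using sep [OF zw] u by linarith
    qed
  qed
  have "ennreal (card F * b) = (\<Sum>z\<in>F. ennreal b)"
    using b(1) by (simp add: ennreal_mult ennreal_of_nat_eq_real_of_nat)
  also have "\<dots> \<le> (\<Sum>z\<in>F. emeasure harea (hball z r))" using b(2) F(2) by (intro sum_mono) auto
  also have "\<dots> = emeasure harea (\<Union>z\<in>F. hball z r)"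
    using F disj by (intro sum_emeasure) auto
  also have "\<dots> \<le> emeasure harea S" using S by (intro emeasure_mono) auto
  finally show ?thesis .
qed

lemma covering_harea:
  fixes r B :: real
  assumes F: "finite F" "F \<subseteq> hplane" and S: "S \<subseteq> (\<Union>z\<in>F. hball z r)"
    and B: "B \<ge> 0" "\<And>z. z \<in> hplane \<Longrightarrow> emeasure harea (hball z r) \<le> ennreal B"
  shows "emeasure harea S \<le> ennreal (card F * B)"
proof -
  have "emeasure harea S \<le> emeasure harea (\<Union>z\<in>F. hball z r)"
    using F S hball_sets by (intro emeasure_mono) (auto intro!: sets.finite_UN)
  also have "\<dots> \<le> (\<Sum>z\<in>F. emeasure harea (hball z r))"
    using F by (intro emeasure_subadditive_finite) auto
  also have "\<dots> \<le> (\<Sum>z\<in>F. ennreal B)" using B(2) F(2) by (intro sum_mono) auto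
  also have "\<dots> = ennreal (card F * B)" using B(1) by (simp add: ennreal_mult ennreal_of_nat_eq_real_of_nat)
  finally show ?thesis .
qed

lemma hball_mono:
  assumes "x \<in> hplane" "z \<in> hplane" "hdist x z + r \<le> R"
  shows "hball z r \<subseteq> hball x R"
proof
  fix u assume u: "u \<in> hball z r"
  then have "hdist x u \<le> hdist x z + hdist z u" using assms by (intro hdist_triangle) (auto simp: hball_def)
  then show "u \<in> hball x R" using u assms by (auto simp: hball_def)
qed

context hyp_cover
begin

definition vol :: "complex \<Rightarrow> real \<Rightarrow> real" where
  "vol x R = measure harea (C \<inter> hball x R)"

definition cnt :: "complex \<Rightarrow> real \<Rightarrow> nat" where
  "cnt x R = card (orb \<inter> hball x R)"

lemma C_borel: "C \<in> sets borel"
proof -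
  obtain T where "closed T" "C = hplane \<inter> T" using closedin_C by (auto simp: closedin_closed)
  then show ?thesis using open_hplane by auto
qed

lemma C_hball_borel: "x \<in> hplane \<Longrightarrow> C \<inter> hball x R \<in> sets borel"
  using C_borel hball_sets by auto

lemma orb_hplane: "orb \<subseteq> hplane"
  using orb_C C_hplane by blast

lemma finite_orb_ball:
  assumes x: "x \<in> hplane"
  shows "finite (orb \<inter> hball x R)"
proof -
  obtain r where r: "r > 0" "\<And>z w. z \<in> orb \<Longrightarrow> w \<in> orb \<Longrightarrow> z \<noteq> w \<Longrightarrow> 2 * r \<le> hdist z w"
    using orb_interior by metis
  obtain b where b: "b > 0" "\<And>z. z \<in> hplane \<Longrightarrow> ennreal b \<le> emeasure harea (hball z r)"
    using harea_hball_lower [OF r(1)] by blast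
  obtain B where B: "B > 0" "\<And>z. z \<in> hplane \<Longrightarrow> emeasure harea (hball z (R + r)) \<le> ennreal B"
    using harea_hball_upper by blast
  have bound: "card F \<le> nat \<lceil>B / b\<rceil>" if F: "finite F" "F \<subseteq> orb \<inter> hball x R" for F
  proof -
    have "ennreal (card F * b) \<le> emeasure harea (hball x (R + r))"
    proof (rule packing_harea [OF F(1), where r = r])
      show "F \<subseteq> hplane" using F(2) orb_hplane by blast
      show "2 * r \<le> hdist z w" if "z \<in> F" "w \<in> F" "z \<noteq> w" for z w using that F(2) r(2) by blast
      show "hball z r \<subseteq> hball x (R + r)" if "z \<in> F" for z
        using that F(2) x by (intro hball_mono) (auto simp: hball_def)
    qed (use b x in auto)
    also have "\<dots> \<le> ennreal B" by (rule B(2) [OF x])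
    finally have "card F * b \<le> B" using B(1) by simp
    then have "real (card F) \<le> B / b" using b(1) by (simp add: field_simps)
    then show ?thesis by linarith
  qed
  then show ?thesis using finite_if_finite_subsets_card_bdd by (metis)
qed

lemma vol_finite:
  assumes x: "x \<in> hplane"
  shows "emeasure harea (C \<inter> hball x R) = ennreal (vol x R)"
proof -
  obtain B where B: "B > 0" "\<And>z. z \<in> hplane \<Longrightarrow> emeasure harea (hball z R) \<le> ennreal B"
    using harea_hball_upper by blast
  have "emeasure harea (C \<inter> hball x R) \<le> emeasure harea (hball x R)" using x by (intro emeasure_mono) auto
  also have "\<dots> < \<infinity>" using B(2) [OF x] by (metis ennreal_less_top infinity_ennreal_def le_less_trans)
  finally show ?thesis by (simp add: vol_def emeasure_eq_ennreal_measure)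
qed

lemma vol_lower:
  obtains r b :: real where "r > 0" "b > 0" "\<And>x R. x \<in> C \<Longrightarrow> cnt x R * b \<le> vol x (R + r)"
proof -
  obtain r where r: "r > 0" "\<And>z. z \<in> orb \<Longrightarrow> hball z r \<subseteq> C"
    "\<And>z w. z \<in> orb \<Longrightarrow> w \<in> orb \<Longrightarrow> z \<noteq> w \<Longrightarrow> 2 * r \<le> hdist z w"
    using orb_interior by metis
  obtain b where b: "b > 0" "\<And>z. z \<in> hplane \<Longrightarrow> ennreal b \<le> emeasure harea (hball z r)"
    using harea_hball_lower [OF r(1)] by blast
  have "real (cnt x R) * b \<le> vol x (R + r)" if x: "x \<in> C" for x R
  proof -
    note xH = C_hplaneD [OF x]
    have "ennreal (card (orb \<inter> hball x R) * b) \<le> emeasure harea (C \<inter> hball x (R + r))"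
    proof (rule packing_harea [OF finite_orb_ball [OF xH], where r = r])
      show "orb \<inter> hball x R \<subseteq> hplane" using orb_hplane by blast
      show "2 * r \<le> hdist z w" if "z \<in> orb \<inter> hball x R" "w \<in> orb \<inter> hball x R" "z \<noteq> w" for z w
        using that r(3) by blast
      show "hball z r \<subseteq> C \<inter> hball x (R + r)" if "z \<in> orb \<inter> hball x R" for z
        using that r(2) hball_mono [OF xH, of z r "R + r"] orb_hplane by (auto simp: hball_def)
    qed (use b C_hball_borel [OF xH] in auto)
    then show ?thesis unfolding vol_finite [OF xH] cnt_def by (simp add: vol_def)
  qed
  then show ?thesis by (rule that [OF r(1) b(1)])
qed

lemma near_orb:
  obtains D where "D > 0" "\<And>x. x \<in> C \<Longrightarrow> \<exists>z\<in>orb. hdist x z \<le> D"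
proof -
  obtain D where D: "D > 0" "\<And>x q. x \<in> C \<Longrightarrow> q \<in> Sigma11 \<Longrightarrow> \<exists>y\<in>C. p y = q \<and> hdist x y \<le> D"
    using cobounded by metis
  show ?thesis using that [OF D(1)] D(2) [OF _ q0_Sigma11] unfolding orb_def by blast
qed

lemma cnt_orb_le:
  assumes z: "z \<in> orb" "z0 \<in> orb"
  shows "cnt z R \<le> cnt z0 R"
proof -
  obtain g where g: "deck g" "g z = z0"
    using deck_exists [of z z0] z by (auto simp: orb_def)
  have C: "w \<in> C" if "w \<in> orb" for w using that orb_C by blast
  show ?thesis unfolding cnt_def
  proof (rule card_inj_on_le [of g])
    show "inj_on g (orb \<inter> hball z R)"
      by (rule inj_onI) (metis deck_inverse [OF g(1)] C IntD1)
    show "g ` (orb \<inter> hball z R) \<subseteq> orb \<inter> hball z0 R"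
    proof
      fix w assume "w \<in> g ` (orb \<inter> hball z R)"
      then obtain v where v: "v \<in> orb" "v \<in> hball z R" "w = g v" by blast
      have "hdist z0 w = hdist z v" using deck_isometry [OF g(1) C [OF z(1)] C [OF v(1)]] g(2) v(3) by simp
      moreover have "w \<in> orb" using v deckD [OF g(1)] by (auto simp: orb_def)
      ultimately show "w \<in> orb \<inter> hball z0 R" using v(2) orb_hplane by (auto simp: hball_def)
    qed
    show "finite (orb \<inter> hball z0 R)" using finite_orb_ball z(2) orb_hplane by blast
  qed
qed

text \<open>
  Cut the segment from \<open>z0\<close> to an orbit point in proportion \<open>R : S\<close>. As
  \<open>C\<close> is convex the cut lies in \<open>C\<close>, so it is within \<open>D\<close> of
  an orbit point \<open>z\<close>, and all orbit points see the same number of orbit points.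
\<close>

lemma cnt_submultiplicative:
  assumes D: "\<And>x. x \<in> C \<Longrightarrow> \<exists>z\<in>orb. hdist x z \<le> D" and z0: "z0 \<in> orb" and RS: "R > 0" "S > 0"
  shows "cnt z0 (R + S) \<le> cnt z0 (R + D) * cnt z0 (S + D)"
proof -
  have H: "w \<in> hplane" if "w \<in> orb" for w using that orb_hplane by blast
  have C: "w \<in> C" if "w \<in> orb" for w using that orb_C by blast
  let ?I = "orb \<inter> hball z0 (R + D)"
  have "orb \<inter> hball z0 (R + S) \<subseteq> (\<Union>z\<in>?I. orb \<inter> hball z (S + D))"
  proof
    fix w assume "w \<in> orb \<inter> hball z0 (R + S)"
    then have w: "w \<in> orb" "hdist z0 w < R + S" by (auto simp: hball_def)
    obtain \<sigma> :: "real \<Rightarrow> complex" where s: "\<sigma> ` {0..1} \<subseteq> C" and e: "\<sigma> 0 = z0" "\<sigma> 1 = w"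
      "\<And>s t. hdist (\<sigma> s) (\<sigma> t) = \<bar>s - t\<bar> * hdist z0 w" using hsegment_path [OF hconvex_C C [OF z0] C [OF w(1)]] by metis
    define t where "t = R / (R + S)"
    have t: "0 \<le> t" "t \<le> 1" "t * (R + S) = R" "(1 - t) * (R + S) = S" "0 < t" "t < 1" using RS by (auto simp: t_def field_simps)
    have m: "\<sigma> t \<in> C" using s t by auto
    have d: "hdist z0 (\<sigma> t) < R" "hdist (\<sigma> t) w < S"
    proof -
      have "hdist z0 (\<sigma> t) = t * hdist z0 w" using e(3) [of 0 t] t e(1) by simp
      also have "\<dots> < t * (R + S)" using w(2) t by (intro mult_strict_left_mono) auto
      finally show "hdist z0 (\<sigma> t) < R" using t by simp
      have "hdist (\<sigma> t) w = (1 - t) * hdist z0 w" using e(3) [of t 1] t e(2) by simp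
      also have "\<dots> < (1 - t) * (R + S)" using w(2) t by (intro mult_strict_left_mono) auto
      finally show "hdist (\<sigma> t) w < S" using t by simp
    qed
    obtain z where z: "z \<in> orb" "hdist (\<sigma> t) z \<le> D" using D [OF m] by blast
    have "hdist z0 z \<le> hdist z0 (\<sigma> t) + hdist (\<sigma> t) z"
      by (intro hdist_triangle H z0 z C_hplaneD m)
    moreover have "hdist z w \<le> hdist (\<sigma> t) z + hdist (\<sigma> t) w"
      using hdist_triangle [OF H [OF z(1)] C_hplaneD [OF m] H [OF w(1)]] by (simp add: hdist_commute)
    ultimately have "z \<in> ?I" "w \<in> orb \<inter> hball z (S + D)"
      using z d w H by (auto simp: hball_def)
    then show "w \<in> (\<Union>z\<in>?I. orb \<inter> hball z (S + D))" by blast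
  qed
  then have "card (orb \<inter> hball z0 (R + S)) \<le> card (\<Union>z\<in>?I. orb \<inter> hball z (S + D))"
    using finite_orb_ball H z0 by (intro card_mono finite_UN_I) auto
  also have "\<dots> \<le> (\<Sum>z\<in>?I. cnt z (S + D))"
    unfolding cnt_def using finite_orb_ball H z0 by (intro card_UN_le) auto
  also have "\<dots> \<le> (\<Sum>z\<in>?I. cnt z0 (S + D))" using cnt_orb_le z0 by (intro sum_mono) auto
  finally show ?thesis by (simp add: cnt_def)
qed

text \<open>
  Balls around orbit points pack \<open>C \<inter> hball z0 R\<close> from inside and cover it from
  outside, so the volume and the orbit count have the same exponential rate.
\<close>

lemma entropy_limit_exists:
  obtains z0 h where "z0 \<in> C" "((\<lambda>R. ln (vol z0 R) / R) \<longlongrightarrow> h) at_top"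
proof -
  obtain x where "x \<in> C" "p x = q0" using q0_Sigma11 p_image by (metis imageE)
  then have z0: "x \<in> orb" by (simp add: orb_def)
  define z0 where "z0 = x"
  note z0 = z0 [folded z0_def]
  have z0C: "z0 \<in> C" and z0H: "z0 \<in> hplane" using z0 orb_C C_hplaneD by auto
  obtain D where D: "D > 0" "\<And>x. x \<in> C \<Longrightarrow> \<exists>z\<in>orb. hdist x z \<le> D" using near_orb by blast
  obtain r b :: real where rb: "r > 0" "b > 0" "\<And>x R. x \<in> C \<Longrightarrow> real (cnt x R) * b \<le> vol x (R + r)" using vol_lower by blast
  obtain B where B: "B > 0" "\<And>z. z \<in> hplane \<Longrightarrow> emeasure harea (hball z (D + 1)) \<le> ennreal B"
    using harea_hball_upper by blast
  have cnt_mono: "cnt z0 R \<le> cnt z0 S" if "R \<le> S" for R S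
    unfolding cnt_def using that finite_orb_ball [OF z0H] by (intro card_mono) (auto simp: hball_def)
  have cnt_pos: "cnt z0 R \<ge> 1" if "R > 0" for R
  proof -
    have "z0 \<in> orb \<inter> hball z0 R" using z0 centre_in_hball [OF z0H that] by blast
    then show ?thesis unfolding cnt_def using finite_orb_ball [OF z0H]
      by (metis One_nat_def Suc_leI card_gt_0_iff empty_iff)
  qed
  have upper: "vol z0 R \<le> cnt z0 (R + D) * B" for R
  proof -
    have "emeasure harea (C \<inter> hball z0 R) \<le> ennreal (card (orb \<inter> hball z0 (R + D)) * B)"
    proof (rule covering_harea [where r = "D + 1"])
      show "finite (orb \<inter> hball z0 (R + D))" by (rule finite_orb_ball [OF z0H])
      show "orb \<inter> hball z0 (R + D) \<subseteq> hplane" using orb_hplane by blast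
      show "C \<inter> hball z0 R \<subseteq> (\<Union>z\<in>orb \<inter> hball z0 (R + D). hball z (D + 1))"
      proof
        fix y assume y: "y \<in> C \<inter> hball z0 R"
        then obtain z where z: "z \<in> orb" "hdist y z \<le> D" using D(2) by blast
        have zH: "z \<in> hplane" and yH: "y \<in> hplane" using z(1) orb_hplane y C_hplane by auto
        have "hdist z0 z \<le> hdist z0 y + hdist y z" by (intro hdist_triangle z0H zH yH)
        then have "z \<in> orb \<inter> hball z0 (R + D)" using y z zH by (auto simp: hball_def)
        moreover have "y \<in> hball z (D + 1)" using z(2) yH hdist_commute [of y z] by (auto simp: hball_def)
        ultimately show "y \<in> (\<Union>z\<in>orb \<inter> hball z0 (R + D). hball z (D + 1))" by blast
      qed
    qed (use B in auto)
    then show ?thesis unfolding vol_finite [OF z0H] cnt_def using B(1) by simp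
  qed
  \<comment> \<open>The shift by \<open>2 * D\<close> turns approximate submultiplicativity into subadditivity.\<close>
  define a where "a R = ln (real (cnt z0 (R + 2 * D)))" for R
  obtain h where h: "((\<lambda>R. a R / R) \<longlongrightarrow> h) at_top"
  proof (rule fekete_real [of a])
    show "a (R + S) \<le> a R + a S" if "R > 0" "S > 0" for R S
    proof -
      have "cnt z0 ((R + D) + (S + D)) \<le> cnt z0 (R + D + D) * cnt z0 (S + D + D)"
        using that D(1) by (intro cnt_submultiplicative [OF D(2) z0]) auto
      then have "real (cnt z0 (R + S + 2 * D)) \<le> real (cnt z0 (R + 2 * D)) * real (cnt z0 (S + 2 * D))"
        by (simp add: algebra_simps flip: of_nat_mult)
      moreover have pos: "real (cnt z0 (R + S + 2 * D)) > 0" "real (cnt z0 (R + 2 * D)) > 0" "real (cnt z0 (S + 2 * D)) > 0"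
        using cnt_pos [of "R + S + 2 * D"] cnt_pos [of "R + 2 * D"] cnt_pos [of "S + 2 * D"] that D(1) by auto
      ultimately have "ln (real (cnt z0 (R + S + 2 * D))) \<le> ln (real (cnt z0 (R + 2 * D)) * real (cnt z0 (S + 2 * D)))"
        by simp
      then show ?thesis using pos unfolding a_def by (simp add: ln_mult)
    qed
    show "a R \<ge> 0" if "R > 0" for R using cnt_pos [of "R + 2 * D"] that D(1) by (simp add: a_def)
    show "a R \<le> a S" if "0 < R" "R \<le> S" for R S
      using cnt_mono [of "R + 2 * D" "S + 2 * D"] cnt_pos [of "R + 2 * D"] that D(1) by (simp add: a_def)
  qed (rule that)
  have "((\<lambda>R. ln (vol z0 R) / R) \<longlongrightarrow> h) at_top"
  proof (rule tendsto_sandwich)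
    show "((\<lambda>R. (a (R - (r + 2 * D)) + ln b) / R) \<longlongrightarrow> h) at_top" "((\<lambda>R. (a (R - D) + ln B) / R) \<longlongrightarrow> h) at_top"
      by (rule rate_shift [OF h])+
    show "\<forall>\<^sub>F R in at_top. (a (R - (r + 2 * D)) + ln b) / R \<le> ln (vol z0 R) / R"
    proof (rule eventually_mono [OF eventually_gt_at_top [of r]])
      fix R assume R: "R > r"
      have c: "real (cnt z0 (R - r)) \<ge> 1" using cnt_pos [of "R - r"] R by simp
      have "a (R - (r + 2 * D)) + ln b = ln (real (cnt z0 (R - r)) * b)"
        using c rb(2) by (simp add: a_def ln_mult algebra_simps)
      also have "\<dots> \<le> ln (vol z0 R)"
      proof -
        have "real (cnt z0 (R - r)) * b > 0" using c rb(2) by simp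
        then show ?thesis using rb(3) [OF z0C, of "R - r"] by simp
      qed
      finally show "(a (R - (r + 2 * D)) + ln b) / R \<le> ln (vol z0 R) / R"
        using R rb(1) by (intro divide_right_mono) auto
    qed
    show "\<forall>\<^sub>F R in at_top. ln (vol z0 R) / R \<le> (a (R - D) + ln B) / R"
    proof (rule eventually_mono [OF eventually_gt_at_top [of r]])
      fix R assume R: "R > r"
      have c: "real (cnt z0 (R - r)) \<ge> 1" "real (cnt z0 (R + D)) \<ge> 1"
        using cnt_pos [of "R - r"] cnt_pos [of "R + D"] R rb(1) D(1) by auto
      have "real (cnt z0 (R - r)) * b > 0" using c(1) rb(2) by (intro mult_pos_pos) linarith+
      then have "vol z0 R > 0" using rb(3) [OF z0C, of "R - r"] by simp
      then have "ln (vol z0 R) \<le> ln (real (cnt z0 (R + D)) * B)" using upper [of R] by simp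
      also have "\<dots> = a (R - D) + ln B" using c B(1) by (simp add: a_def ln_mult algebra_simps)
      finally show "ln (vol z0 R) / R \<le> (a (R - D) + ln B) / R"
        using R rb(1) by (intro divide_right_mono) auto
    qed
  qed
  with z0C that show ?thesis by blast
qed

text \<open>
  The unit balls around the \<open>2 ^ n\<close> points of the tree are disjoint and covered by
  balls of a fixed radius around orbit points. Comparing areas, there are at least \<open>const * 2
  ^ n\<close> orbit points at distance about \<open>n * (3 * L + 79)\<close>.
\<close>

lemma entropy_lower_bound:
  assumes L: "boundary_length d \<le> ereal L" and x: "x \<in> C" and lim: "((\<lambda>R. ln (vol x R) / R) \<longlongrightarrow> h) at_top"
  shows "ln 2 / (3 * L + 79) \<le> h" "L > 0"
proof -
  obtain A c l where A: "A \<subseteq> C" "A \<noteq> {}" "c \<ge> 0" "l \<ge> 2 * c + 13" "\<And>y. y \<in> A \<Longrightarrow> tripod A c l (3 * L + 79) y"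
    and L0: "L > 0" using tripods_exist [OF L] by blast
  show "L > 0" by (rule L0)
  define \<Lambda> where "\<Lambda> = 3 * L + 79"
  have \<Lambda>: "\<Lambda> > 0" using L0 by (simp add: \<Lambda>_def)
  obtain y where y: "y \<in> A" using A(2) by blast
  have xH: "x \<in> hplane" and yH: "y \<in> hplane" and AH: "A \<subseteq> hplane" using x y A(1) C_hplane by auto
  obtain D where D: "D > 0" "\<And>x. x \<in> C \<Longrightarrow> \<exists>z\<in>orb. hdist x z \<le> D" using near_orb by blast
  obtain r b :: real where rb: "r > 0" "b > 0" "\<And>x R. x \<in> C \<Longrightarrow> real (cnt x R) * b \<le> vol x (R + r)" using vol_lower by blast
  obtain B where B: "B > 0" "\<And>z. z \<in> hplane \<Longrightarrow> emeasure harea (hball z (D + 1)) \<le> ennreal B"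
    using harea_hball_upper by blast
  obtain b1 where b1: "b1 > 0" "\<And>z. z \<in> hplane \<Longrightarrow> ennreal b1 \<le> emeasure harea (hball z 1)"
    using harea_hball_lower [of 1] by auto
  define k where "k = hdist x y + D + 1"
  have count: "2 ^ n * b1 \<le> real (cnt x (n * \<Lambda> + k)) * B" for n :: nat
  proof -
    obtain T where T: "T \<subseteq> A" "finite T" "card T = 2 ^ n" "\<And>t. t \<in> T \<Longrightarrow> hdist y t \<le> n * \<Lambda>"
      "\<And>t t'. t \<in> T \<Longrightarrow> t' \<in> T \<Longrightarrow> t \<noteq> t' \<Longrightarrow> 2 \<le> hdist t t'"
      using tripod_tree [OF AH A(5) A(3) A(4) y yH, of n] unfolding \<Lambda>_def by blast
    let ?S = "\<Union>t\<in>T. hball t 1" and ?F = "orb \<inter> hball x (n * \<Lambda> + k)"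
    have TH: "T \<subseteq> hplane" using T(1) AH by blast
    have "ennreal (card T * b1) \<le> emeasure harea ?S"
    proof (rule packing_harea [OF T(2) TH, where r = 1])
      show "?S \<in> sets borel" using T(2) TH hball_sets by (intro sets.finite_UN) auto
    qed (use T(5) b1 in auto)
    also have "\<dots> \<le> ennreal (card ?F * B)"
    proof (rule covering_harea [OF finite_orb_ball [OF xH], where r = "D + 1"])
      show "?F \<subseteq> hplane" using orb_hplane by blast
      show "?S \<subseteq> (\<Union>z\<in>?F. hball z (D + 1))"
      proof
        fix u assume "u \<in> ?S"
        then obtain t where t: "t \<in> T" "u \<in> hball t 1" by blast
        have tC: "t \<in> C" and tH: "t \<in> hplane" using t(1) T(1) A(1) C_hplane by auto
        obtain z where z: "z \<in> orb" "hdist t z \<le> D" using D(2) [OF tC] by blast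
        have zH: "z \<in> hplane" using z(1) orb_hplane by blast
        have "hdist x z \<le> hdist x t + hdist t z" "hdist x t \<le> hdist x y + hdist y t"
          by (intro hdist_triangle xH tH zH yH)+
        then have "hdist x z < n * \<Lambda> + k" using T(4) [OF t(1)] z(2) by (simp add: k_def)
        then have "z \<in> ?F" using z(1) zH by (simp add: hball_def)
        moreover have "u \<in> hball z (D + 1)"
          using hball_mono [OF zH tH, of 1 "D + 1"] z(2) t(2) hdist_commute [of t z] by auto
        ultimately show "u \<in> (\<Union>z\<in>?F. hball z (D + 1))" by blast
      qed
    qed (use B in auto)
    finally show ?thesis using B(1) by (simp add: T(3) cnt_def)
  qed
  define c0 where "c0 = b1 * b / B"
  have c0: "c0 > 0" using b1(1) rb(2) B(1) by (simp add: c0_def)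
  define R where "R n = real n * \<Lambda> + (k + r)" for n :: nat
  have low: "real n * ln 2 + ln c0 \<le> ln (vol x (R n))" for n
  proof -
    have "2 ^ n * c0 = (2 ^ n * b1) * (b / B)" by (simp add: c0_def)
    also have "\<dots> \<le> (real (cnt x (n * \<Lambda> + k)) * B) * (b / B)"
      using count [of n] B(1) rb(2) by (intro mult_right_mono) auto
    also have "\<dots> = real (cnt x (n * \<Lambda> + k)) * b" using B(1) by simp
    also have "\<dots> \<le> vol x (R n)" using rb(3) [OF x, of "n * \<Lambda> + k"] by (simp add: R_def add.assoc)
    finally have "2 ^ n * c0 \<le> vol x (R n)" .
    moreover have "2 ^ n * c0 > 0" using c0 by simp
    ultimately have "ln (2 ^ n * c0) \<le> ln (vol x (R n))" by simp
    then show ?thesis using c0 by (simp add: ln_mult ln_realpow)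
  qed
  have Rinf: "filterlim R at_top sequentially"
    unfolding R_def
    by (subst add.commute) (intro filterlim_tendsto_add_at_top [OF tendsto_const]
        filterlim_at_top_mult_tendsto_pos [OF tendsto_const \<Lambda>] filterlim_real_sequentially)
  have lim1: "(\<lambda>n. ln (vol x (R n)) / R n) \<longlonglongrightarrow> h"
    using filterlim_compose [OF lim Rinf] .
  have "(\<lambda>n. ln 2 / \<Lambda> + (ln c0 - (k + r) * ln 2 / \<Lambda>) / R n) \<longlonglongrightarrow> ln 2 / \<Lambda> + 0"
    by (intro tendsto_add tendsto_const const_over_tendsto_0 Rinf)
  then have lim2: "(\<lambda>n. ln 2 / \<Lambda> + (ln c0 - (k + r) * ln 2 / \<Lambda>) / R n) \<longlonglongrightarrow> ln 2 / \<Lambda>" by simp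
  have "\<forall>\<^sub>F n in sequentially. R n > 0"
    using Rinf by (auto simp: filterlim_at_top_dense)
  then have "\<forall>\<^sub>F n in sequentially. ln 2 / \<Lambda> + (ln c0 - (k + r) * ln 2 / \<Lambda>) / R n \<le> ln (vol x (R n)) / R n"
  proof eventually_elim
    case (elim n)
    have "ln 2 / \<Lambda> + (ln c0 - (k + r) * ln 2 / \<Lambda>) / R n = (R n * ln 2 / \<Lambda> + ln c0 - (k + r) * ln 2 / \<Lambda>) / R n"
      using elim by (simp add: field_simps)
    also have "R n * ln 2 / \<Lambda> + ln c0 - (k + r) * ln 2 / \<Lambda> = real n * ln 2 + ln c0"
      using \<Lambda> by (simp add: R_def field_simps)
    also have "\<dots> / R n \<le> ln (vol x (R n)) / R n" using low elim by (intro divide_right_mono) auto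
    finally show ?case .
  qed
  then show "ln 2 / (3 * L + 79) \<le> h"
    using tendsto_le [OF trivial_limit_sequentially lim1 lim2] by (simp add: \<Lambda>_def)
qed

end

text \<open>
  The lower bound holds for every realisation of the universal cover and every base point, in
  particular for those selected in the definition of the entropy, once the limit is known to exist.
\<close>

lemma volume_entropy_ge:
  assumes d: "hyperbolic_metric d" and L: "boundary_length d \<le> ereal L"
  shows "ln 2 / (3 * L + 79) \<le> volume_entropy d" "L > 0"
proof -
  let ?P = "\<lambda>h. \<exists>C p x. universal_cover d C p \<and> x \<in> C \<and>
        ((\<lambda>R. ln (measure harea (C \<inter> hball x R)) / R) \<longlongrightarrow> h) at_top"
  have "\<exists>h. ?P h"
  proof -
    obtain C p where "universal_cover d C p" using d by (auto simp: hyperbolic_metric_def)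
    then interpret hyp_cover d C p using d by unfold_locales
    obtain z0 h where "z0 \<in> C" "((\<lambda>R. ln (vol z0 R) / R) \<longlongrightarrow> h) at_top" by (rule entropy_limit_exists)
    then show ?thesis unfolding vol_def using cov by blast
  qed
  then have "?P (volume_entropy d)" unfolding volume_entropy_def by (rule someI_ex)
  then obtain C p x where C: "universal_cover d C p" "x \<in> C"
    "((\<lambda>R. ln (measure harea (C \<inter> hball x R)) / R) \<longlongrightarrow> volume_entropy d) at_top" by blast
  interpret hyp_cover d C p using d C(1) by unfold_locales
  show "ln 2 / (3 * L + 79) \<le> volume_entropy d" "L > 0"
    using entropy_lower_bound [OF L C(2)] C(3) unfolding vol_def by auto
qed

theorem theorem24:
  fixes X :: "nat \<Rightarrow> complex \<times> complex \<Rightarrow> complex \<times> complex \<Rightarrow> real"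
  assumes "\<And>n. hyperbolic_metric (X n)"
    and "(\<lambda>n. volume_entropy (X n)) \<longlonglongrightarrow> 0"
  shows "(\<lambda>n. boundary_length (X n)) \<longlonglongrightarrow> \<infinity>"
  unfolding tendsto_PInfty
proof
  fix L :: real
  define c where "c = ln 2 / (3 * max L 0 + 79)"
  have "c > 0" by (simp add: c_def)
  then have "\<forall>\<^sub>F n in sequentially. volume_entropy (X n) < c"
    using assms(2) by (intro order_tendstoD(2))
  then show "\<forall>\<^sub>F n in sequentially. ereal L < boundary_length (X n)"
  proof eventually_elim
    case (elim n)
    show ?case
    proof (rule ccontr)
      assume "\<not> ereal L < boundary_length (X n)"
      then have "boundary_length (X n) \<le> ereal L" by simp
      from volume_entropy_ge [OF assms(1) this] elim show False by (simp add: c_def)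
    qed
  qed
qed

end
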